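(* Let $X^{\bm\vartheta}(t)$ be the randomised composite process (with deterministic switching times) defined in the context. (i) The probability density function of $X^{\bm\vartheta}(t)$ is $$f(x;X^{\bm\vartheta}(t))=\bigl(\delta_{x_0}*f_{Y_0^{\vartheta_0}(s_0(t))}*\cdots*f_{Y_M^{\vartheta_M}(s_M(t))}\bigr)(x),$$ where $\delta_{x_0}$ is the Dirac delta translated to $x_0$ and $f_{Y_j^{\vartheta_j}(s_j(t))}(y):=f(y;Y_j^{\vartheta_j}(s_j(t)))=\int_{D_j}f(y;Y_j^{\theta}(s_j(t)))\,\mathrm{d}F_{\vartheta_j}(\theta)$, with $D_j$ the domain and $F_{\vartheta_j}$ the cdf of $\vartheta_j$. (ii) Let $N_0,\dots,N_M\in\mathbb{N}$. If, for every $j\in\{0,\dots,M\}$, the first $2N_j$ moments of $\vartheta_j$ are finite, $\mathbb{E}[\vartheta_j^{2N_j}]<\infty$, then $$f(x;X^{\bm\vartheta}(t))=\sum_{n_0,\dots,n_M=1}^{N_0,\dots,N_M}\Bigl(\prod_{j=0}^M w_{j,n_j}\Bigr) f\Bigl(x;x_0+\sum_{j=0}^M Y_j^{\theta_{j,n_j}}(s_j(t))\Bigr)+\bar\varepsilon(t)=\sum_{n_0,\dots,n_M=1}^{N_0,\dots,N_M}\Bigl(\prod_{j=0}^M w_{j,n_j}\Bigr) f\bigl(x;X^{(\theta_{0,n_0},\dots,\theta_{M,n_M})}(t)\bigr)+\bar\varepsilon(t),$$ where $(w_{j,n},\theta_{j,n})_{n=1}^{N_j}$ are the Gauss quadrature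 pairs associated with $\vartheta_j$, and the error term $\bar\varepsilon(t)$ (whose dependence on $x$ is suppressed in the notation) is bounded by $$\bar\varepsilon(t)\le\sum_{j=0}^M\sup_{y\in\mathbb{R}}\hat\varepsilon_{N_j}(s_j(t),y),$$ where $\hat\varepsilon_{N_j}(s,y):=f(y;Y_j^{\vartheta_j}(s))-\sum_{n=1}^{N_j}w_{j,n}f(y;Y_j^{\theta_{j,n}}(s))$ is the quadrature discretisation error of the density of the $j$-th randomised component process.
   Context: Fix $M\in\mathbb{N}$, $x_0\in\mathbb{R}$, $\lambda\ge0$ and a cdf $F_\eta$. For $j\in\{0,\dots,M\}$ let $W_j$ be a standard Brownian motion, $P_j$ a Poisson process with intensity $\lambda$, and $\eta_j(1),\eta_j(2),\dots$ i.i.d. real random variables with cdf $F_\eta$; all these are mutually independent. Let $b_j(t,z),\sigma_j(t,z)$ be real-valued functions, finite for all $t\ge0$ and bounded for all $z\in\mathbb{R}$. For $\theta\in\mathbb{R}$ the conditional component process is $$Y_j^{\theta}(t)=\int_0^t b_j(u,\theta)\,\mathrm{d}u+\int_0^t\sigma_j(u,\theta)\,\mathrm{d}W_j(u)+\sum_{i=1}^{P_j(t)}\eta_j(i).$$ Let $\bm\vartheta=(\vartheta_0,\dots,\vartheta_M)$ be a vector of independent continuous real-valued random variables (the randomisers), independent of all $W_j,P_j,\eta_j$. The randomised component process $Y_j^{\vartheta_j}(t)$ is given by the same formula with $\theta$ replaced by the random variable $\vartheta_j$. Let $0=\tau_0<\tau_1<\dots<\tau_M<\infty$ be deterministic, $\tau_{M+1}=\infty$,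 and let $s_j(t)=0$ for $t<\tau_j$, $s_j(t)=t-\tau_j$ for $\tau_j\le t<\tau_{j+1}$, $s_j(t)=\tau_{j+1}-\tau_j$ for $t\ge\tau_{j+1}$. The randomised composite process is $X^{\bm\vartheta}(t)=x_0+\sum_{j=0}^M Y_j^{\vartheta_j}(s_j(t))$ and, for $\bm\theta=(\theta_0,\dots,\theta_M)\in\mathbb{R}^{M+1}$, the conditional composite process is $X^{\bm\theta}(t)=x_0+\sum_{j=0}^M Y_j^{\theta_j}(s_j(t))$. $f(x;Z)$ denotes the probability density function of $Z$ at $x$; $*$ denotes convolution. Since $Y_j(0)=0$, the density of $Y_j(0)$ is understood as the Dirac delta $\delta_0$, the identity of convolution. The Gauss quadrature pairs $(w_{j,n},\theta_{j,n})_{n=1}^{N_j}$ associated with $\vartheta_j$ are the weights and nodes of the $N_j$-point Gauss quadrature rule for integration against the density of $\vartheta_j$. *)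

theory Defs
  imports "HOL-Probability.Probability"
begin

section \<open>Driving processes\<close>

definition independent_increments :: "'a measure \<Rightarrow> (real \<Rightarrow> 'a \<Rightarrow> real) \<Rightarrow> bool" where
  "independent_increments \<Omega> X \<longleftrightarrow>
     (\<forall>(r :: nat \<Rightarrow> real) n. 0 \<le> r 0 \<and> (\<forall>k<n. r k \<le> r (Suc k)) \<longrightarrow>
        prob_space.indep_vars \<Omega> (\<lambda>_. borel) (\<lambda>k \<omega>. X (r (Suc k)) \<omega> - X (r k) \<omega>) {..<n})"

definition standard_brownian_motion :: "'a measure \<Rightarrow> (real \<Rightarrow> 'a \<Rightarrow> real) \<Rightarrow> bool" where
  "standard_brownian_motion \<Omega> W \<longleftrightarrow>
     (\<forall>t\<ge>0. W t \<in> borel_measurable \<Omega>) \<and>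
     (AE \<omega> in \<Omega>. W 0 \<omega> = 0) \<and>
     independent_increments \<Omega> W \<and>
     (\<forall>s t. 0 \<le> s \<and> s < t \<longrightarrow>
        distributed \<Omega> lborel (\<lambda>\<omega>. W t \<omega> - W s \<omega>) (normal_density 0 (sqrt (t - s)))) \<and>
     (AE \<omega> in \<Omega>. continuous_on {0..} (\<lambda>t. W t \<omega>))"

text \<open>The Poisson probabilities are written out because \<open>poisson_pmf\<close> requires a positive
  rate, whereas the intensity \<open>lam = 0\<close> (no jumps) is allowed here.\<close>

definition poisson_process :: "'a measure \<Rightarrow> real \<Rightarrow> (real \<Rightarrow> 'a \<Rightarrow> nat) \<Rightarrow> bool" where
  "poisson_process \<Omega> lam P \<longleftrightarrow>
     (\<forall>t\<ge>0. P t \<in> measurable \<Omega> (count_space UNIV)) \<and>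
     (AE \<omega> in \<Omega>. P 0 \<omega> = 0) \<and>
     independent_increments \<Omega> (\<lambda>t \<omega>. real (P t \<omega>)) \<and>
     (\<forall>s t k. 0 \<le> s \<and> s < t \<longrightarrow>
        measure \<Omega> {\<omega> \<in> space \<Omega>. P t \<omega> = P s \<omega> + k} =
          (lam * (t - s)) ^ k / fact k * exp (- (lam * (t - s)))) \<and>
     (AE \<omega> in \<Omega>. mono_on {0..} (\<lambda>t. P t \<omega>) \<and>
        (\<forall>t\<ge>0. continuous (at_right t) (\<lambda>u. real (P u \<omega>))))"


section \<open>Mutual independence of the driving sources\<close>

definition process_events ::
  "'a measure \<Rightarrow> 'i set \<Rightarrow> ('i \<Rightarrow> 'a \<Rightarrow> real) \<Rightarrow> 'a set set" where
  "process_events \<Omega> T X =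
     sigma_sets (space \<Omega>) {X t -` A \<inter> space \<Omega> | t A. t \<in> T \<and> A \<in> sets borel}"

datatype source = Brownian nat | Poisson nat | Jump nat nat | Randomiser nat

primrec source_events ::
  "'a measure \<Rightarrow> (nat \<Rightarrow> real \<Rightarrow> 'a \<Rightarrow> real) \<Rightarrow> (nat \<Rightarrow> real \<Rightarrow> 'a \<Rightarrow> nat) \<Rightarrow>
    (nat \<Rightarrow> nat \<Rightarrow> 'a \<Rightarrow> real) \<Rightarrow> (nat \<Rightarrow> 'a \<Rightarrow> real) \<Rightarrow> source \<Rightarrow> 'a set set" where
  "source_events \<Omega> W P \<eta> \<theta> (Brownian j) = process_events \<Omega> {0..} (W j)"
| "source_events \<Omega> W P \<eta> \<theta> (Poisson j) = process_events \<Omega> {0..} (\<lambda>t \<omega>. real (P j t \<omega>))"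
| "source_events \<Omega> W P \<eta> \<theta> (Jump j i) = process_events \<Omega> {i} (\<eta> j)"
| "source_events \<Omega> W P \<eta> \<theta> (Randomiser j) = process_events \<Omega> {j} \<theta>"

definition sources :: "nat \<Rightarrow> source set" where
  "sources M = Brownian ` {..M} \<union> Poisson ` {..M} \<union> {Jump j i | j i. j \<le> M \<and> 1 \<le> i}
     \<union> Randomiser ` {..M}"


section \<open>The Ito integral\<close>

definition converges_in_probability :: "'a measure \<Rightarrow> (nat \<Rightarrow> 'a \<Rightarrow> real) \<Rightarrow> ('a \<Rightarrow> real) \<Rightarrow> bool" where
  "converges_in_probability \<Omega> X Z \<longleftrightarrow>
     (\<forall>\<epsilon>>0. (\<lambda>m. measure \<Omega> {\<omega> \<in> space \<Omega>. \<bar>X m \<omega> - Z \<omega>\<bar> > \<epsilon>}) \<longlonglongrightarrow> 0)"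

text \<open>A simple process on \<open>{0..T}\<close> is
  \<open>\<Sum>k<n. \<xi> k * indicator {r k<..r (Suc k)}\<close>, each \<open>\<xi> k\<close> being bounded and known at time
  \<open>r k\<close>.\<close>

definition simple_process ::
  "(real \<Rightarrow> 'a measure) \<Rightarrow> real \<Rightarrow> nat \<Rightarrow> (nat \<Rightarrow> real) \<Rightarrow> (nat \<Rightarrow> 'a \<Rightarrow> real) \<Rightarrow> bool" where
  "simple_process F T n r \<xi> \<longleftrightarrow> r 0 = 0 \<and> r n = T \<and>
     (\<forall>k<n. r k \<le> r (Suc k) \<and> \<xi> k \<in> borel_measurable (F (r k)) \<and>
        (\<exists>C. \<forall>\<omega>\<in>space (F (r k)). \<bar>\<xi> k \<omega>\<bar> \<le> C))"

definition simple_value :: "nat \<Rightarrow> (nat \<Rightarrow> real) \<Rightarrow> (nat \<Rightarrow> 'a \<Rightarrow> real) \<Rightarrow> real \<Rightarrow> 'a \<Rightarrow> real" where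
  "simple_value n r \<xi> u \<omega> = (\<Sum>k<n. \<xi> k \<omega> * indicator {r k<..r (Suc k)} u)"

definition simple_integral ::
  "(real \<Rightarrow> 'a \<Rightarrow> real) \<Rightarrow> nat \<Rightarrow> (nat \<Rightarrow> real) \<Rightarrow> (nat \<Rightarrow> 'a \<Rightarrow> real) \<Rightarrow> 'a \<Rightarrow> real" where
  "simple_integral W n r \<xi> \<omega> = (\<Sum>k<n. \<xi> k \<omega> * (W (r (Suc k)) \<omega> - W (r k) \<omega>))"

text \<open>\<open>I\<close> is (a version of) the integral of \<open>H\<close> against \<open>W\<close> over \<open>{0..T}\<close>: the limit in
  probability of integrals of simple \<open>F\<close>-adapted processes \<open>H\<^sub>m\<close> for which the time integral of
  \<open>(H\<^sub>m - H)\<^sup>2\<close> tends to 0 in probability. It is determined up to a null set.\<close>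

definition is_ito_integral ::
  "'a measure \<Rightarrow> (real \<Rightarrow> 'a measure) \<Rightarrow> (real \<Rightarrow> 'a \<Rightarrow> real) \<Rightarrow> (real \<Rightarrow> 'a \<Rightarrow> real) \<Rightarrow>
    real \<Rightarrow> ('a \<Rightarrow> real) \<Rightarrow> bool" where
  "is_ito_integral \<Omega> F W H T I \<longleftrightarrow>
     I \<in> borel_measurable \<Omega> \<and>
     case_prod H \<in> borel_measurable (restrict_space borel {0..T} \<Otimes>\<^sub>M \<Omega>) \<and>
     (\<forall>u\<in>{0..T}. H u \<in> borel_measurable (F u)) \<and>
     (\<exists>n r \<xi>. (\<forall>m. simple_process F T (n m) (r m) (\<xi> m)) \<and>
        (\<forall>\<epsilon>>0. (\<lambda>m. measure \<Omega> {\<omega> \<in> space \<Omega>.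
            (\<integral>\<^sup>+u\<in>{0..T}. ennreal ((simple_value (n m) (r m) (\<xi> m) u \<omega> - H u \<omega>)\<^sup>2) \<partial>lborel)
              > ennreal \<epsilon>}) \<longlonglongrightarrow> 0) \<and>
        converges_in_probability \<Omega> (\<lambda>m. simple_integral W (n m) (r m) (\<xi> m)) I)"


section \<open>Component and composite processes\<close>

text \<open>The natural filtration of \<open>W\<close>, enlarged at time 0 by the parameter \<open>\<zeta>\<close>. If \<open>\<zeta>\<close> is
  independent of \<open>W\<close> (in particular, constant), \<open>W\<close> is a Brownian motion for it.\<close>

definition enlarged_filtration ::
  "'a measure \<Rightarrow> (real \<Rightarrow> 'a \<Rightarrow> real) \<Rightarrow> ('a \<Rightarrow> real) \<Rightarrow> real \<Rightarrow> 'a measure" where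
  "enlarged_filtration \<Omega> W \<zeta> t =
     sigma (space \<Omega>) ({W s -` A \<inter> space \<Omega> | s A. 0 \<le> s \<and> s \<le> t \<and> A \<in> sets borel} \<union>
                      {\<zeta> -` A \<inter> space \<Omega> | A. A \<in> sets borel})"

text \<open>For \<open>p = 1\<close> (drift) and \<open>p = 2\<close> (volatility), the local integrability in time makes
  the integrals in the component process exist.\<close>

definition admissible_coefficient :: "nat \<Rightarrow> (real \<Rightarrow> real \<Rightarrow> real) \<Rightarrow> bool" where
  "admissible_coefficient p g \<longleftrightarrow>
     case_prod g \<in> borel_measurable (restrict_space borel {0..} \<Otimes>\<^sub>M borel) \<and>
     (\<forall>t\<ge>0. bounded (range (g t))) \<and>
     (\<forall>T\<ge>0. \<forall>z. set_integrable lborel {0..T} (\<lambda>u. \<bar>g u z\<bar> ^ p))"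

text \<open>The parameter \<open>\<zeta>\<close> is a random variable: a constant gives a conditional component process,
  a randomiser the randomised one.\<close>

definition component_process ::
  "'a measure \<Rightarrow> (real \<Rightarrow> real \<Rightarrow> real) \<Rightarrow> (real \<Rightarrow> real \<Rightarrow> real) \<Rightarrow> (real \<Rightarrow> 'a \<Rightarrow> real) \<Rightarrow>
    (real \<Rightarrow> 'a \<Rightarrow> nat) \<Rightarrow> (nat \<Rightarrow> 'a \<Rightarrow> real) \<Rightarrow> ('a \<Rightarrow> real) \<Rightarrow> (real \<Rightarrow> 'a \<Rightarrow> real) \<Rightarrow> bool" where
  "component_process \<Omega> b \<sigma> W P \<eta> \<zeta> Y \<longleftrightarrow>
     (\<forall>t\<ge>0. Y t \<in> borel_measurable \<Omega> \<and>
        (\<exists>I. is_ito_integral \<Omega> (enlarged_filtration \<Omega> W \<zeta>) W (\<lambda>u \<omega>. \<sigma> u (\<zeta> \<omega>)) t I \<and>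
             (AE \<omega> in \<Omega>. Y t \<omega> =
                (LBINT u:{0..t}. b u (\<zeta> \<omega>)) + I \<omega> + (\<Sum>i=1..P t \<omega>. \<eta> i \<omega>))))"

text \<open>\<open>\<tau> (Suc M)\<close> is to be read as \<open>\<infinity>\<close>; the value of the function there is not used.\<close>

definition clock :: "nat \<Rightarrow> (nat \<Rightarrow> real) \<Rightarrow> nat \<Rightarrow> real \<Rightarrow> real" where
  "clock M \<tau> j t =
     (if t < \<tau> j then 0 else if j = M \<or> t < \<tau> (Suc j) then t - \<tau> j else \<tau> (Suc j) - \<tau> j)"

definition composite_process ::
  "nat \<Rightarrow> real \<Rightarrow> (nat \<Rightarrow> real) \<Rightarrow> (nat \<Rightarrow> real \<Rightarrow> 'a \<Rightarrow> real) \<Rightarrow> real \<Rightarrow> 'a \<Rightarrow> real" where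
  "composite_process M x0 \<tau> Y t \<omega> = x0 + (\<Sum>j\<le>M. Y j (clock M \<tau> j t) \<omega>)"


section \<open>Densities\<close>

definition has_pdf :: "'a measure \<Rightarrow> ('a \<Rightarrow> real) \<Rightarrow> bool" where
  "has_pdf \<Omega> Z \<longleftrightarrow> Z \<in> borel_measurable \<Omega> \<and> absolutely_continuous lborel (distr \<Omega> borel Z)"

text \<open>A density is only determined up to null sets. Its value at a point is fixed here as the
  derivative of the cdf, which is the continuous version of the density whenever there is one.\<close>

definition pdf :: "'a measure \<Rightarrow> ('a \<Rightarrow> real) \<Rightarrow> real \<Rightarrow> real" where
  "pdf \<Omega> Z x = deriv (cdf (distr \<Omega> borel Z)) x"

text \<open>Generalised densities: a translated Dirac delta, or an ordinary density function. Values in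
  \<open>ennreal\<close> allow for mixtures and convolutions that are infinite at some points.\<close>

datatype gen_density = Dirac real | Density "real \<Rightarrow> ennreal"

primrec has_gen_density :: "'a measure \<Rightarrow> ('a \<Rightarrow> real) \<Rightarrow> gen_density \<Rightarrow> bool" where
  "has_gen_density \<Omega> Z (Dirac a) \<longleftrightarrow> Z \<in> borel_measurable \<Omega> \<and> distr \<Omega> borel Z = return borel a"
| "has_gen_density \<Omega> Z (Density f) \<longleftrightarrow> distributed \<Omega> lborel Z f"

fun conv :: "gen_density \<Rightarrow> gen_density \<Rightarrow> gen_density" where
  "conv (Dirac a) (Dirac c) = Dirac (a + c)"
| "conv (Dirac a) (Density g) = Density (\<lambda>x. g (x - a))"
| "conv (Density f) (Dirac c) = Density (\<lambda>x. f (x - c))"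
| "conv (Density f) (Density g) = Density (\<lambda>x. \<integral>\<^sup>+y. f (x - y) * g y \<partial>lborel)"

primrec density_at :: "gen_density \<Rightarrow> real \<Rightarrow> ennreal" where
  "density_at (Dirac a) x = (if x = a then \<infinity> else 0)"
| "density_at (Density f) x = f x"

text \<open>\<open>Y z\<close> is the conditional component process with parameter \<open>z\<close>, \<open>D\<close> the domain of the
  randomiser \<open>\<theta>\<close>. All component processes start at 0.\<close>

definition randomised_density ::
  "'a measure \<Rightarrow> real set \<Rightarrow> ('a \<Rightarrow> real) \<Rightarrow> (real \<Rightarrow> real \<Rightarrow> 'a \<Rightarrow> real) \<Rightarrow> real \<Rightarrow> gen_density" where
  "randomised_density \<Omega> D \<theta> Y s =
     (if s = 0 then Dirac 0
      else Density (\<lambda>y. \<integral>\<^sup>+z\<in>D. ennreal (pdf \<Omega> (Y z s) y) \<partial>distr \<Omega> borel \<theta>))"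

definition composite_density ::
  "'a measure \<Rightarrow> nat \<Rightarrow> real \<Rightarrow> (nat \<Rightarrow> real) \<Rightarrow> (nat \<Rightarrow> real set) \<Rightarrow> (nat \<Rightarrow> 'a \<Rightarrow> real) \<Rightarrow>
    (nat \<Rightarrow> real \<Rightarrow> real \<Rightarrow> 'a \<Rightarrow> real) \<Rightarrow> real \<Rightarrow> gen_density" where
  "composite_density \<Omega> M x0 \<tau> D \<theta> Y t =
     foldl conv (Dirac x0)
       (map (\<lambda>j. randomised_density \<Omega> (D j) (\<theta> j) (Y j) (clock M \<tau> j t)) [0..<Suc M])"


section \<open>Gauss quadrature\<close>

text \<open>\<open>N\<close> distinct nodes \<open>x 1, \<dots>, x N\<close> and weights \<open>w 1, \<dots>, w N\<close> integrating every
  polynomial of degree at most \<open>2 N - 1\<close> exactly against \<open>\<mu>\<close>.\<close>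

definition gauss_quadrature ::
  "real measure \<Rightarrow> nat \<Rightarrow> (nat \<Rightarrow> real) \<Rightarrow> (nat \<Rightarrow> real) \<Rightarrow> bool" where
  "gauss_quadrature \<mu> N w x \<longleftrightarrow>
     inj_on x {1..N} \<and>
     (\<forall>p :: real poly. degree p < 2 * N \<longrightarrow>
        (\<Sum>n=1..N. w n * poly p (x n)) = (\<integral>z. poly p z \<partial>\<mu>))"

text \<open>At \<open>s = 0\<close> all densities involved are the Dirac delta at 0, so that the error is
  \<open>1 - (\<Sum>n=1..N. w n)\<close> times that delta. (Weights of a Gauss rule for a probability
  distribution sum to 1, and \<open>0 * \<infinity> = 0\<close> in \<open>ereal\<close>.)\<close>

definition quadrature_error ::
  "'a measure \<Rightarrow> real set \<Rightarrow> ('a \<Rightarrow> real) \<Rightarrow> (real \<Rightarrow> real \<Rightarrow> 'a \<Rightarrow> real) \<Rightarrow>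
    nat \<Rightarrow> (nat \<Rightarrow> real) \<Rightarrow> (nat \<Rightarrow> real) \<Rightarrow> real \<Rightarrow> real \<Rightarrow> ereal" where
  "quadrature_error \<Omega> D \<theta> Y N w x s y =
     (if s = 0 then ereal (1 - (\<Sum>n=1..N. w n)) * enn2ereal (density_at (Dirac 0) y)
      else enn2ereal (density_at (randomised_density \<Omega> D \<theta> Y s) y)
             - ereal (\<Sum>n=1..N. w n * pdf \<Omega> (Y (x n) s) y))"

end

theory Submission
  imports Defs
begin

text \<open>Given the parameter, a component is a Gaussian variable plus an independent compound Poisson
  sum: the characteristic function of the Ito integral of \<open>\<sigma> u \<zeta>\<close>, with \<open>\<zeta>\<close> independent of
  the Brownian motion, is found by passing to the limit in the exponential martingales of the
  approximating simple processes. By Levy's uniqueness theorem the law of the randomised component is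
  then the mixture of the conditional laws, and independence of the components turns sums into
  convolutions.

  The compound Poisson sum vanishes with positive probability, so a conditional law with a density has
  a nondegenerate Gaussian part. Hence its density is bounded and continuous, and the derivatives of
  the distribution functions agree with pointwise convolutions everywhere. The error bound follows by
  replacing the factors of the convolution one at a time; each replacement costs at most the
  supremum of one quadrature error because the weights are nonnegative with sum 1.\<close>

section \<open>Ito integrals with an independent parameter\<close>


text \<open>The conditional law given \<zeta> is not formed for the Ito integral. It is encoded by
  testing: \<open>iexp (a * I)\<close> is multiplied by a bounded function of \<zeta> before taking
  expectations. This fits the martingale argument because \<zeta> is known at time 0, so such a
  factor may multiply the exponential martingale; in particular exp(-a^2 V(\<zeta>)/2) may, which
  cancels the limiting compensator. The obstacle is that the compensators exp(a^2 Q/2) of the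
  approximating processes have no common bound, so dominated convergence needs a level C for the
  quadratic variation Q and for its limit V, removed at the end.

  An Ito integral is given only up to null sets and is measurable only for the full space.
  Independence is therefore shown for versions measurable in the algebra of their own sources.

  A mixture density may be infinite at some points, so the comparison with the quadrature sum is
  one-sided and runs in \<open>ennreal\<close>; the only integral of the true partial convolution
  that it needs is its total mass 1.\<close>

text \<open>Indices are chosen so that the n-th exceptional event, with threshold 2^-n, has
  probability below 2^-n; Borel-Cantelli then leaves only finitely many exceptions. Values in
  \<open>ennreal\<close> admit time integrals that may be infinite.\<close>

lemma (in prob_space) AE_convergent_subsequence:
  fixes U :: "nat \<Rightarrow> 'a \<Rightarrow> ennreal"
  assumes U [measurable]: "\<And>m. U m \<in> borel_measurable M"
    and lim: "\<And>e. 0 < e \<Longrightarrow> (\<lambda>m. prob {\<omega> \<in> space M. U m \<omega> > ennreal e}) \<longlonglongrightarrow> 0"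
  obtains s :: "nat \<Rightarrow> nat" where "strict_mono s" "AE \<omega> in M. (\<lambda>m. U (s m) \<omega>) \<longlonglongrightarrow> 0"
proof -
  define E where "E k m = {\<omega> \<in> space M. U m \<omega> > ennreal ((1/2)^k)}" for k m
  have [measurable]: "E k m \<in> events" for k m unfolding E_def by measurable
  have ev: "eventually (\<lambda>m. prob (E k m) < (1/2)^k) sequentially" for k
    unfolding E_def using order_tendstoD(2)[OF lim[of "(1/2)^k"], of "(1/2)^k"] by simp
  have "\<exists>s. \<forall>n. prob (E n (s n)) < (1/2)^n \<and> s n < s (Suc n)"
  proof (rule dependent_nat_choice)
    show "\<exists>x. prob (E 0 x) < (1/2)^0" using eventually_happens[OF ev[of 0]] by auto
    fix x n
    have "eventually (\<lambda>m. prob (E (Suc n) m) < (1/2)^Suc n \<and> x < m) sequentially"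
      by (intro eventually_conj ev eventually_gt_at_top)
    from eventually_happens[OF this] show "\<exists>y. prob (E (Suc n) y) < (1/2)^Suc n \<and> x < y" by auto
  qed
  then obtain s where s: "\<And>n. prob (E n (s n)) < (1/2)^n" "\<And>n. s n < s (Suc n)" by blast
  have "strict_mono s" using s(2) by (simp add: strict_mono_Suc_iff)
  moreover have "AE \<omega> in M. eventually (\<lambda>n. \<omega> \<in> space M - E n (s n)) sequentially"
  proof (rule borel_cantelli_AE1)
    show "summable (\<lambda>n. prob (E n (s n)))"
      by (rule summable_comparison_test[OF _ summable_geometric[of "1/2::real"]])
         (use s(1) in \<open>auto intro!: exI[of _ 0] less_imp_le\<close>)
  qed (auto simp: emeasure_eq_measure)
  then have "AE \<omega> in M. (\<lambda>m. U (s m) \<omega>) \<longlonglongrightarrow> 0"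
  proof eventually_elim
    case (elim \<omega>)
    have "eventually (\<lambda>n. U (s n) \<omega> \<le> ennreal ((1/2)^n)) sequentially"
      using elim by eventually_elim (auto simp: E_def)
    then show ?case
    proof (rule tendsto_sandwich[rotated, OF _ tendsto_const])
      show "(\<lambda>n. ennreal ((1/2)^n)) \<longlonglongrightarrow> 0"
        using tendsto_ennrealI[OF LIMSEQ_power_zero, of "1/2::real"] by (simp only: ennreal_0) simp
    qed auto
  qed
  ultimately show ?thesis by (rule that)
qed

section \<open>Independence of Brownian increments from the enlarged past\<close>

text \<open>Independent increments are stated for one grid, so the finitely many past times are
  arranged into a grid that ends in r, r'. Past values are then partial sums of the earlier
  increments, and the increment from r to r' is the last one.\<close>

lemma (in prob_space) brownian_increment_indep_finite:
  assumes bm: "standard_brownian_motion M W" and r: "0 \<le> r" "r \<le> r'"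
    and S: "finite S" "S \<subseteq> {0..r}" and A: "\<And>s. A s \<in> sets borel" and B: "B \<in> sets borel"
  shows "prob ({\<omega>\<in>space M. \<forall>s\<in>S. W s \<omega> \<in> A s} \<inter> {\<omega>\<in>space M. W r' \<omega> - W r \<omega> \<in> B}) =
    prob {\<omega>\<in>space M. \<forall>s\<in>S. W s \<omega> \<in> A s} * prob {\<omega>\<in>space M. W r' \<omega> - W r \<omega> \<in> B}"
proof -
  note A [measurable] B [measurable]
  have Wm: "\<And>t. 0 \<le> t \<Longrightarrow> W t \<in> borel_measurable M" and W0: "AE \<omega> in M. W 0 \<omega> = 0"
    and incr: "independent_increments M W"
    using bm by (auto simp: standard_brownian_motion_def)
  \<comment> \<open>Adding 0 makes the partial sums start at \<open>W 0\<close>; adding r, an upper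
    bound of S, makes r the last grid point before r'.\<close>
  define S' where "S' = insert 0 (insert r S)"
  define l where "l = sorted_list_of_set S'"
  have S': "finite S'" "S' \<noteq> {}" using S by (auto simp: S'_def)
  have setl: "set l = S'" and srt: "sorted l" and dist: "distinct l" using S' by (auto simp: l_def)
  define m where "m = length l - 1"
  have len: "length l = Suc m" using S' setl by (cases l) (auto simp: m_def)
  define rr where "rr k = (if k \<le> m then l ! k else r')" for k
  have bnd: "x \<in> S' \<Longrightarrow> 0 \<le> x \<and> x \<le> r" for x using S r by (auto simp: S'_def)
  have idx: "\<exists>k\<le>m. rr k = x" if "x \<in> S'" for x
    using that unfolding setl[symmetric] in_set_conv_nth len rr_def by auto
  have rrS: "k \<le> m \<Longrightarrow> rr k \<in> S'" for k unfolding setl[symmetric] rr_def by (simp add: len)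
  have mono: "rr i \<le> rr k" if "i \<le> k" "k \<le> m" for i k
    using that srt by (auto simp: rr_def len sorted_nth_mono)
  have rr0: "rr 0 = 0"
  proof -
    obtain k where "k \<le> m" "rr k = 0" using idx[of 0] by (auto simp: S'_def)
    then show ?thesis using mono[of 0 k] bnd[OF rrS[of 0]] by auto
  qed
  have rrm: "rr m = r"
  proof -
    obtain k where "k \<le> m" "rr k = r" using idx[of r] by (auto simp: S'_def)
    then show ?thesis using mono[of k m] bnd[OF rrS[of m]] by auto
  qed
  have rrSuc: "rr (Suc m) = r'" by (simp add: rr_def)
  define X where "X k \<omega> = W (rr (Suc k)) \<omega> - W (rr k) \<omega>" for k \<omega>
  have "rr k \<le> rr (Suc k)" if "k < Suc m" for k
    using that mono[of k "Suc k"] rrSuc rrm r by (cases "k = m") auto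
  then have ind: "indep_vars (\<lambda>_. borel) X {..<Suc m}"
    using incr[unfolded independent_increments_def, rule_format, of rr "Suc m"] rr0
    by (auto simp: X_def[abs_def])
  have tel: "(\<Sum>i<k. X i \<omega>) = W (rr k) \<omega> - W 0 \<omega>" for k \<omega>
    unfolding X_def rr0[symmetric] by (rule sum_lessThan_telescope)
  from idx have "\<forall>x\<in>S. \<exists>k. k \<le> m \<and> rr k = x" by (auto simp: S'_def)
  from bchoice[OF this] obtain i where i: "\<And>x. x \<in> S \<Longrightarrow> i x \<le> m \<and> rr (i x) = x" by blast
  have iv: "indep_var (PiM {..<m} (\<lambda>_. borel)) (\<lambda>\<omega>. restrict (\<lambda>i. X i \<omega>) {..<m})
      (PiM {m} (\<lambda>_. borel)) (\<lambda>\<omega>. restrict (\<lambda>i. X i \<omega>) {m})"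
    by (rule indep_var_restrict[OF ind]) auto
  define PA where "PA = {f :: nat \<Rightarrow> real. f \<in> space (PiM {..<m} (\<lambda>_. borel)) \<and> (\<forall>s\<in>S. (\<Sum>k\<in>{..<i s}. f k) \<in> A s)}"
  define PB where "PB = {f \<in> space (PiM {m} (\<lambda>_. borel :: real measure)). f m \<in> B}"
  have [measurable]: "(\<lambda>f :: nat \<Rightarrow> real. \<Sum>k\<in>{..<i s}. f k) \<in> borel_measurable (PiM {..<m} (\<lambda>_. borel :: real measure))" if "s \<in> S" for s
    by (intro borel_measurable_sum measurable_component_singleton) (use i[OF that] in auto)
  have PA: "PA \<in> sets (PiM {..<m} (\<lambda>_. borel))"
    unfolding PA_def using S(1) by measurable
  have PB: "PB \<in> sets (PiM {m} (\<lambda>_. borel))" unfolding PB_def by measurable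
  define EA where "EA = {\<omega>\<in>space M. \<forall>s\<in>S. W s \<omega> \<in> A s}"
  define EB where "EB = {\<omega>\<in>space M. W r' \<omega> - W r \<omega> \<in> B}"
  \<comment> \<open>Partial sums give \<open>W s - W 0\<close>, and \<open>W 0\<close> vanishes only
    almost everywhere; EA and EA' differ by a null set.\<close>
  define EA' where "EA' = {\<omega>\<in>space M. \<forall>s\<in>S. W s \<omega> - W 0 \<omega> \<in> A s}"
  have [measurable]: "W s \<in> borel_measurable M" if "s \<in> S" for s using that S Wm by auto
  have [measurable]: "W 0 \<in> borel_measurable M" "W r \<in> borel_measurable M" "W r' \<in> borel_measurable M" using r Wm by auto
  have m: "EA \<in> events" "EA' \<in> events" "EB \<in> events"
    unfolding EA_def EA'_def EB_def using S(1) by measurable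
  have "(\<lambda>\<omega>. restrict (\<lambda>i. X i \<omega>) {..<m}) -` PA \<inter> space M = EA'"
  proof -
    have "(\<Sum>k\<in>{..<i x}. (\<lambda>j\<in>{..<m}. X j \<omega>) k) = W x \<omega> - W 0 \<omega>" if "x \<in> S" for x \<omega>
    proof -
      have "(\<Sum>k\<in>{..<i x}. (\<lambda>j\<in>{..<m}. X j \<omega>) k) = (\<Sum>k<i x. X k \<omega>)"
        by (intro sum.cong) (use i[OF that] in auto)
      then show ?thesis using tel[of \<omega> "i x"] i[OF that] by simp
    qed
    then show ?thesis by (auto simp: PA_def EA'_def space_PiM)
  qed
  moreover have "(\<lambda>\<omega>. restrict (\<lambda>i. X i \<omega>) {m}) -` PB \<inter> space M = EB"
    by (auto simp: PB_def EB_def space_PiM X_def rrSuc rrm)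
  moreover have "(\<lambda>\<omega>. (restrict (\<lambda>i. X i \<omega>) {..<m}, restrict (\<lambda>i. X i \<omega>) {m})) -` (PA \<times> PB) \<inter> space M
      = ((\<lambda>\<omega>. restrict (\<lambda>i. X i \<omega>) {..<m}) -` PA \<inter> space M) \<inter> ((\<lambda>\<omega>. restrict (\<lambda>i. X i \<omega>) {m}) -` PB \<inter> space M)" by auto
  ultimately have eq: "prob (EA' \<inter> EB) = prob EA' * prob EB"
    using indep_varD[OF iv PA PB] by metis
  have AE: "AE \<omega> in M. \<omega> \<in> EA \<longleftrightarrow> \<omega> \<in> EA'"
    using W0 by eventually_elim (auto simp: EA_def EA'_def)
  have "prob (EA \<inter> EB) = prob (EA' \<inter> EB)"
    by (rule finite_measure_eq_AE) (use AE m in auto)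
  moreover have "prob EA = prob EA'"
    by (rule finite_measure_eq_AE) (use AE m in auto)
  ultimately show ?thesis using eq by (simp add: EA_def EB_def)
qed

text \<open>W stays a Brownian motion for the enlarged filtration. The events
  \<open>\<zeta> \<in> C\<close> and \<open>W s \<in> A s\<close> for finitely many s up to r form a
  generator stable under intersection, on which the product rule can be verified directly.\<close>

lemma (in prob_space) brownian_increment_indep:
  assumes bm: "standard_brownian_motion M W" and r: "0 \<le> r" "r \<le> r'"
    and zeta [measurable]: "\<zeta> \<in> borel_measurable M"
    and ind: "indep_set (process_events M {0..} W) (sigma_sets (space M) {\<zeta> -` A \<inter> space M | A. A \<in> sets borel})"
  shows "indep_set (sets (enlarged_filtration M W \<zeta> r))
    (sigma_sets (space M) {(\<lambda>\<omega>. W r' \<omega> - W r \<omega>) -` A \<inter> space M | A. A \<in> sets borel})"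
proof -
  have Wm: "\<And>t. 0 \<le> t \<Longrightarrow> W t \<in> borel_measurable M"
    using bm by (auto simp: standard_brownian_motion_def)
  have [measurable]: "W r \<in> borel_measurable M" "W r' \<in> borel_measurable M" using r Wm by auto
  define PP where "PP = {{\<omega>\<in>space M. \<zeta> \<omega> \<in> C \<and> (\<forall>s\<in>S. W s \<omega> \<in> A s)} | C S A.
     C \<in> sets borel \<and> finite S \<and> S \<subseteq> {0..r} \<and> (\<forall>s. A s \<in> sets borel)}"
  define G where "G = sigma (space M) {W t -` A \<inter> space M | t A. t \<in> {0..} \<and> A \<in> sets borel}"
  have setsG: "sets G = process_events M {0..} W" and spaceG: "space G = space M"
    unfolding G_def process_events_def by (auto intro!: sets_measure_of space_measure_of)
  have WG: "W t \<in> borel_measurable G" if "0 \<le> t" for t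
    by (rule measurableI) (use that in \<open>auto simp: setsG spaceG process_events_def intro!: sigma_sets.Basic\<close>)
  have indep: "indep_set PP {(\<lambda>\<omega>. W r' \<omega> - W r \<omega>) -` A \<inter> space M | A. A \<in> sets borel}"
  proof (rule indep_setI)
    show "PP \<subseteq> events"
    proof
      fix x assume "x \<in> PP"
      then obtain C S A where x: "x = {\<omega>\<in>space M. \<zeta> \<omega> \<in> C \<and> (\<forall>s\<in>S. W s \<omega> \<in> A s)}"
        and [measurable]: "C \<in> sets borel" "\<And>s. A s \<in> sets borel" and S: "finite S" "S \<subseteq> {0..r}"
        unfolding PP_def by blast
      have [measurable]: "W s \<in> borel_measurable M" if "s \<in> S" for s using that S Wm by auto
      show "x \<in> events" unfolding x using S(1) by measurable
    qed
    show "{(\<lambda>\<omega>. W r' \<omega> - W r \<omega>) -` A \<inter> space M | A. A \<in> sets borel} \<subseteq> events" by auto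
    fix x y assume "x \<in> PP" "y \<in> {(\<lambda>\<omega>. W r' \<omega> - W r \<omega>) -` A \<inter> space M | A. A \<in> sets borel}"
    then obtain C S A B where x: "x = {\<omega>\<in>space M. \<zeta> \<omega> \<in> C \<and> (\<forall>s\<in>S. W s \<omega> \<in> A s)}"
      and y: "y = (\<lambda>\<omega>. W r' \<omega> - W r \<omega>) -` B \<inter> space M"
      and C [measurable]: "C \<in> sets borel" and A [measurable]: "\<And>s. A s \<in> sets borel"
      and S: "finite S" "S \<subseteq> {0..r}" and B [measurable]: "B \<in> sets borel"
      unfolding PP_def by blast
    define E where "E = {\<omega>\<in>space M. \<forall>s\<in>S. W s \<omega> \<in> A s}"
    define Z where "Z = \<zeta> -` C \<inter> space M"
    have yy: "y = {\<omega>\<in>space M. W r' \<omega> - W r \<omega> \<in> B}" unfolding y by auto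
    have EB: "prob (E \<inter> y) = prob E * prob y" unfolding E_def yy
      by (rule brownian_increment_indep_finite) fact+
    have [measurable]: "W s \<in> borel_measurable G" if "s \<in> S" for s using that S WG by auto
    have [measurable]: "W r \<in> borel_measurable G" "W r' \<in> borel_measurable G" using r WG by auto
    have "E \<in> sets G" "E \<inter> y \<in> sets G"
      unfolding E_def yy spaceG[symmetric] using S(1) by measurable
    then have 1: "E \<in> process_events M {0..} W" "E \<inter> y \<in> process_events M {0..} W" by (simp_all add: setsG)
    have 2: "Z \<in> sigma_sets (space M) {\<zeta> -` A \<inter> space M | A. A \<in> sets borel}"
      unfolding Z_def using C by (intro sigma_sets.Basic) blast
    \<comment> \<open>Past and increment together are one event of the path of W, so independence of
      \<zeta> from the whole path splits off Z; the finite case then separates E from y.\<close>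
    have "x \<inter> y = (E \<inter> y) \<inter> Z" unfolding x E_def Z_def yy by auto
    moreover have "x = E \<inter> Z" unfolding x E_def Z_def by auto
    ultimately show "prob (x \<inter> y) = prob x * prob y"
      using indep_setD[OF ind 1(1) 2] indep_setD[OF ind 1(2) 2] EB by simp
  qed
  have "indep_set (sigma_sets (space M) PP)
    (sigma_sets (space M) {(\<lambda>\<omega>. W r' \<omega> - W r \<omega>) -` A \<inter> space M | A. A \<in> sets borel})"
  proof (rule indep_set_sigma_sets[OF indep])
    show "Int_stable PP"
    proof (rule Int_stableI)
      fix x y assume "x \<in> PP" "y \<in> PP"
      then obtain C S A C' S' A' where x: "x = {\<omega>\<in>space M. \<zeta> \<omega> \<in> C \<and> (\<forall>s\<in>S. W s \<omega> \<in> A s)}"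
        and [simp]: "C \<in> sets borel" "\<And>s. A s \<in> sets borel" "finite S" "S \<subseteq> {0..r}"
        and y: "y = {\<omega>\<in>space M. \<zeta> \<omega> \<in> C' \<and> (\<forall>s\<in>S'. W s \<omega> \<in> A' s)}"
        and [simp]: "C' \<in> sets borel" "\<And>s. A' s \<in> sets borel" "finite S'" "S' \<subseteq> {0..r}"
        unfolding PP_def by blast
      define A'' where "A'' s = (if s \<in> S then A s else UNIV) \<inter> (if s \<in> S' then A' s else UNIV)" for s
      have A'': "\<forall>s. A'' s \<in> sets borel" by (auto simp: A''_def)
      have "x \<inter> y = {\<omega>\<in>space M. \<zeta> \<omega> \<in> C \<inter> C' \<and> (\<forall>s\<in>S \<union> S'. W s \<omega> \<in> A'' s)}"
        unfolding x y A''_def by auto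
      then show "x \<inter> y \<in> PP" unfolding PP_def using A''
        by (intro CollectI exI[of _ "C \<inter> C'"] exI[of _ "S \<union> S'"] exI[of _ A'']) auto
    qed
    show "Int_stable {(\<lambda>\<omega>. W r' \<omega> - W r \<omega>) -` A \<inter> space M | A. A \<in> sets borel}"
      unfolding Int_stable_def
    proof safe
      fix A B :: "real set" assume "A \<in> sets borel" "B \<in> sets borel"
      then show "\<exists>C. (\<lambda>\<omega>. W r' \<omega> - W r \<omega>) -` A \<inter> space M \<inter> ((\<lambda>\<omega>. W r' \<omega> - W r \<omega>) -` B \<inter> space M) =
          (\<lambda>\<omega>. W r' \<omega> - W r \<omega>) -` C \<inter> space M \<and> C \<in> sets borel"
        by (intro exI[of _ "A \<inter> B"]) auto
    qed
  qed
  moreover have "sets (enlarged_filtration M W \<zeta> r) \<subseteq> sigma_sets (space M) PP"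
  proof -
    have 1: "W s -` A \<inter> space M \<in> PP" if "0 \<le> s" "s \<le> r" "A \<in> sets borel" for s A
      unfolding PP_def by (intro CollectI exI[of _ UNIV] exI[of _ "{s}"] exI[of _ "\<lambda>_. A"]) (use that in auto)
    have 2: "\<zeta> -` A \<inter> space M \<in> PP" if "A \<in> sets borel" for A
      unfolding PP_def by (intro CollectI exI[of _ A] exI[of _ "{}"] exI[of _ "\<lambda>_. UNIV"]) (use that in auto)
    show ?thesis unfolding enlarged_filtration_def
      by (subst sets_measure_of) (auto intro!: sigma_sets_mono 1 2)
  qed
  ultimately show ?thesis unfolding indep_sets2_eq by blast
qed


section \<open>Measurability for the enlarged filtration\<close>

lemma space_enlarged_filtration [simp]: "space (enlarged_filtration \<Omega> W \<zeta> t) = space \<Omega>"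
  unfolding enlarged_filtration_def by (rule space_measure_of) auto

lemma sets_enlarged_filtration:
  "sets (enlarged_filtration \<Omega> W \<zeta> t) = sigma_sets (space \<Omega>)
    ({W s -` A \<inter> space \<Omega> | s A. 0 \<le> s \<and> s \<le> t \<and> A \<in> sets borel} \<union> {\<zeta> -` A \<inter> space \<Omega> | A. A \<in> sets borel})"
  unfolding enlarged_filtration_def by (rule sets_measure_of) auto

lemma measurable_enlarged_filtration_process:
  assumes "0 \<le> s" "s \<le> t" shows "W s \<in> borel_measurable (enlarged_filtration \<Omega> W \<zeta> t)"
  by (rule measurableI) (use assms in \<open>auto simp: sets_enlarged_filtration intro!: sigma_sets.Basic\<close>)

lemma measurable_enlarged_filtration_parameter:
  "\<zeta> \<in> borel_measurable (enlarged_filtration \<Omega> W \<zeta> t)"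
  by (rule measurableI) (auto simp: sets_enlarged_filtration intro!: sigma_sets.Basic)

lemma enlarged_filtration_subset:
  assumes N: "space N = space \<Omega>" and W: "\<And>s. 0 \<le> s \<Longrightarrow> s \<le> t \<Longrightarrow> W s \<in> borel_measurable N"
    and zeta: "\<zeta> \<in> borel_measurable N"
  shows "sets (enlarged_filtration \<Omega> W \<zeta> t) \<subseteq> sets N"
  unfolding sets_enlarged_filtration N[symmetric]
  using W zeta by (intro sets.sigma_sets_subset) (auto intro: measurable_sets)

lemma enlarged_filtration_mono:
  assumes "s \<le> t"
  shows "sets (enlarged_filtration \<Omega> W \<zeta> s) \<subseteq> sets (enlarged_filtration \<Omega> W \<zeta> t)"
  using assms by (intro enlarged_filtration_subset measurable_enlarged_filtration_process
      measurable_enlarged_filtration_parameter) auto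

lemma measurable_sub_algebra:
  assumes f: "f \<in> measurable A B" and "space A = space C" "sets A \<subseteq> sets C"
  shows "f \<in> measurable C B"
  using assms by (auto simp: measurable_def)

text \<open>Passage from independent families of events to product measures, for values in arbitrary
  and possibly different spaces; it is needed for pairs such as a complex and a real variable
  against an increment.\<close>

lemma (in prob_space) distr_pair_indep_set:
  assumes ind: "indep_set \<A> \<B>"
    and X [measurable]: "X \<in> M \<rightarrow>\<^sub>M S" and Y [measurable]: "Y \<in> M \<rightarrow>\<^sub>M T"
    and XA: "\<And>E. E \<in> sets S \<Longrightarrow> X -` E \<inter> space M \<in> \<A>"
    and YB: "\<And>E. E \<in> sets T \<Longrightarrow> Y -` E \<inter> space M \<in> \<B>"
  shows "distr M S X \<Otimes>\<^sub>M distr M T Y = distr M (S \<Otimes>\<^sub>M T) (\<lambda>\<omega>. (X \<omega>, Y \<omega>))"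
proof -
  interpret X: prob_space "distr M S X" by (rule prob_space_distr) fact
  interpret Y: prob_space "distr M T Y" by (rule prob_space_distr) fact
  show ?thesis
  proof (rule pair_measure_eqI)
    show "sigma_finite_measure (distr M S X)" ..
    show "sigma_finite_measure (distr M T Y)" ..
    fix A B assume "A \<in> sets (distr M S X)" "B \<in> sets (distr M T Y)"
    then have [measurable]: "A \<in> sets S" "B \<in> sets T" by auto
    have eq: "(\<lambda>\<omega>. (X \<omega>, Y \<omega>)) -` (A \<times> B) \<inter> space M = (X -` A \<inter> space M) \<inter> (Y -` B \<inter> space M)" by auto
    show "emeasure (distr M S X) A * emeasure (distr M T Y) B =
        emeasure (distr M (S \<Otimes>\<^sub>M T) (\<lambda>\<omega>. (X \<omega>, Y \<omega>))) (A \<times> B)"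
      using indep_setD[OF ind XA YB, of A B]
      by (simp add: emeasure_distr eq emeasure_eq_measure ennreal_mult)
  qed simp
qed

lemma (in prob_space) expectation_iexp_normal:
  assumes D: "distributed M lborel D (normal_density 0 s)" and s: "0 < s"
  shows "(\<integral>\<omega>. iexp (a * D \<omega>) \<partial>M) = complex_of_real (exp (- (a^2 * s^2) / 2))"
proof -
  have [measurable]: "D \<in> borel_measurable M" using distributed_measurable[OF D] by simp
  have "distributed M lborel (\<lambda>\<omega>. (D \<omega> - 0) / s) std_normal_density"
    using D normal_standard_normal_convert[OF s, of D 0] by simp
  from distributed_distr_eq_density[OF this]
  have eq: "distr M borel (\<lambda>\<omega>. D \<omega> / s) = std_normal_distribution"
    by (simp cong: distr_cong)
  have "(\<integral>\<omega>. iexp (a * D \<omega>) \<partial>M) = (\<integral>\<omega>. iexp ((a * s) * (D \<omega> / s)) \<partial>M)"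
    using s by simp
  also have "\<dots> = char (distr M borel (\<lambda>\<omega>. D \<omega> / s)) (a * s)"
    unfolding char_def by (subst integral_distr) auto
  finally show ?thesis by (simp add: eq char_std_normal_distribution power_mult_distrib)
qed

text \<open>With \<open>(X, \<xi>)\<close> frozen, D is a centred Gaussian of variance s^2, and the
  mean of exp(i a \<xi> D) is exp(-a^2 \<xi>^2 s^2 / 2), the inverse of the compensator. The bounds
  on X and \<xi> give the integrability for Fubini.\<close>

lemma (in prob_space) expectation_gaussian_exponential:
  fixes X :: "'a \<Rightarrow> complex" and \<xi> D :: "'a \<Rightarrow> real"
  assumes Xm [measurable]: "X \<in> borel_measurable M" and \<xi>m [measurable]: "\<xi> \<in> borel_measurable M"
    and ind: "distr M (borel \<Otimes>\<^sub>M borel) (\<lambda>\<omega>. (X \<omega>, \<xi> \<omega>)) \<Otimes>\<^sub>M distr M borel D =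
      distr M ((borel \<Otimes>\<^sub>M borel) \<Otimes>\<^sub>M borel) (\<lambda>\<omega>. ((X \<omega>, \<xi> \<omega>), D \<omega>))"
    and D: "distributed M lborel D (normal_density 0 s)" and s: "0 < s"
    and X: "\<And>\<omega>. \<omega> \<in> space M \<Longrightarrow> norm (X \<omega>) \<le> c" and \<xi>: "\<And>\<omega>. \<omega> \<in> space M \<Longrightarrow> \<bar>\<xi> \<omega>\<bar> \<le> C"
  shows "(\<integral>\<omega>. X \<omega> * exp (\<i> * of_real (a * \<xi> \<omega> * D \<omega>) + of_real (a\<^sup>2 * (\<xi> \<omega>)\<^sup>2 * s\<^sup>2 / 2)) \<partial>M) = (\<integral>\<omega>. X \<omega> \<partial>M)"
proof -
  define Z where "Z \<omega> = (X \<omega>, \<xi> \<omega>)" for \<omega>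
  have Z [measurable]: "Z \<in> M \<rightarrow>\<^sub>M borel \<Otimes>\<^sub>M borel" unfolding Z_def by measurable
  have Dm [measurable]: "D \<in> borel_measurable M" using distributed_measurable[OF D] by simp
  define h :: "(complex \<times> real) \<times> real \<Rightarrow> complex" where
    "h p = fst (fst p) * exp (\<i> * of_real (a * snd (fst p) * snd p) + of_real (a\<^sup>2 * (snd (fst p))\<^sup>2 * s\<^sup>2 / 2))" for p
  have hm [measurable]: "h \<in> borel_measurable ((borel \<Otimes>\<^sub>M borel) \<Otimes>\<^sub>M borel)" unfolding h_def by measurable
  let ?L1 = "distr M (borel \<Otimes>\<^sub>M borel) Z" and ?L2 = "distr M borel D"
  interpret L1: prob_space ?L1 by (rule prob_space_distr) measurable
  interpret L2: prob_space ?L2 by (rule prob_space_distr) measurable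
  interpret P: pair_sigma_finite ?L1 ?L2 ..
  have eq: "?L1 \<Otimes>\<^sub>M ?L2 = distr M ((borel \<Otimes>\<^sub>M borel) \<Otimes>\<^sub>M borel) (\<lambda>\<omega>. (Z \<omega>, D \<omega>))"
    using ind by (simp add: Z_def[abs_def])
  have bound: "norm (h (Z \<omega>, D \<omega>)) \<le> c * exp (a\<^sup>2 * C\<^sup>2 * s\<^sup>2 / 2)" if "\<omega> \<in> space M" for \<omega>
  proof -
    have "(\<xi> \<omega>)\<^sup>2 \<le> C\<^sup>2" using \<xi>[OF that] by (metis abs_ge_zero power2_abs power_mono)
    then have "exp (a\<^sup>2 * (\<xi> \<omega>)\<^sup>2 * s\<^sup>2 / 2) \<le> exp (a\<^sup>2 * C\<^sup>2 * s\<^sup>2 / 2)"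
      by (simp add: mult_left_mono mult_right_mono)
    then show ?thesis using X[OF that]
      by (auto simp: h_def Z_def norm_mult intro!: mult_mono order_trans[OF norm_ge_zero X[OF that]])
  qed
  have inth: "integrable M (\<lambda>\<omega>. h (Z \<omega>, D \<omega>))"
    by (rule integrable_const_bound) (use bound in \<open>auto intro: AE_I2\<close>)
  have "(\<integral>\<omega>. h (Z \<omega>, D \<omega>) \<partial>M) = (\<integral>p. h p \<partial>(?L1 \<Otimes>\<^sub>M ?L2))"
    unfolding eq by (subst integral_distr) auto
  also have "\<dots> = (\<integral>z. (\<integral>d. h (z, d) \<partial>?L2) \<partial>?L1)"
  proof (rule P.integral_fst'[symmetric])
    show "integrable (?L1 \<Otimes>\<^sub>M ?L2) h" unfolding eq using inth by (subst integrable_distr_eq) auto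
  qed
  also have "\<dots> = (\<integral>z. fst z \<partial>?L1)"
  proof (rule Bochner_Integration.integral_cong[OF refl])
    fix z :: "complex \<times> real"
    have [measurable]: "(\<lambda>d. h (z, d)) \<in> borel_measurable borel" unfolding h_def by simp
    have "(\<integral>d. h (z, d) \<partial>?L2) = (\<integral>\<omega>. h (z, D \<omega>) \<partial>M)"
      by (subst integral_distr) auto
    also have "\<dots> = (\<integral>\<omega>. (fst z * exp (of_real (a\<^sup>2 * (snd z)\<^sup>2 * s\<^sup>2 / 2))) * iexp ((a * snd z) * D \<omega>) \<partial>M)"
      by (simp add: h_def exp_add mult_ac)
    also have "\<dots> = (fst z * exp (of_real (a\<^sup>2 * (snd z)\<^sup>2 * s\<^sup>2 / 2))) * (\<integral>\<omega>. iexp ((a * snd z) * D \<omega>) \<partial>M)"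
      by (rule integral_mult_right_zero)
    also have "\<dots> = fst z"
      unfolding expectation_iexp_normal[OF D s]
      by (simp add: exp_of_real[symmetric] mult_exp_exp power_mult_distrib del: exp_of_real)
    finally show "(\<integral>d. h (z, d) \<partial>?L2) = fst z" .
  qed
  also have "\<dots> = (\<integral>\<omega>. X \<omega> \<partial>M)" by (subst integral_distr) (auto simp: Z_def)
  finally show ?thesis by (simp add: h_def Z_def)
qed


section \<open>Exponential martingales of simple processes\<close>

text \<open>A constant parameter generates the trivial algebra and is independent of everything, so
  this setting covers conditional and randomised components alike.\<close>

locale brownian_with_parameter = prob_space M for M :: "'a measure" +
  fixes W :: "real \<Rightarrow> 'a \<Rightarrow> real" and \<zeta> :: "'a \<Rightarrow> real"
  assumes bm: "standard_brownian_motion M W"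
    and parameter_measurable [measurable]: "\<zeta> \<in> borel_measurable M"
    and parameter_indep: "indep_set (process_events M {0..} W)
      (sigma_sets (space M) {\<zeta> -` A \<inter> space M | A. A \<in> sets borel})"
begin

abbreviation filtration :: "real \<Rightarrow> 'a measure" where
  "filtration \<equiv> enlarged_filtration M W \<zeta>"

lemma brownian_measurable: "0 \<le> t \<Longrightarrow> W t \<in> borel_measurable M"
  using bm by (auto simp: standard_brownian_motion_def)

lemma filtration_subset: "sets (filtration t) \<subseteq> sets M"
  by (intro enlarged_filtration_subset) (auto simp: brownian_measurable)

lemma filtration_measurable: "f \<in> measurable (filtration t) N \<Longrightarrow> f \<in> measurable M N"
  by (rule measurable_sub_algebra[OF _ _ filtration_subset]) auto

lemma filtration_measurable_mono:
  "f \<in> measurable (filtration s) N \<Longrightarrow> s \<le> t \<Longrightarrow> f \<in> measurable (filtration t) N"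
  by (rule measurable_sub_algebra[OF _ _ enlarged_filtration_mono]) auto

lemma exponential_increment:
  fixes X :: "'a \<Rightarrow> complex"
  assumes r: "0 \<le> r" "r \<le> r'"
    and X: "X \<in> borel_measurable (filtration r)" "\<And>\<omega>. \<omega> \<in> space M \<Longrightarrow> norm (X \<omega>) \<le> c"
    and \<xi>: "\<xi> \<in> borel_measurable (filtration r)" "\<And>\<omega>. \<omega> \<in> space M \<Longrightarrow> \<bar>\<xi> \<omega>\<bar> \<le> C"
  shows "(\<integral>\<omega>. X \<omega> * exp (\<i> * of_real (a * \<xi> \<omega> * (W r' \<omega> - W r \<omega>)) + of_real (a\<^sup>2 * (\<xi> \<omega>)\<^sup>2 * (r' - r) / 2)) \<partial>M)
    = (\<integral>\<omega>. X \<omega> \<partial>M)"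
\<comment> \<open>The Gaussian law is available only for a positive time difference; for r = r' the
  increment and the compensator both vanish.\<close>
proof (cases "r = r'")
  case False
  with r have rr: "r < r'" by simp
  note [measurable] = filtration_measurable[OF X(1)] filtration_measurable[OF \<xi>(1)]
  have [measurable]: "W r \<in> borel_measurable M" "W r' \<in> borel_measurable M" using r by (auto intro: brownian_measurable)
  have D: "distributed M lborel (\<lambda>\<omega>. W r' \<omega> - W r \<omega>) (normal_density 0 (sqrt (r' - r)))"
    using bm r rr by (auto simp: standard_brownian_motion_def)
  have pm: "(\<lambda>\<omega>. (X \<omega>, \<xi> \<omega>)) \<in> filtration r \<rightarrow>\<^sub>M borel \<Otimes>\<^sub>M borel"
    using X(1) \<xi>(1) by (rule measurable_Pair)
  have "distr M (borel \<Otimes>\<^sub>M borel) (\<lambda>\<omega>. (X \<omega>, \<xi> \<omega>)) \<Otimes>\<^sub>M distr M borel (\<lambda>\<omega>. W r' \<omega> - W r \<omega>) =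
      distr M ((borel \<Otimes>\<^sub>M borel) \<Otimes>\<^sub>M borel) (\<lambda>\<omega>. ((X \<omega>, \<xi> \<omega>), W r' \<omega> - W r \<omega>))"
    by (rule distr_pair_indep_set[OF brownian_increment_indep[OF bm r parameter_measurable parameter_indep]])
       (use measurable_sets[OF pm] in \<open>auto intro!: sigma_sets.Basic\<close>)
  from expectation_gaussian_exponential[OF _ _ this D _ X(2) \<xi>(2), of a] rr show ?thesis by simp
qed simp

text \<open>The exponential is a product over the grid intervals. Each partial product is bounded
  and known at the left end of the next interval, so it can take the role of X in
  \<open>exponential_increment\<close>, which removes the factors one by one until only G is
  left.\<close>

lemma exponential_martingale:
  fixes G :: "'a \<Rightarrow> complex"
  assumes sp: "simple_process filtration T n r \<xi>"
    and G: "G \<in> borel_measurable (filtration 0)" "\<And>\<omega>. \<omega> \<in> space M \<Longrightarrow> norm (G \<omega>) \<le> c"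
  shows "(\<integral>\<omega>. G \<omega> * exp (\<i> * of_real (a * simple_integral W n r \<xi> \<omega>)
      + of_real (a\<^sup>2 * (\<Sum>k<n. (\<xi> k \<omega>)\<^sup>2 * (r (Suc k) - r k)) / 2)) \<partial>M) = (\<integral>\<omega>. G \<omega> \<partial>M)"
proof -
  have r0: "r 0 = 0" and rmono: "\<And>k. k < n \<Longrightarrow> r k \<le> r (Suc k)"
    and \<xi>: "\<And>k. k < n \<Longrightarrow> \<xi> k \<in> borel_measurable (filtration (r k))"
    and bd: "\<And>k. k < n \<Longrightarrow> \<exists>C. \<forall>\<omega>\<in>space M. \<bar>\<xi> k \<omega>\<bar> \<le> C"
    using sp by (auto simp: simple_process_def)
  have rpos: "k \<le> n \<Longrightarrow> 0 \<le> r k" for k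
    by (induction k) (use r0 rmono in \<open>auto intro: order_trans\<close>)
  define E where "E k \<omega> = exp (\<i> * of_real (a * \<xi> k \<omega> * (W (r (Suc k)) \<omega> - W (r k) \<omega>))
      + of_real (a\<^sup>2 * (\<xi> k \<omega>)\<^sup>2 * (r (Suc k) - r k) / 2))" for k \<omega>
  define N where "N k \<omega> = G \<omega> * (\<Prod>i<k. E i \<omega>)" for k \<omega>
  have "N k \<in> borel_measurable (filtration (r k)) \<and> (\<exists>c. \<forall>\<omega>\<in>space M. norm (N k \<omega>) \<le> c) \<and>
      (\<integral>\<omega>. N k \<omega> \<partial>M) = (\<integral>\<omega>. G \<omega> \<partial>M)" if "k \<le> n" for k
    using that
  proof (induction k)
    case 0
    then show ?case using G by (auto simp: N_def r0)
  next
    case (Suc k)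
    then have k: "k < n" by simp
    from Suc obtain c where Nm: "N k \<in> borel_measurable (filtration (r k))"
      and Nb: "\<And>\<omega>. \<omega>\<in>space M \<Longrightarrow> norm (N k \<omega>) \<le> c" and Ne: "(\<integral>\<omega>. N k \<omega> \<partial>M) = (\<integral>\<omega>. G \<omega> \<partial>M)" by auto
    obtain C where C: "\<And>\<omega>. \<omega>\<in>space M \<Longrightarrow> \<bar>\<xi> k \<omega>\<bar> \<le> C" using bd[OF k] by auto
    have NS: "N (Suc k) \<omega> = N k \<omega> * E k \<omega>" for \<omega> by (simp add: N_def mult_ac)
    have [measurable]: "N k \<in> borel_measurable (filtration (r (Suc k)))"
      "\<xi> k \<in> borel_measurable (filtration (r (Suc k)))"
      "W (r k) \<in> borel_measurable (filtration (r (Suc k)))"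
      "W (r (Suc k)) \<in> borel_measurable (filtration (r (Suc k)))"
      using rmono[OF k] rpos[of k] rpos[of "Suc k"] k
      by (auto intro: filtration_measurable_mono[OF Nm] filtration_measurable_mono[OF \<xi>[OF k]]
          measurable_enlarged_filtration_process)
    have "N (Suc k) \<in> borel_measurable (filtration (r (Suc k)))"
      unfolding NS[abs_def] E_def by measurable
    moreover have "norm (N (Suc k) \<omega>) \<le> c * exp (a\<^sup>2 * C\<^sup>2 * (r (Suc k) - r k) / 2)" if w: "\<omega> \<in> space M" for \<omega>
    proof -
      have "(\<xi> k \<omega>)\<^sup>2 \<le> C\<^sup>2" using C[OF w] by (metis abs_ge_zero power2_abs power_mono)
      then have "exp (a\<^sup>2 * (\<xi> k \<omega>)\<^sup>2 * (r (Suc k) - r k) / 2) \<le> exp (a\<^sup>2 * C\<^sup>2 * (r (Suc k) - r k) / 2)"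
        using rmono[OF k] by (simp add: mult_left_mono mult_right_mono)
      then show ?thesis unfolding NS using Nb[OF w]
        by (auto simp: E_def norm_mult intro!: mult_mono order_trans[OF norm_ge_zero Nb[OF w]])
    qed
    moreover have "(\<integral>\<omega>. N (Suc k) \<omega> \<partial>M) = (\<integral>\<omega>. G \<omega> \<partial>M)"
      unfolding NS E_def Ne[symmetric]
      by (rule exponential_increment[OF rpos[OF less_imp_le[OF k]] rmono[OF k] Nm Nb \<xi>[OF k] C])
    ultimately show ?case by blast
  qed
  from this[of n] have "(\<integral>\<omega>. N n \<omega> \<partial>M) = (\<integral>\<omega>. G \<omega> \<partial>M)" by simp
  moreover have "N n \<omega> = G \<omega> * exp (\<i> * of_real (a * simple_integral W n r \<xi> \<omega>)
      + of_real (a\<^sup>2 * (\<Sum>k<n. (\<xi> k \<omega>)\<^sup>2 * (r (Suc k) - r k)) / 2))" for \<omega>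
    unfolding N_def E_def exp_sum[OF finite_lessThan, symmetric] simple_integral_def
    by (simp add: sum.distrib sum_distrib_left sum_divide_distrib mult_ac)
  ultimately show ?thesis by simp
qed

end

section \<open>Stopping, and convergence of quadratic variations\<close>

text \<open>Stopping a simple process before its quadratic variation exceeds \<open>C\<close> keeps it adapted and
  makes the exponential martingale bounded.\<close>

definition stopped :: "real \<Rightarrow> (nat \<Rightarrow> real) \<Rightarrow> (nat \<Rightarrow> 'a \<Rightarrow> real) \<Rightarrow> nat \<Rightarrow> 'a \<Rightarrow> real" where
  "stopped C r \<xi> k \<omega> = (if (\<Sum>i\<le>k. (\<xi> i \<omega>)\<^sup>2 * (r (Suc i) - r i)) \<le> C then \<xi> k \<omega> else 0)"

text \<open>The induction needs the stronger bound by the minimum of C and the unstopped sum. While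
  the unstopped sum is at most C it dominates the stopped one; once it exceeds C it stays above, and
  further terms are 0.\<close>

lemma stopped_quadratic_variation_le:
  assumes C: "0 \<le> C" and r: "\<And>k. k < n \<Longrightarrow> r k \<le> r (Suc k)"
  shows "(\<Sum>k<n. (stopped C r \<xi> k \<omega>)\<^sup>2 * (r (Suc k) - r k)) \<le> C"
proof -
  have "(\<Sum>k<m. (stopped C r \<xi> k \<omega>)\<^sup>2 * (r (Suc k) - r k)) \<le> min C (\<Sum>k<m. (\<xi> k \<omega>)\<^sup>2 * (r (Suc k) - r k))"
    if "m \<le> n" for m
    using that
  proof (induction m)
    case (Suc m)
    have "0 \<le> (\<xi> m \<omega>)\<^sup>2 * (r (Suc m) - r m)" using r[of m] Suc.prems by simp
    then show ?case using Suc by (auto simp: stopped_def lessThan_Suc_atMost[symmetric])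
  qed (use C in auto)
  from this[of n] show ?thesis by simp
qed

lemma stopped_eq:
  assumes r: "\<And>k. k < n \<Longrightarrow> r k \<le> r (Suc k)"
    and le: "(\<Sum>k<n. (\<xi> k \<omega>)\<^sup>2 * (r (Suc k) - r k)) \<le> C" and k: "k < n"
  shows "stopped C r \<xi> k \<omega> = \<xi> k \<omega>"
proof -
  have "(\<Sum>i\<le>k. (\<xi> i \<omega>)\<^sup>2 * (r (Suc i) - r i)) \<le> (\<Sum>k<n. (\<xi> k \<omega>)\<^sup>2 * (r (Suc k) - r k))"
    by (rule sum_mono2) (use k r in auto)
  with le show ?thesis by (simp add: stopped_def)
qed

context brownian_with_parameter begin

text \<open>The decision for interval k looks ahead to the end of that interval, but the quadratic
  variation there depends only on the coefficients up to \<open>\<xi> k\<close> and the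
  deterministic lengths, all known at time \<open>r k\<close>.\<close>

lemma simple_process_stopped:
  assumes sp: "simple_process filtration T n r \<xi>"
  shows "simple_process filtration T n r (stopped C r \<xi>)"
proof -
  have r0: "r 0 = 0" and rmono: "\<And>k. k < n \<Longrightarrow> r k \<le> r (Suc k)"
    and \<xi>: "\<And>k. k < n \<Longrightarrow> \<xi> k \<in> borel_measurable (filtration (r k))"
    and bd: "\<And>k. k < n \<Longrightarrow> \<exists>C. \<forall>\<omega>\<in>space M. \<bar>\<xi> k \<omega>\<bar> \<le> C"
    using sp by (auto simp: simple_process_def)
  have rle: "i \<le> k \<Longrightarrow> k < n \<Longrightarrow> r i \<le> r k" for i k
    by (induction k rule: dec_induct) (auto intro: order_trans[OF _ rmono])
  have "stopped C r \<xi> k \<in> borel_measurable (filtration (r k))" if k: "k < n" for k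
  proof -
    have [measurable]: "\<xi> i \<in> borel_measurable (filtration (r k))" if "i \<in> {..k}" for i
      by (rule filtration_measurable_mono[OF \<xi>]) (use that k rle in auto)
    have [measurable]: "\<xi> k \<in> borel_measurable (filtration (r k))" by (rule \<xi>[OF k])
    show ?thesis unfolding stopped_def by measurable
  qed
  moreover have "\<exists>c. \<forall>\<omega>\<in>space M. \<bar>stopped C r \<xi> k \<omega>\<bar> \<le> c" if k: "k < n" for k
  proof -
    obtain c where "\<forall>\<omega>\<in>space M. \<bar>\<xi> k \<omega>\<bar> \<le> c" using bd[OF k] by auto
    then show ?thesis by (intro exI[of _ "max c 0"]) (auto simp: stopped_def)
  qed
  ultimately show ?thesis using sp by (auto simp: simple_process_def)
qed

end

text \<open>The half-open grid intervals are disjoint, so the off-diagonal products in the square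
  vanish.\<close>

lemma nn_integral_simple_value_square:
  assumes r: "r 0 = 0" "r n = T" "\<And>k. k < n \<Longrightarrow> r k \<le> r (Suc k)"
  shows "(\<integral>\<^sup>+u\<in>{0..T}. ennreal ((simple_value n r \<xi> u \<omega>)\<^sup>2) \<partial>lborel) = ennreal (\<Sum>k<n. (\<xi> k \<omega>)\<^sup>2 * (r (Suc k) - r k))"
proof -
  have rle: "i \<le> k \<Longrightarrow> k \<le> n \<Longrightarrow> r i \<le> r k" for i k
    by (induction k rule: dec_induct) (auto intro: order_trans[OF _ r(3)])
  have sq: "(simple_value n r \<xi> u \<omega>)\<^sup>2 = (\<Sum>k<n. (\<xi> k \<omega>)\<^sup>2 * indicator {r k<..r (Suc k)} u)" for u
  proof -
    have dis: "indicator {r i<..r (Suc i)} u * indicator {r k<..r (Suc k)} u = (0::real)"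
      if "i < n" "k < n" "i \<noteq> k" for i k
      using that rle[of "Suc i" k] rle[of "Suc k" i] by (cases "i < k") (auto simp: indicator_def)
    have "(simple_value n r \<xi> u \<omega>)\<^sup>2 = (\<Sum>i<n. \<Sum>k<n. (\<xi> i \<omega> * indicator {r i<..r (Suc i)} u) * (\<xi> k \<omega> * indicator {r k<..r (Suc k)} u))"
      unfolding simple_value_def power2_eq_square by (rule sum_product)
    also have "\<dots> = (\<Sum>i<n. \<Sum>k<n. if k = i then (\<xi> i \<omega>)\<^sup>2 * indicator {r i<..r (Suc i)} u else 0)"
    proof (intro sum.cong refl)
      fix i k assume "i \<in> {..<n}" "k \<in> {..<n}"
      then show "(\<xi> i \<omega> * indicator {r i<..r (Suc i)} u) * (\<xi> k \<omega> * indicator {r k<..r (Suc k)} u) =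
        (if k = i then (\<xi> i \<omega>)\<^sup>2 * indicator {r i<..r (Suc i)} u else 0)"
        using dis[of i k] by (auto simp: power2_eq_square indicator_def)
    qed
    also have "\<dots> = (\<Sum>k<n. (\<xi> k \<omega>)\<^sup>2 * indicator {r k<..r (Suc k)} u)"
      by (simp add: sum.delta)
    finally show ?thesis .
  qed
  have "(\<integral>\<^sup>+u\<in>{0..T}. ennreal ((simple_value n r \<xi> u \<omega>)\<^sup>2) \<partial>lborel) =
      (\<integral>\<^sup>+u. (\<Sum>k<n. ennreal ((\<xi> k \<omega>)\<^sup>2) * indicator {r k<..r (Suc k)} u) \<partial>lborel)"
  proof (rule nn_integral_cong)
    fix u
    have "indicator {r k<..r (Suc k)} u * indicator {0..T} u = (indicator {r k<..r (Suc k)} u :: ennreal)" if "k < n" for k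
      using that rle[of 0 k] rle[of "Suc k" n] r(1,2) by (auto simp: indicator_def)
    note ind = this
    have "ennreal ((simple_value n r \<xi> u \<omega>)\<^sup>2) = (\<Sum>k<n. ennreal ((\<xi> k \<omega>)\<^sup>2 * indicator {r k<..r (Suc k)} u))"
      unfolding sq by (rule sum_ennreal[symmetric]) auto
    also have "\<dots> = (\<Sum>k<n. ennreal ((\<xi> k \<omega>)\<^sup>2) * indicator {r k<..r (Suc k)} u)"
      by (intro sum.cong) (auto simp: indicator_def)
    finally show "ennreal ((simple_value n r \<xi> u \<omega>)\<^sup>2) * indicator {0..T} u =
        (\<Sum>k<n. ennreal ((\<xi> k \<omega>)\<^sup>2) * indicator {r k<..r (Suc k)} u)"
      by (simp only: sum_distrib_right mult.assoc) (intro sum.cong refl, simp only: lessThan_iff ind)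
  qed
  also have "\<dots> = (\<Sum>k<n. ennreal ((\<xi> k \<omega>)\<^sup>2) * ennreal (r (Suc k) - r k))"
    using r(3) by (subst nn_integral_sum) (auto intro!: sum.cong simp: nn_integral_cmult_indicator)
  also have "\<dots> = ennreal (\<Sum>k<n. (\<xi> k \<omega>)\<^sup>2 * (r (Suc k) - r k))"
    using r(3) by (subst sum_ennreal[symmetric]) (auto simp: ennreal_mult)
  finally show ?thesis .
qed

text \<open>Continuity of the squared norm under L^2 convergence, by Young's inequality with a small
  weight d on the square of the limit h. Taking h, and never \<open>f m\<close>, as the weighted
  function makes one d serve for all m and for both inequalities.\<close>

lemma tendsto_nn_integral_square:
  fixes f :: "nat \<Rightarrow> real \<Rightarrow> real"
  assumes f: "\<And>m. f m \<in> borel_measurable N" and h: "h \<in> borel_measurable N"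
    and Q: "\<And>m. (\<integral>\<^sup>+u. ennreal ((f m u)\<^sup>2) \<partial>N) = ennreal (Q m)" "\<And>m. 0 \<le> Q m"
    and V: "(\<integral>\<^sup>+u. ennreal ((h u)\<^sup>2) \<partial>N) = ennreal V" "0 \<le> V"
    and lim: "(\<lambda>m. \<integral>\<^sup>+u. ennreal ((f m u - h u)\<^sup>2) \<partial>N) \<longlonglongrightarrow> 0"
  shows "Q \<longlonglongrightarrow> V"
proof (rule LIMSEQ_I)
  fix \<epsilon> :: real assume \<epsilon>: "0 < \<epsilon>"
  note [measurable] = f h
  \<comment> \<open>With V + 1 in place of V the quotient is defined also for V = 0, and d V stays
    below \<epsilon>/2.\<close>
  define d where "d = \<epsilon> / (2 * (V + 1))"
  have d: "0 < d" "d * V < \<epsilon> / 2"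
    using \<epsilon> V(2) by (auto simp: d_def field_simps)
  define c where "c = 1 + 1 / d"
  have c: "0 < c" using d by (simp add: c_def add_pos_pos)
  \<comment> \<open>Either choice of z gives x^2 \<le> y^2 + 2 z (x - y) + (x - y)^2. Expanding the
    squares with \<open>sqrt d\<close> bounds the mixed term, at the price 1/d that is contained in
    c.\<close>
  have pw: "x\<^sup>2 \<le> y\<^sup>2 + d * z\<^sup>2 + c * (x - y)\<^sup>2" if "z = x \<or> z = y" for x y z :: real
  proof -
    have "0 \<le> (sqrt d * z - (x - y) / sqrt d)\<^sup>2" "0 \<le> (sqrt d * z + (x - y) / sqrt d)\<^sup>2" by auto
    then have "2 * \<bar>z * (x - y)\<bar> \<le> d * z\<^sup>2 + (x - y)\<^sup>2 / d"
      using d(1) by (auto simp: power2_diff power2_sum power_mult_distrib power_divide abs_if)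
    moreover have "c * (x - y)\<^sup>2 = (x-y)\<^sup>2 + (x - y)\<^sup>2 / d" by (simp add: c_def algebra_simps)
    moreover have "x\<^sup>2 \<le> y\<^sup>2 + 2 * (z * (x - y)) + (x - y)\<^sup>2"
      using that zero_le_power2[of "x - y"] by (auto simp: power2_eq_square algebra_simps)
    moreover have "z * (x - y) \<le> \<bar>z * (x - y)\<bar>" by simp
    ultimately show ?thesis by linarith
  qed
  have int: "ennreal A \<le> ennreal B + ennreal (d * V) + ennreal c * E"
    if A: "(\<integral>\<^sup>+u. ennreal ((a u)\<^sup>2) \<partial>N) = ennreal A" and B: "(\<integral>\<^sup>+u. ennreal ((b u)\<^sup>2) \<partial>N) = ennreal B"
      and E: "(\<integral>\<^sup>+u. ennreal ((a u - b u)\<^sup>2) \<partial>N) = E" and ab: "h = a \<or> h = b"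
      and [measurable]: "a \<in> borel_measurable N" "b \<in> borel_measurable N" for a b A B E
  proof -
    have "ennreal A \<le> (\<integral>\<^sup>+u. ennreal ((b u)\<^sup>2) + ennreal d * ennreal ((h u)\<^sup>2) + ennreal c * ennreal ((a u - b u)\<^sup>2) \<partial>N)"
      unfolding A[symmetric]
    proof (rule nn_integral_mono)
      fix u
      have "ennreal ((a u)\<^sup>2) \<le> ennreal ((b u)\<^sup>2 + d * (h u)\<^sup>2 + c * (a u - b u)\<^sup>2)"
        using pw[of "h u" "a u" "b u"] ab by (intro ennreal_leI) auto
      then show "ennreal ((a u)\<^sup>2) \<le> ennreal ((b u)\<^sup>2) + ennreal d * ennreal ((h u)\<^sup>2) + ennreal c * ennreal ((a u - b u)\<^sup>2)"
        using c d by (simp add: ennreal_mult ennreal_plus)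
    qed
    also have "\<dots> = ennreal B + ennreal d * ennreal V + ennreal c * E"
      by (simp add: nn_integral_add nn_integral_cmult B V(1) E)
    finally show ?thesis using d V(2) by (simp add: ennreal_mult)
  qed
  have "eventually (\<lambda>m. (\<integral>\<^sup>+u. ennreal ((f m u - h u)\<^sup>2) \<partial>N) < ennreal (\<epsilon> / (2 * c))) sequentially"
    using order_tendstoD(2)[OF lim, of "ennreal (\<epsilon> / (2 * c))"] c \<epsilon> by simp
  then have "eventually (\<lambda>m. norm (Q m - V) < \<epsilon>) sequentially"
  proof eventually_elim
    case (elim m)
    then obtain e where e: "(\<integral>\<^sup>+u. ennreal ((f m u - h u)\<^sup>2) \<partial>N) = ennreal e" "0 \<le> e"
      by (metis ennreal_cases infinity_ennreal_def not_less_iff_gr_or_eq top.not_eq_extremum order.strict_trans ennreal_less_top)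
    with elim c \<epsilon> have "e < \<epsilon> / (2 * c)" by (simp add: ennreal_less_iff)
    then have ce: "c * e < \<epsilon> / 2" using c by (simp add: field_simps)
    have e': "(\<integral>\<^sup>+u. ennreal ((h u - f m u)\<^sup>2) \<partial>N) = ennreal e"
      using e(1) by (simp add: power2_commute)
    have dV: "0 \<le> d * V" "0 \<le> c * e" using d c e V by auto
    have "ennreal (Q m) \<le> ennreal (V + d * V + c * e)"
      using int[OF Q(1)[of m] V(1) e(1)] dV V(2) c e(2) by (simp add: ennreal_mult ennreal_plus)
    moreover have "ennreal V \<le> ennreal (Q m + d * V + c * e)"
      using int[OF V(1) Q(1)[of m] e'] dV Q(2)[of m] c e(2) by (simp add: ennreal_mult ennreal_plus)
    ultimately have "Q m \<le> V + d * V + c * e" "V \<le> Q m + d * V + c * e"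
      using dV V(2) Q(2)[of m] by (simp_all only: ennreal_le_iff add_nonneg_nonneg)
    then show ?case using ce d by auto
  qed
  then show "\<exists>no. \<forall>n\<ge>no. norm (Q n - V) < \<epsilon>" by (simp add: eventually_sequentially)
qed


section \<open>Law of the Ito integral jointly with its parameter\<close>

context brownian_with_parameter begin

text \<open>Independence arguments need an integral built from W and \<zeta> alone, whereas I is
  only measurable on the whole space. The simple integrals are known at time T; along an almost
  surely convergent subsequence their pointwise \<open>lim\<close>, which is measurable regardless
  of convergence, is such a version.\<close>

lemma ito_integral_version:
  assumes ito: "is_ito_integral M filtration W H T I"
  obtains I' where "I' \<in> borel_measurable (filtration T)" "AE \<omega> in M. I \<omega> = I' \<omega>"
proof -
  obtain n r \<xi> where sp: "\<And>m. simple_process filtration T (n m) (r m) (\<xi> m)"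
    and conv: "converges_in_probability M (\<lambda>m. simple_integral W (n m) (r m) (\<xi> m)) I"
    and Im [measurable]: "I \<in> borel_measurable M"
    using ito unfolding is_ito_integral_def by blast
  define X where "X m = simple_integral W (n m) (r m) (\<xi> m)" for m
  have X: "X m \<in> borel_measurable (filtration T)" for m
  proof -
    have rn: "r m 0 = 0" "r m (n m) = T" and rmono: "\<And>k. k < n m \<Longrightarrow> r m k \<le> r m (Suc k)"
      and \<xi>: "\<And>k. k < n m \<Longrightarrow> \<xi> m k \<in> borel_measurable (filtration (r m k))"
      using sp[of m] by (auto simp: simple_process_def)
    have rle: "i \<le> k \<Longrightarrow> k \<le> n m \<Longrightarrow> r m i \<le> r m k" for i k
      by (induction k rule: dec_induct) (auto intro: order_trans[OF _ rmono])
    have rb: "0 \<le> r m k" "r m k \<le> T" if "k \<le> n m" for k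
      using rle[of 0 k] rle[of k "n m"] that rn by auto
    show ?thesis unfolding X_def simple_integral_def
    proof (intro borel_measurable_sum borel_measurable_times borel_measurable_diff)
      fix k assume "k \<in> {..<n m}"
      then have k: "k < n m" by simp
      show "\<xi> m k \<in> borel_measurable (filtration T)"
        by (rule filtration_measurable_mono[OF \<xi>[OF k] rb(2)]) (use k in simp)
      show "W (r m (Suc k)) \<in> borel_measurable (filtration T)" "W (r m k) \<in> borel_measurable (filtration T)"
        by (rule measurable_enlarged_filtration_process; use rb k in simp)+
    qed
  qed
  have [measurable]: "X m \<in> borel_measurable M" for m by (rule filtration_measurable[OF X])
  obtain s where s: "AE \<omega> in M. (\<lambda>m. ennreal \<bar>X (s m) \<omega> - I \<omega>\<bar>) \<longlonglongrightarrow> 0"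
  proof (rule AE_convergent_subsequence[of "\<lambda>m \<omega>. ennreal \<bar>X m \<omega> - I \<omega>\<bar>"])
    fix e :: real assume "0 < e"
    then show "(\<lambda>m. prob {\<omega> \<in> space M. ennreal e < ennreal \<bar>X m \<omega> - I \<omega>\<bar>}) \<longlonglongrightarrow> 0"
      using conv by (simp add: converges_in_probability_def X_def ennreal_less_iff)
  qed auto
  show ?thesis
  proof
    show "(\<lambda>\<omega>. lim (\<lambda>m. X (s m) \<omega>)) \<in> borel_measurable (filtration T)"
      by (intro borel_measurable_lim_metric X)
    show "AE \<omega> in M. I \<omega> = lim (\<lambda>m. X (s m) \<omega>)"
      using s
    proof eventually_elim
      case (elim \<omega>)
      then have "(\<lambda>m. \<bar>X (s m) \<omega> - I \<omega>\<bar>) \<longlonglongrightarrow> 0"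
        by (subst (asm) tendsto_ennreal_iff[where x=0, simplified]) auto
      then have "(\<lambda>m. X (s m) \<omega>) \<longlonglongrightarrow> I \<omega>"
        by (simp add: LIM_zero_iff tendsto_rabs_zero_iff)
      then show ?case by (simp add: limI)
    qed
  qed
qed

text \<open>The exponential martingales of the approximating simple processes, stopped so as to be
  bounded, have constant expectation, and their exponents converge along a subsequence.\<close>

lemma ito_integral_conditional_char:
  fixes \<phi> :: "real \<Rightarrow> complex"
  assumes ito: "is_ito_integral M filtration W (\<lambda>u \<omega>. g u (\<zeta> \<omega>)) T I"
    and g: "(\<lambda>(u, z). indicator {0..T} u * g u z) \<in> borel_measurable (borel \<Otimes>\<^sub>M borel)"
    and V: "\<And>z. (\<integral>\<^sup>+u\<in>{0..T}. ennreal ((g u z)\<^sup>2) \<partial>lborel) = ennreal (V z)" "\<And>z. 0 \<le> V z"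
    and Vm [measurable]: "V \<in> borel_measurable borel"
    and \<phi> [measurable]: "\<phi> \<in> borel_measurable borel" and bd: "\<And>z. norm (\<phi> z) \<le> c"
  shows "(\<integral>\<omega>. \<phi> (\<zeta> \<omega>) * iexp (a * I \<omega>) \<partial>M) = (\<integral>\<omega>. \<phi> (\<zeta> \<omega>) * exp (of_real (- (a\<^sup>2 * V (\<zeta> \<omega>) / 2))) \<partial>M)"
proof -
  obtain n r \<xi> where sp: "\<And>m. simple_process filtration T (n m) (r m) (\<xi> m)"
    and conv1: "\<And>e. 0 < e \<Longrightarrow> (\<lambda>m. prob {\<omega> \<in> space M.
            (\<integral>\<^sup>+u\<in>{0..T}. ennreal ((simple_value (n m) (r m) (\<xi> m) u \<omega> - g u (\<zeta> \<omega>))\<^sup>2) \<partial>lborel)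
              > ennreal e}) \<longlonglongrightarrow> 0"
    and conv: "converges_in_probability M (\<lambda>m. simple_integral W (n m) (r m) (\<xi> m)) I"
    and Im [measurable]: "I \<in> borel_measurable M"
    using ito unfolding is_ito_integral_def by blast
  have rn: "r m 0 = 0" "r m (n m) = T" and rmono: "\<And>k. k < n m \<Longrightarrow> r m k \<le> r m (Suc k)"
    and \<xi>: "\<And>k. k < n m \<Longrightarrow> \<xi> m k \<in> borel_measurable (filtration (r m k))" for m
    using sp[of m] by (auto simp: simple_process_def)
  have rle: "i \<le> k \<Longrightarrow> k \<le> n m \<Longrightarrow> r m i \<le> r m k" for i k m
    by (induction k rule: dec_induct) (auto intro: order_trans[OF _ rmono])
  have rb: "0 \<le> r m k" if "k \<le> n m" for k m
    using rle[of 0 k m] that rn[of m] by auto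
  have \<xi>m: "\<xi> m k \<in> borel_measurable M" if "k < n m" for k m
    by (rule filtration_measurable[OF \<xi>[OF that]])
  have Wm: "W (r m k) \<in> borel_measurable M" if "k \<le> n m" for k m
    by (rule brownian_measurable[OF rb[OF that]])
  define X where "X m = simple_integral W (n m) (r m) (\<xi> m)" for m
  define Q where "Q m \<omega> = (\<Sum>k<n m. (\<xi> m k \<omega>)\<^sup>2 * (r m (Suc k) - r m k))" for m \<omega>
  define e where "e m \<omega> = (\<integral>\<^sup>+u\<in>{0..T}. ennreal ((simple_value (n m) (r m) (\<xi> m) u \<omega> - g u (\<zeta> \<omega>))\<^sup>2) \<partial>lborel)" for m \<omega>
  have Xm [measurable]: "X m \<in> borel_measurable M" for m
    unfolding X_def simple_integral_def
    by (intro borel_measurable_sum borel_measurable_times borel_measurable_diff \<xi>m Wm) auto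
  have Qm [measurable]: "Q m \<in> borel_measurable M" for m
    unfolding Q_def by (intro borel_measurable_sum borel_measurable_times borel_measurable_power \<xi>m) auto
  have em [measurable]: "e m \<in> borel_measurable M" for m
  proof -
    have "(\<lambda>p. indicator {0..T} (snd p) * (simple_value (n m) (r m) (\<xi> m) (snd p) (fst p) - g (snd p) (\<zeta> (fst p))))
        \<in> borel_measurable (M \<Otimes>\<^sub>M lborel)"
    proof -
      have "(\<lambda>p. (\<lambda>(u, z). indicator {0..T} u * g u z) (snd p, \<zeta> (fst p))) \<in> borel_measurable (M \<Otimes>\<^sub>M lborel)"
        by (rule measurable_compose[OF _ g]) measurable
      moreover have "(\<lambda>p. simple_value (n m) (r m) (\<xi> m) (snd p) (fst p)) \<in> borel_measurable (M \<Otimes>\<^sub>M lborel)"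
        unfolding simple_value_def
        by (intro borel_measurable_sum borel_measurable_times measurable_compose[OF measurable_fst \<xi>m]) measurable
      ultimately show ?thesis by (simp add: right_diff_distrib)
    qed
    note [measurable] = this
    have "(\<lambda>\<omega>. \<integral>\<^sup>+u. ennreal ((indicator {0..T} u * (simple_value (n m) (r m) (\<xi> m) u \<omega> - g u (\<zeta> \<omega>)))\<^sup>2) \<partial>lborel) \<in> borel_measurable M"
      by (intro lborel.borel_measurable_nn_integral) (simp add: split_beta')
    also have "(\<lambda>\<omega>. \<integral>\<^sup>+u. ennreal ((indicator {0..T} u * (simple_value (n m) (r m) (\<xi> m) u \<omega> - g u (\<zeta> \<omega>)))\<^sup>2) \<partial>lborel) = e m"
      unfolding e_def by (intro ext nn_integral_cong) (auto simp: indicator_def)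
    finally show ?thesis .
  qed
  \<comment> \<open>Applying the subsequence lemma to the maximum yields one subsequence for the L^2
    errors in time and for the integrals.\<close>
  obtain s where s: "AE \<omega> in M. (\<lambda>m. max (e (s m) \<omega>) (ennreal \<bar>X (s m) \<omega> - I \<omega>\<bar>)) \<longlonglongrightarrow> 0"
  proof (rule AE_convergent_subsequence[of "\<lambda>m \<omega>. max (e m \<omega>) (ennreal \<bar>X m \<omega> - I \<omega>\<bar>)"])
    fix d :: real assume d: "0 < d"
    have "(\<lambda>m. prob {\<omega> \<in> space M. ennreal d < e m \<omega>} + prob {\<omega> \<in> space M. ennreal d < ennreal \<bar>X m \<omega> - I \<omega>\<bar>}) \<longlonglongrightarrow> 0 + 0"
      using conv1[OF d] conv d
      by (intro tendsto_add) (simp_all add: converges_in_probability_def X_def e_def ennreal_less_iff)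
    then have lim0: "(\<lambda>m. prob {\<omega> \<in> space M. ennreal d < e m \<omega>} + prob {\<omega> \<in> space M. ennreal d < ennreal \<bar>X m \<omega> - I \<omega>\<bar>}) \<longlonglongrightarrow> 0"
      by simp
    have "prob {\<omega> \<in> space M. ennreal d < max (e m \<omega>) (ennreal \<bar>X m \<omega> - I \<omega>\<bar>)}
        \<le> prob {\<omega> \<in> space M. ennreal d < e m \<omega>} + prob {\<omega> \<in> space M. ennreal d < ennreal \<bar>X m \<omega> - I \<omega>\<bar>}" for m
    proof -
      have "{\<omega> \<in> space M. ennreal d < max (e m \<omega>) (ennreal \<bar>X m \<omega> - I \<omega>\<bar>)} =
        {\<omega> \<in> space M. ennreal d < e m \<omega>} \<union> {\<omega> \<in> space M. ennreal d < ennreal \<bar>X m \<omega> - I \<omega>\<bar>}"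
        by (auto simp: less_max_iff_disj)
      then show ?thesis by (simp only:) (rule measure_Un_le; measurable)
    qed
    then show "(\<lambda>m. prob {\<omega> \<in> space M. ennreal d < max (e m \<omega>) (ennreal \<bar>X m \<omega> - I \<omega>\<bar>)}) \<longlonglongrightarrow> 0"
      by (intro tendsto_sandwich[OF _ _ tendsto_const lim0] always_eventually allI) auto
  qed auto
  have XI: "AE \<omega> in M. (\<lambda>m. X (s m) \<omega>) \<longlonglongrightarrow> I \<omega>"
    using s
  proof eventually_elim
    case (elim \<omega>)
    have "(\<lambda>m. ennreal \<bar>X (s m) \<omega> - I \<omega>\<bar>) \<longlonglongrightarrow> 0"
      by (rule tendsto_sandwich[OF _ _ tendsto_const elim]) auto
    then have "(\<lambda>m. \<bar>X (s m) \<omega> - I \<omega>\<bar>) \<longlonglongrightarrow> 0"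
      by (subst (asm) tendsto_ennreal_iff[where x=0, simplified]) auto
    then show ?case by (simp add: LIM_zero_iff tendsto_rabs_zero_iff)
  qed
  have QV: "AE \<omega> in M. (\<lambda>m. Q (s m) \<omega>) \<longlonglongrightarrow> V (\<zeta> \<omega>)"
    using s AE_space
  proof eventually_elim
    case (elim \<omega>)
    have e0: "(\<lambda>m. e (s m) \<omega>) \<longlonglongrightarrow> 0"
      by (rule tendsto_sandwich[OF _ _ tendsto_const elim(1)]) auto
    show ?case
    proof (rule tendsto_nn_integral_square[where N = lborel
          and f = "\<lambda>m u. indicator {0..T} u * simple_value (n (s m)) (r (s m)) (\<xi> (s m)) u \<omega>"
          and h = "\<lambda>u. indicator {0..T} u * g u (\<zeta> \<omega>)"])
      show "(\<lambda>u. indicator {0..T} u * simple_value (n (s m)) (r (s m)) (\<xi> (s m)) u \<omega>) \<in> borel_measurable lborel" for m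
        unfolding simple_value_def by measurable
      have "(\<lambda>u. (\<lambda>(u, z). indicator {0..T} u * g u z) (u, \<zeta> \<omega>)) \<in> borel_measurable lborel"
        by (rule measurable_compose[OF _ g]) measurable
      then show "(\<lambda>u. indicator {0..T} u * g u (\<zeta> \<omega>)) \<in> borel_measurable lborel" by simp
      show "(\<integral>\<^sup>+u. ennreal ((indicator {0..T} u * simple_value (n (s m)) (r (s m)) (\<xi> (s m)) u \<omega>)\<^sup>2) \<partial>lborel) = ennreal (Q (s m) \<omega>)" for m
        unfolding Q_def using nn_integral_simple_value_square[where \<xi> = "\<xi> (s m)" and \<omega> = \<omega>, OF rn rmono, of "s m", symmetric]
        by (auto simp: indicator_def intro!: nn_integral_cong)
      show "0 \<le> Q (s m) \<omega>" for m unfolding Q_def using rmono by (intro sum_nonneg) auto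
      show "(\<integral>\<^sup>+u. ennreal ((indicator {0..T} u * g u (\<zeta> \<omega>))\<^sup>2) \<partial>lborel) = ennreal (V (\<zeta> \<omega>))"
        unfolding V(1)[symmetric] by (intro nn_integral_cong) (auto simp: indicator_def)
      show "0 \<le> V (\<zeta> \<omega>)" by fact
      show "(\<lambda>m. \<integral>\<^sup>+u. ennreal ((indicator {0..T} u * simple_value (n (s m)) (r (s m)) (\<xi> (s m)) u \<omega>
          - indicator {0..T} u * g u (\<zeta> \<omega>))\<^sup>2) \<partial>lborel) \<longlonglongrightarrow> 0"
        using e0 unfolding e_def
        by (rule Lim_transform_eventually) (auto intro!: always_eventually nn_integral_cong simp: indicator_def)
    qed
  qed
  have c0: "0 \<le> c" using norm_ge_zero bd by (rule order_trans)
  \<comment> \<open>Restricting to \<open>V z < C\<close> makes stopping at level C asymptotically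
    invisible while the exponentials stay bounded.\<close>
  have trunc: "(\<integral>\<omega>. \<phi> (\<zeta> \<omega>) * indicator {z. V z < C} (\<zeta> \<omega>) * iexp (a * I \<omega>) \<partial>M) =
     (\<integral>\<omega>. \<phi> (\<zeta> \<omega>) * indicator {z. V z < C} (\<zeta> \<omega>) * exp (of_real (- (a\<^sup>2 * V (\<zeta> \<omega>) / 2))) \<partial>M)" if C: "0 \<le> C" for C
  proof -
    \<comment> \<open>G depends on \<zeta> only and so is known at time 0. Its last factor cancels
      the limit of the compensators, which leaves \<open>iexp (a * I \<omega>)\<close> in the limit
      of N.\<close>
    define G where "G \<omega> = \<phi> (\<zeta> \<omega>) * indicator {z. V z < C} (\<zeta> \<omega>) * exp (of_real (- (a\<^sup>2 * V (\<zeta> \<omega>) / 2)))" for \<omega>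
    define \<xi>' where "\<xi>' m = stopped C (r m) (\<xi> m)" for m
    define X' where "X' m = simple_integral W (n m) (r m) (\<xi>' m)" for m
    define Q' where "Q' m \<omega> = (\<Sum>k<n m. (\<xi>' m k \<omega>)\<^sup>2 * (r m (Suc k) - r m k))" for m \<omega>
    have sp': "simple_process filtration T (n m) (r m) (\<xi>' m)" for m
      unfolding \<xi>'_def by (rule simple_process_stopped[OF sp])
    then have \<xi>'m: "\<xi>' m k \<in> borel_measurable M" if "k < n m" for k m
      using that by (auto simp: simple_process_def intro: filtration_measurable)
    have [measurable]: "X' m \<in> borel_measurable M" for m
      unfolding X'_def simple_integral_def
      by (intro borel_measurable_sum borel_measurable_times borel_measurable_diff \<xi>'m Wm) auto
    have [measurable]: "Q' m \<in> borel_measurable M" for m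
      unfolding Q'_def by (intro borel_measurable_sum borel_measurable_times borel_measurable_power \<xi>'m) auto
    have Q'C: "Q' m \<omega> \<le> C" for m \<omega>
      unfolding Q'_def \<xi>'_def by (intro stopped_quadratic_variation_le C rmono)
    have "(\<lambda>z. \<phi> z * indicator {z. V z < C} z * exp (of_real (- (a\<^sup>2 * V z / 2)))) \<in> borel_measurable borel" by measurable
    from measurable_compose[OF measurable_enlarged_filtration_parameter this]
    have Gm: "G \<in> borel_measurable (filtration 0)" unfolding G_def .
    have Gb: "norm (G \<omega>) \<le> c" for \<omega>
    proof -
      have "norm (G \<omega>) \<le> c * 1 * 1" unfolding G_def norm_mult
        by (intro mult_mono bd) (use c0 V(2) in \<open>auto simp: indicator_def norm_exp_eq_Re\<close>)
      then show ?thesis by simp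
    qed
    have [measurable]: "G \<in> borel_measurable M" by (rule filtration_measurable[OF Gm])
    define N where "N m \<omega> = G \<omega> * exp (\<i> * of_real (a * X' m \<omega>) + of_real (a\<^sup>2 * Q' m \<omega> / 2))" for m \<omega>
    have EN: "(\<integral>\<omega>. N m \<omega> \<partial>M) = (\<integral>\<omega>. G \<omega> \<partial>M)" for m
      using exponential_martingale[OF sp' Gm Gb, where a = a] by (simp add: N_def X'_def Q'_def)
    have "(\<lambda>m. \<integral>\<omega>. N (s m) \<omega> \<partial>M) \<longlonglongrightarrow> (\<integral>\<omega>. \<phi> (\<zeta> \<omega>) * indicator {z. V z < C} (\<zeta> \<omega>) * iexp (a * I \<omega>) \<partial>M)"
    proof (rule integral_dominated_convergence[where w = "\<lambda>_. c * exp (a\<^sup>2 * C / 2)"])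
      show "AE \<omega> in M. (\<lambda>m. N (s m) \<omega>) \<longlonglongrightarrow> \<phi> (\<zeta> \<omega>) * indicator {z. V z < C} (\<zeta> \<omega>) * iexp (a * I \<omega>)"
        using XI QV
      proof eventually_elim
        case (elim \<omega>)
        show ?case
        proof (cases "V (\<zeta> \<omega>) < C")
          case True
          \<comment> \<open>Strictness of V < C is used here: the quadratic variations eventually
            lie below C, and from then on the stopped and original processes agree at
            \<omega>.\<close>
          have "eventually (\<lambda>m. Q (s m) \<omega> < C) sequentially"
            by (rule order_tendstoD(2)[OF elim(2) True])
          then have ev: "eventually (\<lambda>m. G \<omega> * exp (\<i> * of_real (a * X (s m) \<omega>) + of_real (a\<^sup>2 * Q (s m) \<omega> / 2)) = N (s m) \<omega>) sequentially"
          proof eventually_elim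
            case (elim m)
            have "\<xi>' (s m) k \<omega> = \<xi> (s m) k \<omega>" if "k < n (s m)" for k
              unfolding \<xi>'_def by (rule stopped_eq[where n = "n (s m)"]) (use elim rmono that in \<open>auto simp: Q_def\<close>)
            then show ?case by (simp add: N_def X_def X'_def Q_def Q'_def simple_integral_def)
          qed
          have "(\<lambda>m. G \<omega> * exp (\<i> * of_real (a * X (s m) \<omega>) + of_real (a\<^sup>2 * Q (s m) \<omega> / 2)))
            \<longlonglongrightarrow> G \<omega> * exp (\<i> * of_real (a * I \<omega>) + of_real (a\<^sup>2 * V (\<zeta> \<omega>) / 2))"
            by (intro tendsto_intros elim) auto
          also have "G \<omega> * exp (\<i> * of_real (a * I \<omega>) + of_real (a\<^sup>2 * V (\<zeta> \<omega>) / 2)) =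
              \<phi> (\<zeta> \<omega>) * indicator {z. V z < C} (\<zeta> \<omega>) * iexp (a * I \<omega>)"
            using True by (simp add: G_def mult_exp_exp flip: exp_of_real)
          finally show ?thesis using ev by (rule Lim_transform_eventually)
        next
          case False
          then show ?thesis by (simp add: N_def G_def)
        qed
      qed
      show "AE \<omega> in M. norm (N (s m) \<omega>) \<le> c * exp (a\<^sup>2 * C / 2)" for m
      proof (rule AE_I2)
        fix \<omega>
        show "norm (N (s m) \<omega>) \<le> c * exp (a\<^sup>2 * C / 2)"
          unfolding N_def norm_mult
          by (intro mult_mono Gb) (use c0 Q'C[of "s m" \<omega>] in \<open>auto simp: mult_left_mono\<close>)
      qed
      show "N (s m) \<in> borel_measurable M" for m unfolding N_def by measurable
    qed (auto)
    then have "(\<integral>\<omega>. G \<omega> \<partial>M) = (\<integral>\<omega>. \<phi> (\<zeta> \<omega>) * indicator {z. V z < C} (\<zeta> \<omega>) * iexp (a * I \<omega>) \<partial>M)"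
      unfolding EN by (rule LIMSEQ_unique[OF tendsto_const])
    then show ?thesis by (simp add: G_def)
  qed
  \<comment> \<open>V is finite everywhere, so each indicator is eventually 1 and the truncation can
    be removed on both sides.\<close>
  have lim: "(\<lambda>C::nat. \<integral>\<omega>. \<phi> (\<zeta> \<omega>) * indicator {z. V z < real C} (\<zeta> \<omega>) * F \<omega> \<partial>M) \<longlonglongrightarrow> (\<integral>\<omega>. \<phi> (\<zeta> \<omega>) * F \<omega> \<partial>M)"
    if [measurable]: "F \<in> borel_measurable M" and F: "\<And>\<omega>. norm (F \<omega>) \<le> 1" for F :: "'a \<Rightarrow> complex"
  proof (rule integral_dominated_convergence[where w = "\<lambda>_. c"])
    show "AE \<omega> in M. (\<lambda>C. \<phi> (\<zeta> \<omega>) * indicator {z. V z < real C} (\<zeta> \<omega>) * F \<omega>) \<longlonglongrightarrow> \<phi> (\<zeta> \<omega>) * F \<omega>"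
    proof (rule AE_I2)
      fix \<omega>
      obtain k :: nat where k: "V (\<zeta> \<omega>) < real k" using reals_Archimedean2 by blast
      show "(\<lambda>C. \<phi> (\<zeta> \<omega>) * indicator {z. V z < real C} (\<zeta> \<omega>) * F \<omega>) \<longlonglongrightarrow> \<phi> (\<zeta> \<omega>) * F \<omega>"
        by (rule tendsto_eventually)
           (use k in \<open>auto intro!: eventually_sequentiallyI[of k]\<close>)
    qed
    show "AE \<omega> in M. norm (\<phi> (\<zeta> \<omega>) * indicator {z. V z < real C} (\<zeta> \<omega>) * F \<omega>) \<le> c" for C
    proof (rule AE_I2)
      fix \<omega>
      have "norm (\<phi> (\<zeta> \<omega>) * indicator {z. V z < real C} (\<zeta> \<omega>) * F \<omega>) \<le> c * 1 * 1"
        unfolding norm_mult by (intro mult_mono bd F) (use c0 in \<open>auto simp: indicator_def\<close>)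
      then show "norm (\<phi> (\<zeta> \<omega>) * indicator {z. V z < real C} (\<zeta> \<omega>) * F \<omega>) \<le> c" by simp
    qed
  qed auto
  have "(\<lambda>C::nat. \<integral>\<omega>. \<phi> (\<zeta> \<omega>) * indicator {z. V z < real C} (\<zeta> \<omega>) * iexp (a * I \<omega>) \<partial>M)
      \<longlonglongrightarrow> (\<integral>\<omega>. \<phi> (\<zeta> \<omega>) * exp (of_real (- (a\<^sup>2 * V (\<zeta> \<omega>) / 2))) \<partial>M)"
    unfolding trunc[OF of_nat_0_le_iff] by (rule lim) (use V(2) in \<open>auto simp: norm_exp_eq_Re\<close>)
  moreover have "(\<lambda>C::nat. \<integral>\<omega>. \<phi> (\<zeta> \<omega>) * indicator {z. V z < real C} (\<zeta> \<omega>) * iexp (a * I \<omega>) \<partial>M)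
      \<longlonglongrightarrow> (\<integral>\<omega>. \<phi> (\<zeta> \<omega>) * iexp (a * I \<omega>) \<partial>M)"
    by (rule lim) (auto)
  ultimately show ?thesis by (rule LIMSEQ_unique[rotated])
qed

end


section \<open>Laws of the components\<close>

definition drift_integral :: "(real \<Rightarrow> real \<Rightarrow> real) \<Rightarrow> real \<Rightarrow> real \<Rightarrow> real" where
  "drift_integral b t z = (LBINT u:{0..t}. b u z)"

definition variance_integral :: "(real \<Rightarrow> real \<Rightarrow> real) \<Rightarrow> real \<Rightarrow> real \<Rightarrow> real" where
  "variance_integral \<sigma> t z = (LBINT u:{0..t}. (\<sigma> u z)\<^sup>2)"

definition jump_sum :: "(real \<Rightarrow> 'a \<Rightarrow> nat) \<Rightarrow> (nat \<Rightarrow> 'a \<Rightarrow> real) \<Rightarrow> real \<Rightarrow> 'a \<Rightarrow> real" where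
  "jump_sum P \<eta> t \<omega> = (\<Sum>i=1..P t \<omega>. \<eta> i \<omega>)"

definition jump_events :: "'a measure \<Rightarrow> (real \<Rightarrow> 'a \<Rightarrow> nat) \<Rightarrow> (nat \<Rightarrow> 'a \<Rightarrow> real) \<Rightarrow> 'a set set" where
  "jump_events M P \<eta> = sigma_sets (space M)
     (process_events M {0..} (\<lambda>t \<omega>. real (P t \<omega>)) \<union> (\<Union>i\<in>{1..}. process_events M {i} \<eta>))"

definition diffusion_events :: "'a measure \<Rightarrow> (real \<Rightarrow> 'a \<Rightarrow> real) \<Rightarrow> ('a \<Rightarrow> real) \<Rightarrow> 'a set set" where
  "diffusion_events M W \<zeta> = sigma_sets (space M)
     (process_events M {0..} W \<union> sigma_sets (space M) {\<zeta> -` A \<inter> space M | A. A \<in> sets borel})"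

section \<open>Drift and variance as measurable functions of the parameter\<close>

text \<open>Joint measurability of a coefficient is given on nonnegative times only. Composing with
  \<open>max 0\<close> extends it to the whole plane and changes nothing on
  \<open>{0..t}\<close>.\<close>

lemma admissible_measurable_pair:
  assumes "admissible_coefficient p g"
  shows "(\<lambda>(u, z). g (max 0 u) z) \<in> borel_measurable (borel \<Otimes>\<^sub>M borel)"
proof -
  have g: "case_prod g \<in> borel_measurable (restrict_space borel {0..} \<Otimes>\<^sub>M borel)"
    using assms by (simp add: admissible_coefficient_def)
  have "(\<lambda>q :: real \<times> real. (max 0 (fst q), snd q)) \<in> borel \<Otimes>\<^sub>M borel \<rightarrow>\<^sub>M restrict_space borel {0..} \<Otimes>\<^sub>M borel"
    by (intro measurable_Pair measurable_restrict_space2 borel_measurable_max measurable_const)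
       (auto simp: le_max_iff_disj)
  from measurable_compose[OF this g] show ?thesis by (simp add: split_beta')
qed

lemma admissible_integral_measurable:
  assumes "admissible_coefficient p g"
  shows "(\<lambda>z. LBINT u:{0..t}. (g u z) ^ k) \<in> borel_measurable borel"
proof -
  note [measurable] = admissible_measurable_pair[OF assms]
  have "(\<lambda>z. \<integral>u. indicator {0..t} u * (g (max 0 u) z) ^ k \<partial>lborel) \<in> borel_measurable borel"
  proof (rule lborel.borel_measurable_lebesgue_integral)
    have "(\<lambda>q. (\<lambda>(u, z). g (max 0 u) z) (snd q, fst q)) \<in> borel_measurable (borel \<Otimes>\<^sub>M lborel)"
      by measurable
    then show "(\<lambda>(z, u). indicator {0..t} u * (g (max 0 u) z) ^ k) \<in> borel_measurable (borel \<Otimes>\<^sub>M lborel)"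
      by (simp add: split_beta')
  qed
  also have "(\<lambda>z. \<integral>u. indicator {0..t} u * (g (max 0 u) z) ^ k \<partial>lborel) = (\<lambda>z. LBINT u:{0..t}. (g u z) ^ k)"
    unfolding set_lebesgue_integral_def by (intro ext Bochner_Integration.integral_cong) (auto simp: indicator_def max_def)
  finally show ?thesis .
qed

lemma drift_integral_measurable: "admissible_coefficient 1 b \<Longrightarrow> drift_integral b t \<in> borel_measurable borel"
  using admissible_integral_measurable[of 1 b t 1] by (simp add: drift_integral_def[abs_def])

lemma variance_integral_measurable: "admissible_coefficient 2 \<sigma> \<Longrightarrow> variance_integral \<sigma> t \<in> borel_measurable borel"
  using admissible_integral_measurable[of 2 \<sigma> t 2] by (simp add: variance_integral_def[abs_def])

lemma variance_integral_nonneg: "0 \<le> variance_integral \<sigma> t z"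
  unfolding variance_integral_def set_lebesgue_integral_def by (rule integral_nonneg_AE) auto

lemma nn_integral_variance:
  assumes "admissible_coefficient 2 \<sigma>" "0 \<le> t"
  shows "(\<integral>\<^sup>+u\<in>{0..t}. ennreal ((\<sigma> u z)\<^sup>2) \<partial>lborel) = ennreal (variance_integral \<sigma> t z)"
proof -
  have "set_integrable lborel {0..t} (\<lambda>u. \<bar>\<sigma> u z\<bar> ^ 2)"
    using assms by (auto simp: admissible_coefficient_def)
  then have i: "integrable lborel (\<lambda>u. indicator {0..t} u * (\<sigma> u z)\<^sup>2)" by (simp add: set_integrable_def)
  have "(\<integral>\<^sup>+u\<in>{0..t}. ennreal ((\<sigma> u z)\<^sup>2) \<partial>lborel) = (\<integral>\<^sup>+u. ennreal (indicator {0..t} u * (\<sigma> u z)\<^sup>2) \<partial>lborel)"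
    by (intro nn_integral_cong) (auto simp: indicator_def)
  also have "\<dots> = ennreal (variance_integral \<sigma> t z)"
    unfolding variance_integral_def set_lebesgue_integral_def
    by (subst nn_integral_eq_integral[OF i]) auto
  finally show ?thesis .
qed

lemma emeasure_distr_nn_integral:
  assumes "f \<in> N \<rightarrow>\<^sub>M K" "A \<in> sets K"
  shows "emeasure (distr N K f) A = (\<integral>\<^sup>+x. indicator A (f x) \<partial>N)"
  using assms nn_integral_distr[of f N K "indicator A"] nn_integral_indicator[of A "distr N K f"] by simp

section \<open>Gaussian laws with jumps, and their mixtures\<close>

text \<open>The conditional law of a component given its parameter \<open>z\<close>, where \<open>L\<close> is the law of the jumps.\<close>

definition component_law :: "(real \<Rightarrow> real) \<Rightarrow> (real \<Rightarrow> real) \<Rightarrow> real measure \<Rightarrow> real \<Rightarrow> real measure" where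
  "component_law B V L z =
     distr (std_normal_distribution \<Otimes>\<^sub>M L) borel (\<lambda>(x, u). B z + sqrt (V z) * x + u)"

text \<open>Convolution of a Gaussian density with L, written as an average over the jump sum. It
  represents \<open>component_law\<close> when \<open>V z\<close> is positive.\<close>

definition component_density :: "(real \<Rightarrow> real) \<Rightarrow> (real \<Rightarrow> real) \<Rightarrow> real measure \<Rightarrow> real \<Rightarrow> real \<Rightarrow> real" where
  "component_density B V L z y = (\<integral>u. normal_density (B z + u) (sqrt (V z)) y \<partial>L)"

lemma normal_density_bound: "0 < s \<Longrightarrow> normal_density m s y \<le> 1 / (s * sqrt (2 * pi))"
  by (auto simp: normal_density_def real_sqrt_mult field_simps)

lemma normal_density_measurable_pair [measurable]:
  "(\<lambda>q. normal_density (f q) (g q) (h q)) \<in> borel_measurable N"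
  if [measurable]: "f \<in> borel_measurable N" "g \<in> borel_measurable N" "h \<in> borel_measurable N"
  unfolding normal_density_def by measurable

context
  fixes B V :: "real \<Rightarrow> real" and L :: "real measure"
  assumes B [measurable]: "B \<in> borel_measurable borel" and V [measurable]: "V \<in> borel_measurable borel"
    and L: "prob_space L" and sets_L [measurable_cong]: "sets L = sets borel"
begin

interpretation L: prob_space L by (rule L)

lemma integrable_normal_density_shift:
  assumes "0 < V z" shows "integrable L (\<lambda>u. normal_density (B z + u) (sqrt (V z)) y)"
  by (rule L.integrable_const_bound[where B = "1 / (sqrt (V z) * sqrt (2 * pi))"])
     (use assms normal_density_bound[of "sqrt (V z)"] in auto)

lemma component_density_nonneg: "0 \<le> component_density B V L z y"
  unfolding component_density_def by (rule integral_nonneg_AE) auto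

lemma component_density_bound:
  assumes "0 < V z" shows "component_density B V L z y \<le> 1 / (sqrt (V z) * sqrt (2 * pi))"
proof -
  have "component_density B V L z y \<le> (\<integral>u. 1 / (sqrt (V z) * sqrt (2 * pi)) \<partial>L)"
    unfolding component_density_def
    by (rule integral_mono[OF integrable_normal_density_shift[OF assms]])
       (use assms normal_density_bound[of "sqrt (V z)"] in auto)
  then show ?thesis by (simp add: L.prob_space)
qed

text \<open>For fixed positive variance all shifted Gaussian densities have the same maximum, so
  dominated convergence applies whatever the jump law is.\<close>

lemma isCont_component_density:
  assumes "0 < V z" shows "isCont (component_density B V L z) y"
  unfolding continuous_at_sequentially
proof safe
  fix X assume X: "X \<longlonglongrightarrow> y"
  have "isCont (\<lambda>y. normal_density (B z + u) (sqrt (V z)) y) y" for u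
    using assms unfolding normal_density_def by (intro continuous_intros) auto
  then have *: "(\<lambda>n. normal_density (B z + u) (sqrt (V z)) (X n)) \<longlonglongrightarrow> normal_density (B z + u) (sqrt (V z)) y" for u
    using X by (rule isCont_tendsto_compose)
  show "(component_density B V L z \<circ> X) \<longlonglongrightarrow> component_density B V L z y"
    unfolding comp_def component_density_def
    by (rule integral_dominated_convergence[where w = "\<lambda>_. 1 / (sqrt (V z) * sqrt (2 * pi))"])
       (use assms * normal_density_bound[of "sqrt (V z)"] in auto)
qed

lemma component_density_measurable:
  "(\<lambda>(z, y). component_density B V L z y) \<in> borel_measurable (borel \<Otimes>\<^sub>M borel)"
  unfolding component_density_def split_beta'
  by (rule L.borel_measurable_lebesgue_integral) measurable

lemma component_law_eq_density:
  assumes "0 < V z"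
  shows "component_law B V L z = density lborel (\<lambda>y. ennreal (component_density B V L z y))"
proof (rule measure_eqI)
  interpret N: prob_space std_normal_distribution using prob_space_normal_density[of 1 0] by simp
  interpret P: pair_sigma_finite std_normal_distribution L ..
  interpret LP: pair_sigma_finite lborel L ..
  fix A assume "A \<in> sets (component_law B V L z)"
  then have A [measurable]: "A \<in> sets borel" by (simp add: component_law_def)
  have shift: "(\<integral>\<^sup>+x. indicator A (B z + sqrt (V z) * x + u) \<partial>std_normal_distribution) =
      (\<integral>\<^sup>+y. ennreal (normal_density (B z + u) (sqrt (V z)) y) * indicator A y \<partial>lborel)" for u
  proof -
    have "distributed std_normal_distribution lborel (\<lambda>x. x) std_normal_density"
      by (auto simp: distributed_def distr_id2)
    from N.normal_density_affine[OF this, of "sqrt (V z)" "B z + u"] assms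
    have d: "distributed std_normal_distribution lborel (\<lambda>x. B z + u + sqrt (V z) * x) (normal_density (B z + u) (sqrt (V z)))"
      by simp
    from distributed_nn_integral[OF this, of "indicator A"]
    show ?thesis by (simp add: add_ac)
  qed
  have "emeasure (component_law B V L z) A = (\<integral>\<^sup>+p. indicator A (B z + sqrt (V z) * fst p + snd p) \<partial>(std_normal_distribution \<Otimes>\<^sub>M L))"
    unfolding component_law_def split_beta' by (rule emeasure_distr_nn_integral) simp_all
  also have "\<dots> = (\<integral>\<^sup>+u. \<integral>\<^sup>+x. indicator A (B z + sqrt (V z) * x + u) \<partial>std_normal_distribution \<partial>L)"
    by (subst P.nn_integral_snd[symmetric]) (auto)
  also have "\<dots> = (\<integral>\<^sup>+u. \<integral>\<^sup>+y. ennreal (normal_density (B z + u) (sqrt (V z)) y) * indicator A y \<partial>lborel \<partial>L)"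
    unfolding shift ..
  also have "\<dots> = (\<integral>\<^sup>+y. \<integral>\<^sup>+u. ennreal (normal_density (B z + u) (sqrt (V z)) y) * indicator A y \<partial>L \<partial>lborel)"
    by (rule LP.Fubini') simp
  also have "\<dots> = (\<integral>\<^sup>+y. ennreal (component_density B V L z y) * indicator A y \<partial>lborel)"
    by (simp add: nn_integral_multc component_density_def nn_integral_eq_integral[OF integrable_normal_density_shift[OF assms]])
  also have "\<dots> = emeasure (density lborel (\<lambda>y. ennreal (component_density B V L z y))) A"
  proof (rule emeasure_density[symmetric])
    have "(\<lambda>y. (\<lambda>(z, y). component_density B V L z y) (z, y)) \<in> borel_measurable borel"
      by (rule measurable_compose[OF _ component_density_measurable]) simp
    then show "(\<lambda>y. ennreal (component_density B V L z y)) \<in> borel_measurable lborel" by simp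
  qed simp
  finally show "emeasure (component_law B V L z) A = emeasure (density lborel (\<lambda>y. ennreal (component_density B V L z y))) A" .
qed (simp add: component_law_def)

text \<open>Without a Gaussian part the law is L translated by \<open>B z\<close>, so an atom of L
  at 0 survives. This is what excludes zero variance for a law with a density.\<close>

lemma component_law_atom:
  assumes "V z = 0" shows "emeasure (component_law B V L z) {B z} = emeasure L {0}"
proof -
  interpret N: prob_space std_normal_distribution using prob_space_normal_density[of 1 0] by simp
  interpret P: pair_sigma_finite std_normal_distribution L ..
  have "emeasure (component_law B V L z) {B z} = emeasure (std_normal_distribution \<Otimes>\<^sub>M L) (space std_normal_distribution \<times> {0})"
    unfolding component_law_def split_beta' using assms
    by (subst emeasure_distr) (auto simp: space_pair_measure sets_eq_imp_space_eq[OF sets_L] intro!: arg_cong2[where f = emeasure])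
  also have "\<dots> = emeasure L {0}"
    using N.emeasure_space_1 by (subst L.emeasure_pair_measure_Times) auto
  finally show ?thesis .
qed

text \<open>Law of B(\<zeta>) + sqrt(V(\<zeta>)) N + J with \<zeta>, N, J independent. As the image
  of a product it is evidently a measure, and Fubini gives both its values on sets and its
  characteristic function.\<close>

definition mixture :: "real measure \<Rightarrow> real measure" where
  "mixture \<nu> = distr (\<nu> \<Otimes>\<^sub>M (std_normal_distribution \<Otimes>\<^sub>M L)) borel (\<lambda>(z, x, u). B z + sqrt (V z) * x + u)"

lemma emeasure_mixture:
  assumes "prob_space \<nu>" and \<nu> [measurable_cong]: "sets \<nu> = sets borel" and A [measurable]: "A \<in> sets borel"
  shows "emeasure (mixture \<nu>) A = (\<integral>\<^sup>+z. emeasure (component_law B V L z) A \<partial>\<nu>)"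
proof -
  interpret N: prob_space std_normal_distribution using prob_space_normal_density[of 1 0] by simp
  interpret NL: pair_prob_space std_normal_distribution L ..
  interpret \<nu>: prob_space \<nu> by fact
  interpret P: pair_sigma_finite \<nu> "std_normal_distribution \<Otimes>\<^sub>M L" ..
  have "emeasure (mixture \<nu>) A = (\<integral>\<^sup>+p. indicator A (B (fst p) + sqrt (V (fst p)) * fst (snd p) + snd (snd p)) \<partial>(\<nu> \<Otimes>\<^sub>M (std_normal_distribution \<Otimes>\<^sub>M L)))"
    unfolding mixture_def split_beta' by (rule emeasure_distr_nn_integral) simp_all
  also have "\<dots> = (\<integral>\<^sup>+z. \<integral>\<^sup>+q. indicator A (B z + sqrt (V z) * fst q + snd q) \<partial>(std_normal_distribution \<Otimes>\<^sub>M L) \<partial>\<nu>)"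
    by (subst NL.nn_integral_fst[symmetric]) auto
  also have "\<dots> = (\<integral>\<^sup>+z. emeasure (component_law B V L z) A \<partial>\<nu>)"
    unfolding component_law_def split_beta'
    by (intro nn_integral_cong emeasure_distr_nn_integral[symmetric]) simp_all
  finally show ?thesis .
qed

lemma real_distribution_mixture:
  assumes "prob_space \<nu>" and \<nu> [measurable_cong]: "sets \<nu> = sets borel"
  shows "real_distribution (mixture \<nu>)"
proof -
  interpret N: prob_space std_normal_distribution using prob_space_normal_density[of 1 0] by simp
  interpret NL: pair_prob_space std_normal_distribution L ..
  interpret \<nu>: prob_space \<nu> by fact
  interpret P: pair_prob_space \<nu> "std_normal_distribution \<Otimes>\<^sub>M L" ..
  have "prob_space (mixture \<nu>)"
    unfolding mixture_def split_beta' by (rule P.prob_space_distr) simp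
  then show ?thesis
    by (auto simp: real_distribution_def real_distribution_axioms_def mixture_def)
qed

text \<open>The standard normal coordinate contributes exp(-a^2 V z / 2), the same factor that the
  Ito integral yields given its parameter; this is the formula to be matched by Levy
  uniqueness.\<close>

lemma char_mixture:
  assumes "prob_space \<nu>" and \<nu> [measurable_cong]: "sets \<nu> = sets borel" and V0: "\<And>z. 0 \<le> V z"
  shows "char (mixture \<nu>) a = (\<integral>z. iexp (a * B z) * exp (of_real (- (a\<^sup>2 * V z / 2))) \<partial>\<nu>) * char L a"
proof -
  interpret N: prob_space std_normal_distribution using prob_space_normal_density[of 1 0] by simp
  interpret NL: pair_prob_space std_normal_distribution L ..
  interpret \<nu>: prob_space \<nu> by fact
  interpret P: pair_prob_space \<nu> "std_normal_distribution \<Otimes>\<^sub>M L" ..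
  let ?Q = "std_normal_distribution \<Otimes>\<^sub>M L"
  have "char (mixture \<nu>) a = (\<integral>p. iexp (a * (B (fst p) + sqrt (V (fst p)) * fst (snd p) + snd (snd p))) \<partial>(\<nu> \<Otimes>\<^sub>M ?Q))"
    unfolding char_def mixture_def split_beta' by (subst integral_distr) simp_all
  also have "\<dots> = (\<integral>z. \<integral>q. iexp (a * (B z + sqrt (V z) * fst q + snd q)) \<partial>?Q \<partial>\<nu>)"
    by (subst P.integral_fst'[symmetric])
       (auto intro!: P.integrable_const_bound[where B = 1])
  also have "\<dots> = (\<integral>z. (iexp (a * B z) * exp (of_real (- (a\<^sup>2 * V z / 2)))) * char L a \<partial>\<nu>)"
  proof (rule Bochner_Integration.integral_cong[OF refl])
    fix z
    have "(\<integral>q. iexp (a * (B z + sqrt (V z) * fst q + snd q)) \<partial>?Q) =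
        (\<integral>x. \<integral>u. iexp (a * (B z + sqrt (V z) * x + u)) \<partial>L \<partial>std_normal_distribution)"
      by (subst NL.integral_fst'[symmetric])
         (auto intro!: NL.integrable_const_bound[where B = 1])
    also have "\<dots> = (\<integral>x. \<integral>u. (iexp (a * B z) * iexp ((a * sqrt (V z)) * x)) * iexp (a * u) \<partial>L \<partial>std_normal_distribution)"
      by (simp add: distrib_left exp_add mult_ac)
    also have "\<dots> = (\<integral>x. iexp (a * B z) * iexp ((a * sqrt (V z)) * x) \<partial>std_normal_distribution) * char L a"
      by (simp only: integral_mult_right_zero integral_mult_left_zero char_def)
    also have "(\<integral>x. iexp (a * B z) * iexp ((a * sqrt (V z)) * x) \<partial>std_normal_distribution) =
        iexp (a * B z) * char std_normal_distribution (a * sqrt (V z))"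
      by (simp only: integral_mult_right_zero char_def)
    also have "char std_normal_distribution (a * sqrt (V z)) = exp (of_real (- (a\<^sup>2 * V z / 2)))"
    proof -
      have "(a * sqrt (V z))\<^sup>2 = a\<^sup>2 * V z" using V0[of z] by (simp add: power_mult_distrib)
      then show ?thesis unfolding char_std_normal_distribution by (simp flip: exp_of_real)
    qed
    finally show "(\<integral>q. iexp (a * (B z + sqrt (V z) * fst q + snd q)) \<partial>?Q) =
        (iexp (a * B z) * exp (of_real (- (a\<^sup>2 * V z / 2)))) * char L a" .
  qed
  also have "\<dots> = (\<integral>z. iexp (a * B z) * exp (of_real (- (a\<^sup>2 * V z / 2))) \<partial>\<nu>) * char L a"
    by (rule integral_mult_left_zero)
  finally show ?thesis .
qed

lemma emeasure_component_law_measurable: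
  assumes A [measurable]: "A \<in> sets borel"
  shows "(\<lambda>z. emeasure (component_law B V L z) A) \<in> borel_measurable borel"
proof -
  interpret N: prob_space std_normal_distribution using prob_space_normal_density[of 1 0] by simp
  interpret NL: pair_prob_space std_normal_distribution L ..
  have "(\<lambda>z. \<integral>\<^sup>+q. indicator A (B z + sqrt (V z) * fst q + snd q) \<partial>(std_normal_distribution \<Otimes>\<^sub>M L)) \<in> borel_measurable borel"
    by (rule NL.borel_measurable_nn_integral) (simp add: split_beta')
  also have "(\<lambda>z. \<integral>\<^sup>+q. indicator A (B z + sqrt (V z) * fst q + snd q) \<partial>(std_normal_distribution \<Otimes>\<^sub>M L))
      = (\<lambda>z. emeasure (component_law B V L z) A)"
    unfolding component_law_def split_beta'
    by (intro ext emeasure_distr_nn_integral[symmetric]) simp_all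
  finally show ?thesis .
qed

text \<open>A constant parameter has a Dirac law, so the law of a conditional component becomes a
  special case of the randomised one.\<close>

lemma mixture_return: "mixture (return borel z) = component_law B V L z"
proof (rule measure_eqI)
  fix A assume "A \<in> sets (mixture (return borel z))"
  then have A: "A \<in> sets borel" by (simp add: mixture_def)
  have "emeasure (mixture (return borel z)) A = (\<integral>\<^sup>+z. emeasure (component_law B V L z) A \<partial>return borel z)"
    by (rule emeasure_mixture[OF _ _ A]) (auto intro: prob_space_return)
  also have "\<dots> = emeasure (component_law B V L z) A"
    using emeasure_component_law_measurable[OF A] by (subst nn_integral_return) auto
  finally show "emeasure (mixture (return borel z)) A = emeasure (component_law B V L z) A" .
qed (simp add: mixture_def component_law_def)

end


section \<open>Law of a single component\<close>

locale component = brownian_with_parameter +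
  fixes P :: "real \<Rightarrow> 'a \<Rightarrow> nat" and \<eta> :: "nat \<Rightarrow> 'a \<Rightarrow> real" and lam :: real
    and b \<sigma> :: "real \<Rightarrow> real \<Rightarrow> real" and Y :: "real \<Rightarrow> 'a \<Rightarrow> real"
  assumes poisson: "poisson_process M lam P"
    and jumps_measurable: "\<And>i. 1 \<le> i \<Longrightarrow> \<eta> i \<in> borel_measurable M"
    and jump_indep: "indep_set (diffusion_events M W \<zeta>) (jump_events M P \<eta>)"
    and drift: "admissible_coefficient 1 b" and volatility: "admissible_coefficient 2 \<sigma>"
    and component: "component_process M b \<sigma> W P \<eta> \<zeta> Y"
begin

abbreviation jump_law :: "real \<Rightarrow> real measure" where
  "jump_law t \<equiv> distr M borel (jump_sum P \<eta> t)"

definition jump_algebra :: "'a measure" where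
  "jump_algebra = sigma (space M) (jump_events M P \<eta>)"

definition diffusion_algebra :: "'a measure" where
  "diffusion_algebra = sigma (space M) (diffusion_events M W \<zeta>)"

lemma jump_algebra_simps: "space jump_algebra = space M" "sets jump_algebra = jump_events M P \<eta>"
  and diffusion_algebra_simps: "space diffusion_algebra = space M" "sets diffusion_algebra = diffusion_events M W \<zeta>"
proof -
  have "jump_events M P \<eta> \<subseteq> events" "diffusion_events M W \<zeta> \<subseteq> events"
    using indep_setD_ev1[OF jump_indep] indep_setD_ev2[OF jump_indep] by auto
  then have *: "jump_events M P \<eta> \<subseteq> Pow (space M)" "diffusion_events M W \<zeta> \<subseteq> Pow (space M)"
    using sets.space_closed by blast+
  then show "space jump_algebra = space M" "space diffusion_algebra = space M"
    by (simp_all add: jump_algebra_def diffusion_algebra_def space_measure_of)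
  have 1: "sets (sigma (space M) (sigma_sets (space M) X)) = sigma_sets (space M) X"
    if "sigma_sets (space M) X \<subseteq> Pow (space M)" for X
  proof -
    have "X \<subseteq> Pow (space M)" using that sigma_sets_superset_generator[of X "space M"] by blast
    then show ?thesis using that by (simp only: sets_measure_of sigma_sets_sigma_sets_eq)
  qed
  show "sets jump_algebra = jump_events M P \<eta>"
    using *(1) unfolding jump_algebra_def jump_events_def by (rule 1)
  show "sets diffusion_algebra = diffusion_events M W \<zeta>"
    using *(2) unfolding diffusion_algebra_def diffusion_events_def by (rule 1)
qed

lemma jump_sum_measurable_algebra:
  assumes "0 \<le> t" shows "jump_sum P \<eta> t \<in> borel_measurable jump_algebra"
proof -
  have P: "(\<lambda>\<omega>. real (P t \<omega>)) \<in> borel_measurable jump_algebra"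
  proof (rule measurableI)
    fix A :: "real set" assume "A \<in> sets borel"
    then have "(\<lambda>\<omega>. real (P t \<omega>)) -` A \<inter> space M \<in> process_events M {0..} (\<lambda>t \<omega>. real (P t \<omega>))"
      unfolding process_events_def using assms by (intro sigma_sets.Basic) auto
    then show "(\<lambda>\<omega>. real (P t \<omega>)) -` A \<inter> space jump_algebra \<in> sets jump_algebra"
      unfolding jump_algebra_simps jump_events_def by (intro sigma_sets.Basic) blast
  qed simp
  have \<eta>: "\<eta> i \<in> borel_measurable jump_algebra" if "1 \<le> i" for i
  proof (rule measurableI)
    fix A :: "real set" assume "A \<in> sets borel"
    then have "\<eta> i -` A \<inter> space M \<in> process_events M {i} \<eta>"
      unfolding process_events_def by (intro sigma_sets.Basic) auto
    then show "\<eta> i -` A \<inter> space jump_algebra \<in> sets jump_algebra"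
      unfolding jump_algebra_simps jump_events_def using that by (intro sigma_sets.Basic) blast
  qed simp
  have "P t \<in> jump_algebra \<rightarrow>\<^sub>M count_space UNIV"
  proof -
    \<comment> \<open>The event algebra records the counting process as a real-valued one; the floor
      recovers the natural number, and the random number of summands is then treated by countably
      many cases.\<close>
    have "(\<lambda>\<omega>. nat \<lfloor>real (P t \<omega>)\<rfloor>) \<in> jump_algebra \<rightarrow>\<^sub>M count_space UNIV" using P by measurable
    then show ?thesis by simp
  qed
  then have "(\<lambda>\<omega>. (\<lambda>n \<omega>. \<Sum>i=1..n. \<eta> i \<omega>) (P t \<omega>) \<omega>) \<in> borel_measurable jump_algebra"
    by (rule measurable_compose_countable[rotated]) (auto intro!: borel_measurable_sum \<eta>)
  then show ?thesis by (simp add: jump_sum_def[abs_def])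
qed

lemma jump_algebra_subset: "sets jump_algebra \<subseteq> events"
  and diffusion_algebra_subset: "sets diffusion_algebra \<subseteq> events"
  using indep_setD_ev1[OF jump_indep] indep_setD_ev2[OF jump_indep]
  by (auto simp: jump_algebra_simps diffusion_algebra_simps)

lemma jump_sum_measurable: "0 \<le> t \<Longrightarrow> jump_sum P \<eta> t \<in> borel_measurable M"
  by (rule measurable_sub_algebra[OF jump_sum_measurable_algebra _ jump_algebra_subset])
     (simp_all add: jump_algebra_simps)

lemma prob_space_jump_law: "0 \<le> t \<Longrightarrow> prob_space (jump_law t)"
  by (rule prob_space_distr[OF jump_sum_measurable])

lemma parameter_diffusion_measurable: "\<zeta> \<in> borel_measurable diffusion_algebra"
proof (rule measurableI)
  fix A :: "real set" assume "A \<in> sets borel"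
  then have "\<zeta> -` A \<inter> space M \<in> sigma_sets (space M) {\<zeta> -` A \<inter> space M | A. A \<in> sets borel}" by blast
  then show "\<zeta> -` A \<inter> space diffusion_algebra \<in> sets diffusion_algebra"
    unfolding diffusion_algebra_simps diffusion_events_def by (intro sigma_sets.Basic) blast
qed simp

lemma filtration_subset_diffusion: "sets (filtration t) \<subseteq> sets diffusion_algebra"
proof (rule enlarged_filtration_subset)
  fix s :: real assume "0 \<le> s"
  show "W s \<in> borel_measurable diffusion_algebra"
  proof (rule measurableI)
    fix A :: "real set" assume "A \<in> sets borel"
    then have "W s -` A \<inter> space M \<in> process_events M {0..} W"
      unfolding process_events_def using \<open>0 \<le> s\<close> by (intro sigma_sets.Basic) auto
    then show "W s -` A \<inter> space diffusion_algebra \<in> sets diffusion_algebra"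
      unfolding diffusion_algebra_simps diffusion_events_def by (intro sigma_sets.Basic) blast
  qed simp
qed (simp_all add: diffusion_algebra_simps parameter_diffusion_measurable)

text \<open>Both forms of the integral are kept: I is the one whose characteristic function is
  known, and I' the one that is independent of the jumps.\<close>

lemma component_decomposition:
  assumes t: "0 \<le> t"
  obtains I I' where "is_ito_integral M filtration W (\<lambda>u \<omega>. \<sigma> u (\<zeta> \<omega>)) t I"
    "I' \<in> borel_measurable diffusion_algebra" "AE \<omega> in M. I \<omega> = I' \<omega>"
    "AE \<omega> in M. Y t \<omega> = drift_integral b t (\<zeta> \<omega>) + I' \<omega> + jump_sum P \<eta> t \<omega>"
proof -
  obtain I where I: "is_ito_integral M filtration W (\<lambda>u \<omega>. \<sigma> u (\<zeta> \<omega>)) t I"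
    and Y: "AE \<omega> in M. Y t \<omega> = (LBINT u:{0..t}. b u (\<zeta> \<omega>)) + I \<omega> + (\<Sum>i=1..P t \<omega>. \<eta> i \<omega>)"
    using component t unfolding component_process_def by blast
  obtain I' where I': "I' \<in> borel_measurable (filtration t)" "AE \<omega> in M. I \<omega> = I' \<omega>"
    by (rule ito_integral_version[OF I])
  show ?thesis
  proof (rule that[OF I _ I'(2)])
    show "I' \<in> borel_measurable diffusion_algebra"
      by (rule measurable_sub_algebra[OF I'(1) _ filtration_subset_diffusion]) (simp add: diffusion_algebra_simps)
    show "AE \<omega> in M. Y t \<omega> = drift_integral b t (\<zeta> \<omega>) + I' \<omega> + jump_sum P \<eta> t \<omega>"
      using Y I'(2) by eventually_elim (simp add: drift_integral_def jump_sum_def)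
  qed
qed

text \<open>Used with the algebra generated by all sources of one component, so that independence of
  disjoint groups of sources carries over to the components.\<close>

lemma component_version:
  assumes t: "0 \<le> t" and N: "space N = space M" "diffusion_events M W \<zeta> \<subseteq> sets N" "jump_events M P \<eta> \<subseteq> sets N"
  obtains Y' where "Y' \<in> borel_measurable N" "AE \<omega> in M. Y t \<omega> = Y' \<omega>"
proof -
  obtain I I' where I': "I' \<in> borel_measurable diffusion_algebra"
    "AE \<omega> in M. Y t \<omega> = drift_integral b t (\<zeta> \<omega>) + I' \<omega> + jump_sum P \<eta> t \<omega>"
    by (rule component_decomposition[OF t])
  have dN: "f \<in> borel_measurable diffusion_algebra \<Longrightarrow> f \<in> borel_measurable N"
    and jN: "f \<in> borel_measurable jump_algebra \<Longrightarrow> f \<in> borel_measurable N" for f :: "'a \<Rightarrow> real"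
    using N by (auto elim!: measurable_sub_algebra simp: diffusion_algebra_simps jump_algebra_simps)
  note [measurable] = dN[OF I'(1)] jN[OF jump_sum_measurable_algebra[OF t]]
    dN[OF parameter_diffusion_measurable] drift_integral_measurable[OF drift]
  show ?thesis by (rule that[OF _ I'(2)]) measurable
qed

text \<open>The characteristic function splits into a diffusion factor and a jump factor by
  independence, and the diffusion factor is evaluated by the tested identity for the Ito
  integral.\<close>

lemma component_distr:
  assumes t: "0 \<le> t"
  shows "distr M borel (Y t) = mixture (drift_integral b t) (variance_integral \<sigma> t) (jump_law t) (distr M borel \<zeta>)"
proof -
  let ?B = "drift_integral b t" and ?V = "variance_integral \<sigma> t"
  note Bm [measurable] = drift_integral_measurable[OF drift, of t]
    and Vm [measurable] = variance_integral_measurable[OF volatility, of t]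
  note Jm [measurable] = jump_sum_measurable[OF t]
  have Ym [measurable]: "Y t \<in> borel_measurable M"
    using component t by (simp add: component_process_def)
  obtain I I' where I: "is_ito_integral M filtration W (\<lambda>u \<omega>. \<sigma> u (\<zeta> \<omega>)) t I"
    and I'd: "I' \<in> borel_measurable diffusion_algebra" and II': "AE \<omega> in M. I \<omega> = I' \<omega>"
    and Y: "AE \<omega> in M. Y t \<omega> = ?B (\<zeta> \<omega>) + I' \<omega> + jump_sum P \<eta> t \<omega>"
    by (rule component_decomposition[OF t])
  have [measurable]: "I \<in> borel_measurable M" using I by (simp add: is_ito_integral_def)
  have I'm [measurable]: "I' \<in> borel_measurable M"
    by (rule measurable_sub_algebra[OF I'd _ diffusion_algebra_subset]) (simp_all add: diffusion_algebra_simps)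
  interpret Z: prob_space "distr M borel \<zeta>" by (rule prob_space_distr) simp
  interpret J: prob_space "jump_law t" by (rule prob_space_jump_law[OF t])
  interpret YL: prob_space "distr M borel (Y t)" by (rule prob_space_distr) simp
  show ?thesis
  proof (rule Levy_uniqueness)
    show "real_distribution (distr M borel (Y t))"
      by (auto simp: real_distribution_def real_distribution_axioms_def YL.prob_space_axioms)
    show "real_distribution (mixture ?B ?V (jump_law t) (distr M borel \<zeta>))"
      by (rule real_distribution_mixture[OF Bm Vm prob_space_jump_law[OF t] sets_distr Z.prob_space_axioms sets_distr])
    show "char (distr M borel (Y t)) = char (mixture ?B ?V (jump_law t) (distr M borel \<zeta>))"
    proof
      fix a
      \<comment> \<open>The version I' makes X1 measurable in the diffusion algebra; once the
        product has been split, I' is exchanged for I again.\<close>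
      define X1 where "X1 \<omega> = iexp (a * ?B (\<zeta> \<omega>)) * iexp (a * I' \<omega>)" for \<omega>
      define X2 where "X2 \<omega> = iexp (a * jump_sum P \<eta> t \<omega>)" for \<omega>
      have X1d: "X1 \<in> borel_measurable diffusion_algebra"
        unfolding X1_def using I'd parameter_diffusion_measurable by measurable
      have X2d: "X2 \<in> borel_measurable jump_algebra"
        unfolding X2_def using jump_sum_measurable_algebra[OF t] by measurable
      have [measurable]: "X1 \<in> borel_measurable M" "X2 \<in> borel_measurable M"
        unfolding X1_def X2_def by measurable
      have "indep_var borel X1 borel X2"
        unfolding indep_var_distribution_eq
        using measurable_sets[OF X1d] measurable_sets[OF X2d]
        by (auto intro!: distr_pair_indep_set[OF jump_indep] simp: diffusion_algebra_simps jump_algebra_simps)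
      moreover have "integrable M X1" "integrable M X2"
        by (rule integrable_const_bound[where B = 1]; simp add: X1_def X2_def norm_mult)+
      ultimately have prod: "(\<integral>\<omega>. X1 \<omega> * X2 \<omega> \<partial>M) = (\<integral>\<omega>. X1 \<omega> \<partial>M) * (\<integral>\<omega>. X2 \<omega> \<partial>M)"
        by (rule indep_var_lebesgue_integral)
      have "char (distr M borel (Y t)) a = (\<integral>\<omega>. iexp (a * Y t \<omega>) \<partial>M)"
        unfolding char_def by (subst integral_distr) auto
      also have "\<dots> = (\<integral>\<omega>. X1 \<omega> * X2 \<omega> \<partial>M)"
      proof (rule integral_cong_AE)
        show "AE \<omega> in M. iexp (a * Y t \<omega>) = X1 \<omega> * X2 \<omega>"
          using Y by eventually_elim (simp add: X1_def X2_def exp_add[symmetric] algebra_simps)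
      qed simp_all
      also have "\<dots> = (\<integral>\<omega>. X1 \<omega> \<partial>M) * char (jump_law t) a"
        unfolding prod by (simp add: X2_def[abs_def] char_def integral_distr)
      also have "(\<integral>\<omega>. X1 \<omega> \<partial>M) = (\<integral>\<omega>. iexp (a * ?B (\<zeta> \<omega>)) * iexp (a * I \<omega>) \<partial>M)"
      proof (rule integral_cong_AE)
        show "AE \<omega> in M. X1 \<omega> = iexp (a * ?B (\<zeta> \<omega>)) * iexp (a * I \<omega>)"
          using II' by eventually_elim (simp add: X1_def)
      qed simp_all
      also have "\<dots> = (\<integral>\<omega>. iexp (a * ?B (\<zeta> \<omega>)) * exp (of_real (- (a\<^sup>2 * ?V (\<zeta> \<omega>) / 2))) \<partial>M)"
      \<comment> \<open>The drift depends on \<zeta> only, so its exponential serves as the bounded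
        test function.\<close>
      proof (rule ito_integral_conditional_char[OF I, where \<phi> = "\<lambda>z. iexp (a * ?B z)" and c = 1])
        note [measurable] = admissible_measurable_pair[OF volatility]
        have "(\<lambda>(u, z). indicator {0..t} u * \<sigma> (max 0 u) z) \<in> borel_measurable (borel \<Otimes>\<^sub>M borel)"
          by measurable
        also have "(\<lambda>(u, z). indicator {0..t} u * \<sigma> (max 0 u) z) = (\<lambda>(u, z). indicator {0..t} u * \<sigma> u z)"
          by (auto simp: fun_eq_iff indicator_def max_def)
        finally show "(\<lambda>(u, z). indicator {0..t} u * \<sigma> u z) \<in> borel_measurable (borel \<Otimes>\<^sub>M borel)" .
        show "(\<integral>\<^sup>+u\<in>{0..t}. ennreal ((\<sigma> u z)\<^sup>2) \<partial>lborel) = ennreal (?V z)" for z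
          by (rule nn_integral_variance[OF volatility t])
      qed (auto simp: variance_integral_nonneg)
      also have "\<dots> = (\<integral>z. iexp (a * ?B z) * exp (of_real (- (a\<^sup>2 * ?V z / 2))) \<partial>distr M borel \<zeta>)"
        by (subst integral_distr) auto
      finally show "char (distr M borel (Y t)) a = char (mixture ?B ?V (jump_law t) (distr M borel \<zeta>)) a"
        using char_mixture[OF Bm Vm prob_space_jump_law[OF t] sets_distr Z.prob_space_axioms sets_distr variance_integral_nonneg, of a]
        by simp
    qed
  qed
qed

lemma jump_law_atom:
  assumes t: "0 < t" shows "0 < emeasure (jump_law t) {0}"
proof -
  note [measurable] = jump_sum_measurable[OF less_imp_le[OF t]]
  have [measurable]: "P t \<in> M \<rightarrow>\<^sub>M count_space UNIV" "P 0 \<in> M \<rightarrow>\<^sub>M count_space UNIV"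
    using poisson t by (auto simp: poisson_process_def)
  have P0: "AE \<omega> in M. P 0 \<omega> = 0" using poisson by (simp add: poisson_process_def)
  \<comment> \<open>The Poisson probability with k = 0 equals exp(-lam t), which is positive; an
    empty jump sum is 0.\<close>
  have "0 \<le> (0::real) \<and> 0 < t \<longrightarrow> prob {\<omega> \<in> space M. P t \<omega> = P 0 \<omega> + 0} = (lam * (t - 0)) ^ 0 / fact 0 * exp (- (lam * (t - 0)))"
    using poisson unfolding poisson_process_def by blast
  then have "0 < prob {\<omega> \<in> space M. P t \<omega> = P 0 \<omega> + 0}" using t by simp
  also have "\<dots> \<le> prob {\<omega> \<in> space M. jump_sum P \<eta> t \<omega> = 0}"
  proof (rule finite_measure_mono_AE)
    show "AE \<omega> in M. \<omega> \<in> {\<omega> \<in> space M. P t \<omega> = P 0 \<omega> + 0} \<longrightarrow> \<omega> \<in> {\<omega> \<in> space M. jump_sum P \<eta> t \<omega> = 0}"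
      using P0 by eventually_elim (auto simp: jump_sum_def)
  qed measurable
  also have "\<dots> = measure (jump_law t) {0}"
    by (subst measure_distr) (auto intro!: arg_cong[where f = prob])
  finally show ?thesis
    by (simp add: measure_def enn2real_positive_iff)
qed

end


section \<open>Densities and convolution\<close>

lemma pdf_cong_distr: "distr \<Omega> borel X = distr \<Omega> borel X' \<Longrightarrow> pdf \<Omega> X = pdf \<Omega> X'"
  by (simp add: pdf_def fun_eq_iff)

lemma (in prob_space) distr_cong_AE_borel:
  fixes X X' :: "'a \<Rightarrow> real"
  assumes [measurable]: "X \<in> borel_measurable M" "X' \<in> borel_measurable M" and ae: "AE \<omega> in M. X \<omega> = X' \<omega>"
  shows "distr M borel X = distr M borel X'"
  by (rule distr_cong_AE) (use ae in auto)

text \<open>Fundamental theorem of calculus: locally the distribution function is a constant plus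
  the integral of f, and continuity of f makes it differentiable at every point.\<close>

lemma (in prob_space) pdf_eq_continuous_density:
  assumes X: "distributed M lborel X (\<lambda>x. ennreal (f x))" and f: "\<And>x. 0 \<le> f x" "continuous_on UNIV f"
  shows "pdf M X x = f x"
proof -
  have [measurable]: "X \<in> borel_measurable M" using distributed_measurable[OF X] by simp
  have [measurable]: "f \<in> borel_measurable borel" using f(2) by (rule borel_measurable_continuous_onI)
  let ?D = "distr M borel X"
  have D: "?D = density lborel (\<lambda>x. ennreal (f x))"
    using distributed_distr_eq_density[OF X] by (simp cong: distr_cong)
  interpret D: prob_space ?D by (rule prob_space_distr) simp
  interpret D: real_distribution ?D
    by (auto simp: real_distribution_def real_distribution_axioms_def D.prob_space_axioms)
  \<comment> \<open>Any interval with x in its interior would do.\<close>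
  define a where "a = x - 1"
  define c where "c = x + 1"
  have incr: "cdf ?D y = cdf ?D a + integral {a..y} f" if "a \<le> y" for y
  proof (cases "a = y")
    case False
    with that have ay: "a < y" by simp
    have i: "set_integrable lborel {a..y} f"
      by (rule borel_integrable_atLeastAtMost', rule continuous_on_subset[OF f(2)]) simp
    have "emeasure ?D {a<..y} = (\<integral>\<^sup>+u. ennreal (f u) * indicator {a<..y} u \<partial>lborel)"
      unfolding D by (rule emeasure_density) auto
    also have "\<dots> = (\<integral>\<^sup>+u. ennreal (indicator {a..y} u *\<^sub>R f u) \<partial>lborel)"
      by (rule nn_integral_cong_AE, rule AE_mp[OF AE_lborel_singleton[of a]])
         (auto simp: indicator_def)
    also have "\<dots> = ennreal (LBINT u:{a..y}. f u)"
      unfolding set_lebesgue_integral_def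
      by (rule nn_integral_eq_integral) (use i f(1) in \<open>auto simp: set_integrable_def\<close>)
    also have "(LBINT u:{a..y}. f u) = integral {a..y} f"
      by (rule set_borel_integral_eq_integral(2)[OF i])
    finally have "measure ?D {a<..y} = integral {a..y} f"
      using integral_nonneg[OF set_borel_integral_eq_integral(1)[OF i]] f(1)
      by (simp add: measure_def)
    then show ?thesis using D.cdf_diff_eq[OF ay] by simp
  qed simp
  have "((\<lambda>y. integral {a..y} f) has_real_derivative f x) (at x within {a..c})"
    by (rule integral_has_real_derivative) (use f(2) in \<open>auto simp: a_def c_def intro: continuous_on_subset\<close>)
  then have "((\<lambda>y. integral {a..y} f) has_real_derivative f x) (at x)"
    by (subst (asm) at_within_interior) (auto simp: a_def c_def)
  from DERIV_add[OF DERIV_const this]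
  have "((\<lambda>y. cdf ?D a + integral {a..y} f) has_real_derivative f x) (at x)"
    by (simp only: add_0)
  then have "(cdf ?D has_real_derivative f x) (at x)"
  proof (rule has_field_derivative_transform_within_open[where S = "{a<..}"])
    show "cdf ?D a + integral {a..y} f = cdf ?D y" if "y \<in> {a<..}" for y
      by (rule incr[symmetric]) (use that in simp)
  qed (simp_all add: a_def)
  then show ?thesis by (simp add: pdf_def DERIV_imp_deriv)
qed

text \<open>Variables for which the pointwise value \<open>pdf\<close> is itself a density.
  Boundedness is included because it is what makes convolutions continuous, so that the class is
  closed under independent sums.\<close>

definition regular_pdf :: "'a measure \<Rightarrow> ('a \<Rightarrow> real) \<Rightarrow> bool" where
  "regular_pdf M X \<longleftrightarrow> distributed M lborel X (\<lambda>x. ennreal (pdf M X x)) \<and> (\<forall>x. 0 \<le> pdf M X x) \<and>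
     (\<exists>C. \<forall>x. pdf M X x \<le> C) \<and> continuous_on UNIV (pdf M X)"

lemma (in prob_space) regular_pdfI:
  assumes "distributed M lborel X (\<lambda>x. ennreal (f x))" "\<And>x. 0 \<le> f x" "\<And>x. f x \<le> C" "continuous_on UNIV f"
  shows "regular_pdf M X" "pdf M X = f"
proof -
  show "pdf M X = f" by (rule ext) (rule pdf_eq_continuous_density[OF assms(1,2,4)])
  with assms show "regular_pdf M X" by (auto simp: regular_pdf_def)
qed

lemma regular_pdf_cong:
  assumes eq: "distr M borel X = distr M borel X'" and X: "X' \<in> M \<rightarrow>\<^sub>M lborel" and reg: "regular_pdf M X"
  shows "regular_pdf M X'"
proof -
  have lb: "distr M lborel Z = distr M borel Z" for Z :: "'a \<Rightarrow> real"
    by (rule distr_cong) auto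
  have d: "distr M lborel X = distr M lborel X'"
    unfolding lb by (rule eq)
  show ?thesis
    using reg X unfolding regular_pdf_def distributed_def pdf_cong_distr[OF eq] d by blast
qed

text \<open>With C a bound of f, the products f(x - y) g(y) are dominated by C g(y) for all x, so
  the convolution is bounded and continuous. Being a continuous density it agrees with
  \<open>pdf\<close> at every x.\<close>

lemma (in prob_space) regular_pdf_add:
  assumes ind: "indep_var borel X borel Y" and X: "regular_pdf M X" and Y: "regular_pdf M Y"
  shows "regular_pdf M (\<lambda>\<omega>. X \<omega> + Y \<omega>)"
    and "ennreal (pdf M (\<lambda>\<omega>. X \<omega> + Y \<omega>) x) = (\<integral>\<^sup>+y. ennreal (pdf M X (x - y)) * ennreal (pdf M Y y) \<partial>lborel)"
proof -
  define f where "f = pdf M X"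
  define g where "g = pdf M Y"
  obtain C where C: "\<And>x. f x \<le> C" and f0: "\<And>x. 0 \<le> f x" and fc: "continuous_on UNIV f"
    and fd: "distributed M lborel X (\<lambda>x. ennreal (f x))"
    using X by (auto simp: regular_pdf_def f_def)
  have g0: "\<And>x. 0 \<le> g x" and gc: "continuous_on UNIV g" and gd: "distributed M lborel Y (\<lambda>x. ennreal (g x))"
    using Y by (auto simp: regular_pdf_def g_def)
  have [measurable]: "f \<in> borel_measurable borel" "g \<in> borel_measurable borel"
    using fc gc by (auto intro: borel_measurable_continuous_onI)
  have Ym [measurable]: "Y \<in> borel_measurable M" using distributed_measurable[OF gd] by simp
  have "(\<integral>\<^sup>+y. ennreal (g y) \<partial>lborel) = 1"
    using distributed_nn_integral[OF gd, of "\<lambda>_. 1"] by (simp add: emeasure_space_1)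
  then have gi: "integrable lborel g" and g1: "(\<integral>y. g y \<partial>lborel) = 1"
    using g0 by (auto intro!: integrableI_nonneg simp: integral_eq_nn_integral)
  have C0: "0 \<le> C" using f0 C by (rule order_trans)
  have bd: "norm (f (x - y) * g y) \<le> C * g y" for x y
    using f0[of "x - y"] C[of "x - y"] g0[of y] by (simp add: mult_right_mono)
  have fgi: "integrable lborel (\<lambda>y. f (x - y) * g y)" for x
    by (rule Bochner_Integration.integrable_bound[OF integrable_mult_right[OF gi, of C]])
       (use bd C0 g0 in auto)
  define h where "h x = (\<integral>y. f (x - y) * g y \<partial>lborel)" for x
  have h: "(\<integral>\<^sup>+y. ennreal (f (x - y)) * ennreal (g y) \<partial>lborel) = ennreal (h x)" for x
    unfolding h_def using f0 g0
    by (subst nn_integral_eq_integral[OF fgi, symmetric]) (auto simp: ennreal_mult)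
  have h0: "0 \<le> h x" for x unfolding h_def using f0 g0 by (intro integral_nonneg_AE) auto
  have hC: "h x \<le> C" for x
  proof -
    have "h x \<le> (\<integral>y. C * g y \<partial>lborel)" unfolding h_def
      by (rule integral_mono[OF fgi]) (use gi bd in \<open>auto intro: order_trans[OF abs_ge_self]\<close>)
    then show ?thesis by (simp add: g1)
  qed
  have hc: "continuous_on UNIV h"
    unfolding continuous_on_eq_continuous_at[OF open_UNIV] continuous_at_sequentially
  proof safe
    fix x X assume "(X :: nat \<Rightarrow> real) \<longlonglongrightarrow> x"
    then have *: "(\<lambda>n. f (X n - y)) \<longlonglongrightarrow> f (x - y)" for y
      using fc by (intro continuous_on_tendsto_compose[OF fc] tendsto_intros) auto
    show "(h \<circ> X) \<longlonglongrightarrow> h x"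
      unfolding comp_def h_def
      by (rule integral_dominated_convergence[where w = "\<lambda>y. C * g y"])
         (use bd gi in \<open>auto intro!: tendsto_intros *\<close>)
  qed
  have "distributed M lborel (\<lambda>\<omega>. X \<omega> + Y \<omega>) (\<lambda>x. ennreal (h x))"
    using distributed_convolution[OF ind fd gd] by (simp add: h)
  note r = regular_pdfI[OF this h0 hC hc]
  show "regular_pdf M (\<lambda>\<omega>. X \<omega> + Y \<omega>)" by (rule r(1))
  show "ennreal (pdf M (\<lambda>\<omega>. X \<omega> + Y \<omega>) x) = (\<integral>\<^sup>+y. ennreal (pdf M X (x - y)) * ennreal (pdf M Y y) \<partial>lborel)"
    unfolding r(2) h[symmetric] f_def g_def by (rule refl)
qed

lemma (in prob_space) regular_pdf_shift:
  assumes X: "regular_pdf M X"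
  shows "regular_pdf M (\<lambda>\<omega>. c + X \<omega>)" "pdf M (\<lambda>\<omega>. c + X \<omega>) x = pdf M X (x - c)"
proof -
  obtain C where C: "\<And>x. pdf M X x \<le> C" and f0: "\<And>x. 0 \<le> pdf M X x" and fc: "continuous_on UNIV (pdf M X)"
    and fd: "distributed M lborel X (\<lambda>x. ennreal (pdf M X x))"
    using X by (auto simp: regular_pdf_def)
  have "distributed M lborel (\<lambda>\<omega>. c + 1 * X \<omega>) (\<lambda>x. ennreal (pdf M X ((x - c) / 1)) / ennreal \<bar>1\<bar>)"
    by (rule distributed_affine[OF fd]) simp
  then have d: "distributed M lborel (\<lambda>\<omega>. c + X \<omega>) (\<lambda>x. ennreal (pdf M X (x - c)))"
    by (simp add: divide_ennreal_def)
  have "continuous_on UNIV (\<lambda>x. pdf M X (x - c))"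
    by (intro continuous_on_compose2[OF fc] continuous_intros) auto
  from regular_pdfI[OF d f0 C this]
  show "regular_pdf M (\<lambda>\<omega>. c + X \<omega>)" "pdf M (\<lambda>\<omega>. c + X \<omega>) x = pdf M X (x - c)"
    by simp_all
qed

text \<open>A Dirac law means that the variable is almost surely constant, so convolution with it is
  a translation; two densities are convolved in the usual way.\<close>

lemma (in prob_space) has_gen_density_conv:
  assumes ind: "indep_var borel X borel Y" and X: "has_gen_density M X a" and Y: "has_gen_density M Y c"
  shows "has_gen_density M (\<lambda>\<omega>. X \<omega> + Y \<omega>) (conv a c)"
proof -
  have [measurable]: "X \<in> borel_measurable M" "Y \<in> borel_measurable M"
    by (rule indep_var_rv1[OF ind], rule indep_var_rv2[OF ind])
  have const: "AE \<omega> in M. Z \<omega> = r" if "distr M borel Z = return borel r" and Zm: "Z \<in> borel_measurable M"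
    for Z :: "'a \<Rightarrow> real" and r
  proof -
    have "AE z in distr M borel Z. z = r" unfolding that(1) by (subst AE_return) auto
    then show ?thesis by (rule AE_distrD[OF Zm])
  qed
  have shift: "distributed M lborel (\<lambda>\<omega>. Z \<omega> + Z' \<omega>) (\<lambda>x. f (x - r))"
    if Z: "distributed M lborel Z f" and Z': "AE \<omega> in M. Z' \<omega> = r" and [measurable]: "Z' \<in> borel_measurable M" for Z Z' :: "'a \<Rightarrow> real" and f r
  proof -
    have "distributed M lborel (\<lambda>\<omega>. r + 1 * Z \<omega>) (\<lambda>x. f ((x - r) / 1) / ennreal \<bar>1\<bar>)"
      by (rule distributed_affine[OF Z]) simp
    then have "distributed M lborel (\<lambda>\<omega>. r + Z \<omega>) (\<lambda>x. f (x - r))" by (simp add: divide_ennreal_def)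
    moreover have [measurable]: "Z \<in> borel_measurable M" using distributed_measurable[OF Z] by simp
    have "distr M lborel (\<lambda>\<omega>. r + Z \<omega>) = distr M lborel (\<lambda>\<omega>. Z \<omega> + Z' \<omega>)"
      by (rule distr_cong_AE) (use Z' in \<open>auto elim: eventually_mono\<close>)
    ultimately show ?thesis by (simp add: distributed_def)
  qed
  show ?thesis
  proof (cases a; cases c)
    fix r q assume ac: "a = Dirac r" "c = Dirac q"
    have "AE \<omega> in M. X \<omega> = r" "AE \<omega> in M. Y \<omega> = q" using X Y const by (simp_all add: ac)
    then have "AE \<omega> in M. X \<omega> + Y \<omega> = r + q" by eventually_elim simp
    then have "distr M borel (\<lambda>\<omega>. X \<omega> + Y \<omega>) = distr M borel (\<lambda>_. r + q)"
      by (intro distr_cong_AE_borel) auto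
    also have "\<dots> = return borel (r + q)" by (rule distr_const) simp
    finally show ?thesis by (simp add: ac)
  next
    fix r f assume ac: "a = Dirac r" "c = Density f"
    show ?thesis using shift[of Y f X r] X Y const by (simp add: ac add.commute)
  next
    fix f r assume ac: "a = Density f" "c = Dirac r"
    show ?thesis using shift[of X f Y r] X Y const by (simp add: ac)
  next
    fix f g assume ac: "a = Density f" "c = Density g"
    show ?thesis using distributed_convolution[OF ind] X Y by (simp add: ac)
  qed
qed


section \<open>Densities of conditional and randomised components\<close>

lemma constant_component_distr:
  assumes c: "component M W (\<lambda>_. z) P \<eta> lam b \<sigma> Y" and t: "0 \<le> t"
  shows "distr M borel (Y t) =
    component_law (drift_integral b t) (variance_integral \<sigma> t) (distr M borel (jump_sum P \<eta> t)) z"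
proof -
  interpret component M W "\<lambda>_. z" P \<eta> lam b \<sigma> Y by (rule c)
  have "distr M borel (\<lambda>_. z) = return borel z" by (rule distr_const) simp
  then show ?thesis
    using component_distr[OF t] mixture_return[OF drift_integral_measurable[OF drift]
        variance_integral_measurable[OF volatility] prob_space_jump_law[OF t] sets_distr]
    by simp
qed

text \<open>No jump occurs before \<open>t\<close> with positive probability, so a vanishing volatility would
  leave an atom.\<close>

lemma constant_component_variance_pos:
  assumes c: "component M W (\<lambda>_. z) P \<eta> lam b \<sigma> Y" and t: "0 < t" and pdf: "has_pdf M (Y t)"
  shows "0 < variance_integral \<sigma> t z"
proof (rule ccontr)
  assume "\<not> 0 < variance_integral \<sigma> t z"
  then have V: "variance_integral \<sigma> t z = 0"
    using variance_integral_nonneg[of \<sigma> t z] by simp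
  interpret component M W "\<lambda>_. z" P \<eta> lam b \<sigma> Y by (rule c)
  have "0 < emeasure (distr M borel (Y t)) {drift_integral b t z}"
    unfolding constant_component_distr[OF c less_imp_le[OF t]]
      component_law_atom[OF drift_integral_measurable[OF drift]
        variance_integral_measurable[OF volatility] prob_space_jump_law[OF less_imp_le[OF t]] sets_distr V]
    by (rule jump_law_atom[OF t])
  moreover have "{drift_integral b t z} \<in> null_sets (distr M borel (Y t))"
  proof -
    have "{drift_integral b t z} \<in> null_sets lborel" by (simp add: null_sets_def)
    then show ?thesis using pdf unfolding has_pdf_def absolutely_continuous_def by blast
  qed
  ultimately show False by (simp add: null_sets_def)
qed

lemma constant_component_regular_pdf:
  assumes c: "component M W (\<lambda>_. z) P \<eta> lam b \<sigma> Y" and t: "0 < t" and pdf: "has_pdf M (Y t)"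
  shows "regular_pdf M (Y t)"
    and "pdf M (Y t) = component_density (drift_integral b t) (variance_integral \<sigma> t) (distr M borel (jump_sum P \<eta> t)) z"
proof -
  interpret component M W "\<lambda>_. z" P \<eta> lam b \<sigma> Y by (rule c)
  note V = constant_component_variance_pos[OF assms]
  note A = drift_integral_measurable[OF drift, of t] variance_integral_measurable[OF volatility, of t]
    prob_space_jump_law[OF less_imp_le[OF t]] sets_distr
  let ?f = "component_density (drift_integral b t) (variance_integral \<sigma> t) (distr M borel (jump_sum P \<eta> t)) z"
  have cont: "continuous_on UNIV ?f"
    using isCont_component_density[OF A V] by (simp add: continuous_on_eq_continuous_at)
  have "distr M lborel (Y t) = distr M borel (Y t)" by (rule distr_cong) auto
  also have "\<dots> = density lborel (\<lambda>y. ennreal (?f y))"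
    unfolding constant_component_distr[OF c less_imp_le[OF t]]
    by (rule component_law_eq_density[OF A V])
  finally have d: "distributed M lborel (Y t) (\<lambda>y. ennreal (?f y))"
    using pdf borel_measurable_continuous_onI[OF cont]
    by (simp add: distributed_def has_pdf_def)
  show "regular_pdf M (Y t)" "pdf M (Y t) = ?f"
    by (rule regular_pdfI[OF d component_density_nonneg[OF A] component_density_bound[OF A V] cont])+
qed

text \<open>On D, which carries the law of \<zeta>, every conditional \<open>pdf\<close> equals
  \<open>component_density\<close>. The latter is jointly measurable in parameter and point, which
  permits exchanging the integrals over z and y.\<close>

lemma random_component_distributed:
  assumes c: "component M W \<zeta> P \<eta> lam b \<sigma> Yr" and t: "0 < t"
    and D [measurable]: "D \<in> sets borel" "AE \<omega> in M. \<zeta> \<omega> \<in> D"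
    and Y: "\<And>z. z \<in> D \<Longrightarrow> component M W (\<lambda>_. z) P \<eta> lam b \<sigma> (Y z)"
    and pdf: "\<And>z. z \<in> D \<Longrightarrow> has_pdf M (Y z t)"
  shows "distributed M lborel (Yr t) (\<lambda>y. \<integral>\<^sup>+z\<in>D. ennreal (pdf M (Y z t) y) \<partial>distr M borel \<zeta>)"
proof -
  interpret component M W \<zeta> P \<eta> lam b \<sigma> Yr by (rule c)
  let ?B = "drift_integral b t" and ?V = "variance_integral \<sigma> t" and ?L = "jump_law t" and ?Z = "distr M borel \<zeta>"
  note A = drift_integral_measurable[OF drift, of t] variance_integral_measurable[OF volatility, of t]
    prob_space_jump_law[OF less_imp_le[OF t]] sets_distr
  interpret Z: prob_space ?Z by (rule prob_space_distr) simp
  interpret LZ: pair_sigma_finite ?Z lborel ..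
  have Zs: "sets (borel \<Otimes>\<^sub>M ?Z) = sets (borel \<Otimes>\<^sub>M borel)" by (intro sets_pair_measure_cong) auto
  note V = constant_component_variance_pos[OF Y t pdf]
  note p = constant_component_regular_pdf(2)[OF Y t pdf]
  let ?k = "\<lambda>z y. ennreal (component_density ?B ?V ?L z y)"
  have km [measurable]: "(\<lambda>q. component_density ?B ?V ?L (fst q) (snd q)) \<in> borel_measurable (borel \<Otimes>\<^sub>M borel)"
    using component_density_measurable[OF A] by (simp add: split_beta')
  let ?f = "\<lambda>y. \<integral>\<^sup>+z. ?k z y * indicator D z \<partial>?Z"
  have f: "(\<lambda>y. \<integral>\<^sup>+z\<in>D. ennreal (pdf M (Y z t) y) \<partial>?Z) = ?f"
    by (intro ext nn_integral_cong) (auto simp: p indicator_def)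
  have km': "(\<lambda>(y, z). ?k z y * indicator D z) \<in> borel_measurable (borel \<Otimes>\<^sub>M ?Z)"
  proof -
    have "(\<lambda>q. component_density ?B ?V ?L (snd q) (fst q)) \<in> borel_measurable (borel \<Otimes>\<^sub>M borel)"
      using measurable_compose[OF measurable_Pair[OF measurable_snd measurable_fst] km] by simp
    then have "(\<lambda>(y, z). ?k z y * indicator D z) \<in> borel_measurable (borel \<Otimes>\<^sub>M borel)"
      unfolding split_beta' by measurable
    then show ?thesis by (subst measurable_cong_sets[OF Zs refl])
  qed
  have fm: "?f \<in> borel_measurable lborel"
    using Z.borel_measurable_nn_integral[OF km'] by simp
  have Ym: "Yr t \<in> borel_measurable M"
    using component t by (simp add: component_process_def)
  have "distr M lborel (Yr t) = distr M borel (Yr t)" by (rule distr_cong) auto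
  also have "\<dots> = density lborel ?f"
  proof (rule measure_eqI)
    fix E assume "E \<in> sets (distr M borel (Yr t))"
    then have E [measurable]: "E \<in> sets borel" by simp
    have AED: "AE z in ?Z. z \<in> D" using D by (subst AE_distr_iff) auto
    have "emeasure (distr M borel (Yr t)) E = (\<integral>\<^sup>+z. emeasure (component_law ?B ?V ?L z) E \<partial>?Z)"
      unfolding component_distr[OF less_imp_le[OF t]]
      by (rule emeasure_mixture[OF A Z.prob_space_axioms sets_distr E])
    also have "\<dots> = (\<integral>\<^sup>+z. \<integral>\<^sup>+y. ?k z y * indicator D z * indicator E y \<partial>lborel \<partial>?Z)"
    proof (rule nn_integral_cong_AE, use AED in eventually_elim)
      case (elim z)
      have "(\<lambda>y. component_density ?B ?V ?L z y) \<in> borel_measurable borel"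
        using measurable_compose[OF measurable_Pair1' km, of z] by simp
      then have "emeasure (density lborel (?k z)) E = (\<integral>\<^sup>+y. ?k z y * indicator E y \<partial>lborel)"
        by (intro emeasure_density) auto
      then show ?case
        unfolding component_law_eq_density[OF A V[OF elim elim]] using elim by simp
    qed
    also have "\<dots> = (\<integral>\<^sup>+y. \<integral>\<^sup>+z. ?k z y * indicator D z * indicator E y \<partial>?Z \<partial>lborel)"
    proof (rule LZ.Fubini'[symmetric])
      have zs: "sets (?Z \<Otimes>\<^sub>M lborel) = sets (borel \<Otimes>\<^sub>M borel)" by (intro sets_pair_measure_cong) auto
      have "(\<lambda>(z, y). ?k z y * indicator D z * indicator E y) \<in> borel_measurable (borel \<Otimes>\<^sub>M borel)"
        unfolding split_beta' by measurable
      then show "(\<lambda>(z, y). ?k z y * indicator D z * indicator E y) \<in> borel_measurable (?Z \<Otimes>\<^sub>M lborel)"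
        by (subst measurable_cong_sets[OF zs refl])
    qed
    also have "\<dots> = (\<integral>\<^sup>+y. ?f y * indicator E y \<partial>lborel)"
      using measurable_compose[OF measurable_Pair1' km']
      by (intro nn_integral_cong nn_integral_multc) simp
    also have "\<dots> = emeasure (density lborel ?f) E"
      using fm by (subst emeasure_density) auto
    finally show "emeasure (distr M borel (Yr t)) E = emeasure (density lborel ?f) E" .
  qed simp
  finally have d: "distr M lborel (Yr t) = density lborel ?f" .
  have "Yr t \<in> M \<rightarrow>\<^sub>M lborel" using Ym by simp
  then show ?thesis unfolding f distributed_def using fm d by blast
qed

text \<open>On the degenerate interval \<open>{0..0}\<close> every grid consists of zeros, so all
  simple integrals vanish and so does their limit in probability.\<close>

lemma component_zero:
  assumes c: "component M W \<zeta> P \<eta> lam b \<sigma> Y"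
  shows "AE \<omega> in M. Y 0 \<omega> = 0"
proof -
  interpret component M W \<zeta> P \<eta> lam b \<sigma> Y by (rule c)
  obtain I where I: "is_ito_integral M filtration W (\<lambda>u \<omega>. \<sigma> u (\<zeta> \<omega>)) 0 I"
    and Y: "AE \<omega> in M. Y 0 \<omega> = (LBINT u:{0..0}. b u (\<zeta> \<omega>)) + I \<omega> + (\<Sum>i=1..P 0 \<omega>. \<eta> i \<omega>)"
    using component unfolding component_process_def by blast
  have [measurable]: "I \<in> borel_measurable M" using I by (simp add: is_ito_integral_def)
  obtain n r \<xi> where sp: "\<And>m. simple_process filtration 0 (n m) (r m) (\<xi> m)"
    and conv: "converges_in_probability M (\<lambda>m. simple_integral W (n m) (r m) (\<xi> m)) I"
    using I unfolding is_ito_integral_def by blast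
  have X: "simple_integral W (n m) (r m) (\<xi> m) \<omega> = 0" for m \<omega>
  proof -
    have rn: "r m 0 = 0" "r m (n m) = 0" and rmono: "\<And>k. k < n m \<Longrightarrow> r m k \<le> r m (Suc k)"
      using sp[of m] by (auto simp: simple_process_def)
    have rle: "i \<le> k \<Longrightarrow> k \<le> n m \<Longrightarrow> r m i \<le> r m k" for i k
      by (induction k rule: dec_induct) (auto intro: order_trans[OF _ rmono])
    have "r m k = 0" if "k \<le> n m" for k
      using rle[of 0 k] rle[of k "n m"] that rn by auto
    then show ?thesis by (simp add: simple_integral_def)
  qed
  \<comment> \<open>The approximating integrals are 0, so the probabilities that tend to 0 are the
    same for all m.\<close>
  have pz: "prob {\<omega> \<in> space M. e < \<bar>I \<omega>\<bar>} = 0" if "0 < e" for e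
    using conv that unfolding converges_in_probability_def X
    by (auto dest!: spec[of _ e] LIMSEQ_unique[OF tendsto_const])
  have "AE \<omega> in M. \<forall>k. \<not> (1 / real (Suc k) < \<bar>I \<omega>\<bar>)"
  proof (subst AE_all_countable, rule allI)
    fix k
    show "AE \<omega> in M. \<not> (1 / real (Suc k) < \<bar>I \<omega>\<bar>)"
      by (rule AE_I[of _ _ "{\<omega> \<in> space M. 1 / real (Suc k) < \<bar>I \<omega>\<bar>}"])
         (use pz[of "1 / real (Suc k)"] in \<open>auto simp: emeasure_eq_measure\<close>)
  qed
  then have I0: "AE \<omega> in M. I \<omega> = 0"
  proof eventually_elim
    case (elim \<omega>)
    show ?case
    proof (rule ccontr)
      assume "I \<omega> \<noteq> 0"
      then obtain k where "1 / real (Suc k) < \<bar>I \<omega>\<bar>"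
        using nat_approx_posE[of "\<bar>I \<omega>\<bar>"] by auto
      with elim show False by blast
    qed
  qed
  have P0: "AE \<omega> in M. P 0 \<omega> = 0" using poisson by (simp add: poisson_process_def)
  have d0: "(LBINT u:{0}. g u) = 0" for g :: "real \<Rightarrow> real"
    unfolding set_lebesgue_integral_def
    by (rule integral_eq_zero_AE, rule AE_mp[OF AE_lborel_singleton[of 0]]) (auto simp: indicator_def)
  show ?thesis using I0 P0 Y by eventually_elim (simp add: d0)
qed

section \<open>Independent sums and iterated convolutions\<close>

text \<open>Independence is a property of the joint law, namely being the product of the marginals,
  and neither side changes under modification on null sets.\<close>

lemma (in prob_space) indep_vars_cong_AE:
  fixes Y Y' :: "'i \<Rightarrow> 'a \<Rightarrow> real"
  assumes ind: "indep_vars (\<lambda>_. borel) Y' I" and I: "finite I"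
    and Y: "\<And>i. i \<in> I \<Longrightarrow> Y i \<in> borel_measurable M" and ae: "\<And>i. i \<in> I \<Longrightarrow> AE \<omega> in M. Y i \<omega> = Y' i \<omega>"
  shows "indep_vars (\<lambda>_. borel) Y I"
proof (cases "I = {}")
  case True then show ?thesis by (simp add: indep_vars_def indep_sets_def)
next
  case False
  have Y': "\<And>i. i \<in> I \<Longrightarrow> Y' i \<in> borel_measurable M" using ind by (simp add: indep_vars_def)
  have ae': "AE \<omega> in M. \<forall>i\<in>I. Y i \<omega> = Y' i \<omega>" using I ae by (rule AE_finite_allI)
  have "distr M (\<Pi>\<^sub>M i\<in>I. borel) (\<lambda>\<omega>. \<lambda>i\<in>I. Y i \<omega>) = distr M (\<Pi>\<^sub>M i\<in>I. borel) (\<lambda>\<omega>. \<lambda>i\<in>I. Y' i \<omega>)"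
  proof (rule distr_cong_AE)
    show "AE \<omega> in M. (\<lambda>i\<in>I. Y i \<omega>) = (\<lambda>i\<in>I. Y' i \<omega>)"
      using ae' by eventually_elim (auto simp: restrict_def)
  qed (auto intro!: measurable_restrict Y Y')
  also have "\<dots> = (\<Pi>\<^sub>M i\<in>I. distr M borel (Y' i))"
    using indep_vars_iff_distr_eq_PiM'[OF False, where M' = "\<lambda>_. borel" and X = Y'] ind Y' by auto
  also have "\<dots> = (\<Pi>\<^sub>M i\<in>I. distr M borel (Y i))"
    by (intro PiM_cong refl distr_cong_AE_borel[symmetric] Y Y' ae)
  finally show ?thesis
    using indep_vars_iff_distr_eq_PiM'[OF False, where M' = "\<lambda>_. borel" and X = Y] Y by auto
qed

lemma (in prob_space) indep_var_partial_sum: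
  fixes X :: "nat \<Rightarrow> 'a \<Rightarrow> real"
  assumes "indep_vars (\<lambda>_. borel) X {..M'}" "m \<le> M'"
  shows "indep_var borel (\<lambda>\<omega>. x0 + (\<Sum>i<m. X i \<omega>)) borel (X m)"
proof -
  have "indep_var
    borel ((\<lambda>f. x0 + (\<Sum>i<m. f i)) \<circ> (\<lambda>\<omega>. restrict (\<lambda>i. X i \<omega>) {..<m}))
    borel ((\<lambda>f. f m) \<circ> (\<lambda>\<omega>. restrict (\<lambda>i. X i \<omega>) {m}))"
    using assms by (intro indep_var_compose[OF indep_var_restrict[OF assms(1)]]) auto
  then show ?thesis by (simp add: comp_def)
qed

lemma (in prob_space) has_gen_density_foldl_conv:
  fixes X :: "nat \<Rightarrow> 'a \<Rightarrow> real"
  assumes ind: "indep_vars (\<lambda>_. borel) X {..M'}" and d: "\<And>j. j \<le> M' \<Longrightarrow> has_gen_density M (X j) (d j)"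
    and m: "m \<le> Suc M'"
  shows "has_gen_density M (\<lambda>\<omega>. x0 + (\<Sum>j<m. X j \<omega>)) (foldl conv (Dirac x0) (map d [0..<m]))"
  using m
proof (induction m)
  case 0
  have "distr M borel (\<lambda>\<omega>. x0) = return borel x0" by (rule distr_const) simp
  then show ?case by simp
next
  case (Suc m)
  then have "m \<le> M'" by simp
  have "has_gen_density M (\<lambda>\<omega>. (x0 + (\<Sum>j<m. X j \<omega>)) + X m \<omega>) (conv (foldl conv (Dirac x0) (map d [0..<m])) (d m))"
    by (rule has_gen_density_conv[OF indep_var_partial_sum[OF ind \<open>m \<le> M'\<close>] _ d]) (use Suc in auto)
  then show ?case by (simp add: add.assoc)
qed


section \<open>Independence of the components\<close>

lemma Int_stable_process_events: "Int_stable (process_events \<Omega> T X)"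
proof (rule Int_stableI)
  interpret sigma_algebra "space \<Omega>" "process_events \<Omega> T X"
    unfolding process_events_def by (rule sigma_algebra_sigma_sets) auto
  fix a b assume "a \<in> process_events \<Omega> T X" "b \<in> process_events \<Omega> T X"
  then show "a \<inter> b \<in> process_events \<Omega> T X" by (rule Int)
qed

lemma Int_stable_source_events: "Int_stable (source_events \<Omega> W P \<eta> \<theta> i)"
  by (cases i) (simp_all add: Int_stable_process_events)

lemma process_events_singleton:
  "process_events \<Omega> {j} \<theta> = sigma_sets (space \<Omega>) {\<theta> j -` A \<inter> space \<Omega> | A. A \<in> sets borel}"
  unfolding process_events_def by (rule arg_cong[where f = "sigma_sets (space \<Omega>)"]) auto

lemma sigma_sets_constant_subset:
  "sigma_sets (space \<Omega>) {(\<lambda>_. z) -` A \<inter> space \<Omega> | A. A \<in> sets borel} \<subseteq> {{}, space \<Omega>}"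
proof
  fix x assume "x \<in> sigma_sets (space \<Omega>) {(\<lambda>_. z) -` A \<inter> space \<Omega> | A. A \<in> sets borel}"
  then show "x \<in> {{}, space \<Omega>}"
  proof (induction rule: sigma_sets.induct)
    case (Union a)
    then show ?case by (cases "\<exists>i. a i = space \<Omega>") auto
  qed (auto split: if_splits)
qed

text \<open>A constant contributes only the empty set and the whole space. Independence shown with a
  randomiser is thereby inherited when the randomiser is replaced by a constant.\<close>

lemma diffusion_events_constant_subset: "diffusion_events \<Omega> W (\<lambda>_. z) \<subseteq> diffusion_events \<Omega> W \<zeta>"
  unfolding diffusion_events_def
proof (rule sigma_sets_mono', rule Un_mono[OF order_refl])
  have "{} \<in> sigma_sets (space \<Omega>) {\<zeta> -` A \<inter> space \<Omega> | A. A \<in> sets borel}" by (rule sigma_sets.Empty)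
  moreover have "space \<Omega> \<in> sigma_sets (space \<Omega>) {\<zeta> -` A \<inter> space \<Omega> | A. A \<in> sets borel}"
    by (rule sigma_sets_top)
  ultimately show "sigma_sets (space \<Omega>) {(\<lambda>_. z) -` A \<inter> space \<Omega> | A. A \<in> sets borel}
      \<subseteq> sigma_sets (space \<Omega>) {\<zeta> -` A \<inter> space \<Omega> | A. A \<in> sets borel}"
    using sigma_sets_constant_subset[of \<Omega> z] by blast
qed

locale driving_sources = prob_space \<Omega> for \<Omega> :: "'a measure" +
  fixes M :: nat and lam :: real and W :: "nat \<Rightarrow> real \<Rightarrow> 'a \<Rightarrow> real" and P :: "nat \<Rightarrow> real \<Rightarrow> 'a \<Rightarrow> nat"
    and \<eta> :: "nat \<Rightarrow> nat \<Rightarrow> 'a \<Rightarrow> real" and \<theta> :: "nat \<Rightarrow> 'a \<Rightarrow> real"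
  assumes bm: "\<And>j. j \<le> M \<Longrightarrow> standard_brownian_motion \<Omega> (W j)"
    and poisson: "\<And>j. j \<le> M \<Longrightarrow> poisson_process \<Omega> lam (P j)"
    and jumps: "\<And>j i. j \<le> M \<Longrightarrow> 1 \<le> i \<Longrightarrow> \<eta> j i \<in> borel_measurable \<Omega>"
    and randomiser: "\<And>j. j \<le> M \<Longrightarrow> \<theta> j \<in> borel_measurable \<Omega>"
    and indep: "indep_sets (source_events \<Omega> W P \<eta> \<theta>) (sources M)"
begin

abbreviation source_algebra :: "source \<Rightarrow> 'a set set" where
  "source_algebra \<equiv> source_events \<Omega> W P \<eta> \<theta>"

text \<open>All sources of component j. Blocks of different components are disjoint, which is where
  independence of components comes from.\<close>

definition block :: "nat \<Rightarrow> source set" where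
  "block j = {Brownian j, Randomiser j, Poisson j} \<union> {Jump j i | i. 1 \<le> i}"

lemma block_subset: "j \<le> M \<Longrightarrow> block j \<subseteq> sources M"
  by (auto simp: block_def sources_def)

lemma disjoint_block: "disjoint_family_on block J"
  by (auto simp: disjoint_family_on_def block_def)

lemma source_algebra_subset: "i \<in> sources M \<Longrightarrow> source_algebra i \<subseteq> events"
  using indep by (auto simp: indep_sets_def)

text \<open>The sources are jointly independent and each algebra is stable under intersection, so
  disjoint groups generate independent algebras.\<close>

lemma indep_set_groups:
  assumes A: "A \<subseteq> sources M" and B: "B \<subseteq> sources M" and disj: "A \<inter> B = {}"
  shows "indep_set (sigma_sets (space \<Omega>) (\<Union>i\<in>A. source_algebra i)) (sigma_sets (space \<Omega>) (\<Union>i\<in>B. source_algebra i))"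
proof -
  have "indep_sets (\<lambda>c. sigma_sets (space \<Omega>) (\<Union>i\<in>case_bool A B c. source_algebra i)) UNIV"
  proof (rule indep_sets_collect_sigma)
    show "indep_sets source_algebra (\<Union>c\<in>UNIV. case_bool A B c)"
      by (rule indep_sets_mono_index[OF _ indep]) (use A B in \<open>auto split: bool.splits\<close>)
    show "disjoint_family_on (case_bool A B) UNIV"
      using disj by (auto simp: disjoint_family_on_def split: bool.splits)
  qed (rule Int_stable_source_events)
  also have "(\<lambda>c. sigma_sets (space \<Omega>) (\<Union>i\<in>case_bool A B c. source_algebra i)) =
      case_bool (sigma_sets (space \<Omega>) (\<Union>i\<in>A. source_algebra i)) (sigma_sets (space \<Omega>) (\<Union>i\<in>B. source_algebra i))"
    by (auto simp: fun_eq_iff split: bool.splits)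
  finally show ?thesis unfolding indep_set_def .
qed

lemma indep_set_subset: "indep_set A B \<Longrightarrow> A' \<subseteq> A \<Longrightarrow> B' \<subseteq> B \<Longrightarrow> indep_set A' B'"
  unfolding indep_sets2_eq by blast

lemma randomiser_indep:
  assumes j: "j \<le> M"
  shows "indep_set (process_events \<Omega> {0..} (W j)) (sigma_sets (space \<Omega>) {\<theta> j -` A \<inter> space \<Omega> | A. A \<in> sets borel})"
proof (rule indep_set_subset[OF indep_set_groups[of "{Brownian j}" "{Randomiser j}"]])
  show "{Brownian j} \<subseteq> sources M" "{Randomiser j} \<subseteq> sources M" using j by (auto simp: sources_def)
  show "process_events \<Omega> {0..} (W j) \<subseteq> sigma_sets (space \<Omega>) (\<Union>i\<in>{Brownian j}. source_algebra i)"
    by (simp add: sigma_sets_superset_generator)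
  show "sigma_sets (space \<Omega>) {\<theta> j -` A \<inter> space \<Omega> | A. A \<in> sets borel} \<subseteq> sigma_sets (space \<Omega>) (\<Union>i\<in>{Randomiser j}. source_algebra i)"
    by (simp add: process_events_singleton sigma_sets_superset_generator)
qed simp

lemma diffusion_events_randomiser:
  "diffusion_events \<Omega> (W j) (\<theta> j) = sigma_sets (space \<Omega>) (\<Union>i\<in>{Brownian j, Randomiser j}. source_algebra i)"
  by (simp add: diffusion_events_def process_events_singleton)

lemma jump_events_sources:
  "jump_events \<Omega> (P j) (\<eta> j) = sigma_sets (space \<Omega>) (\<Union>i\<in>{Poisson j} \<union> {Jump j i | i. 1 \<le> i}. source_algebra i)"
  unfolding jump_events_def by (rule arg_cong[where f = "sigma_sets (space \<Omega>)"]) auto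

lemma jumps_indep:
  assumes j: "j \<le> M"
  shows "indep_set (diffusion_events \<Omega> (W j) (\<theta> j)) (jump_events \<Omega> (P j) (\<eta> j))"
  unfolding diffusion_events_randomiser jump_events_sources
  by (rule indep_set_groups) (use j in \<open>auto simp: sources_def\<close>)

lemma component_random:
  assumes j: "j \<le> M" and "admissible_coefficient 1 b" "admissible_coefficient 2 \<sigma>"
    and "component_process \<Omega> b \<sigma> (W j) (P j) (\<eta> j) (\<theta> j) Y"
  shows "component \<Omega> (W j) (\<theta> j) (P j) (\<eta> j) lam b \<sigma> Y"
  by (intro component.intro brownian_with_parameter.intro brownian_with_parameter_axioms.intro
      component_axioms.intro prob_space_axioms bm poisson jumps randomiser randomiser_indep jumps_indep assms)

lemma component_constant:
  assumes j: "j \<le> M" and "admissible_coefficient 1 b" "admissible_coefficient 2 \<sigma>"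
    and "component_process \<Omega> b \<sigma> (W j) (P j) (\<eta> j) (\<lambda>_. z) Y"
  shows "component \<Omega> (W j) (\<lambda>_. z) (P j) (\<eta> j) lam b \<sigma> Y"
proof -
  have 1: "indep_set (process_events \<Omega> {0..} (W j)) (sigma_sets (space \<Omega>) {(\<lambda>_. z) -` A \<inter> space \<Omega> | A. A \<in> sets borel})"
  proof (rule indep_set_subset[OF _ order_refl sigma_sets_constant_subset])
    have W: "process_events \<Omega> {0..} (W j) \<subseteq> events"
      using indep_setD_ev1[OF randomiser_indep[OF j]] .
    show "indep_set (process_events \<Omega> {0..} (W j)) {{}, space \<Omega>}"
    proof (rule indep_setI[OF W])
      fix a b assume "a \<in> process_events \<Omega> {0..} (W j)" "b \<in> {{}, space \<Omega>}"
      with W show "prob (a \<inter> b) = prob a * prob b"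
        using sets.sets_into_space[of a \<Omega>] by (auto simp: prob_space Int_absorb2)
    qed auto
  qed
  have 2: "indep_set (diffusion_events \<Omega> (W j) (\<lambda>_. z)) (jump_events \<Omega> (P j) (\<eta> j))"
    by (rule indep_set_subset[OF jumps_indep[OF j] diffusion_events_constant_subset order_refl])
  show ?thesis
    by (intro component.intro brownian_with_parameter.intro brownian_with_parameter_axioms.intro
        component_axioms.intro prob_space_axioms bm poisson jumps measurable_const 1 2 assms) simp
qed

text \<open>Each component has a version measurable for its block, and the blocks are disjoint.
  Admitting \<theta> j or a constant for each j covers the randomised components as well as the
  components at quadrature nodes.\<close>

lemma indep_vars_components:
  assumes c: "\<And>j. j \<le> M \<Longrightarrow> component \<Omega> (W j) (\<zeta> j) (P j) (\<eta> j) lam (b j) (\<sigma> j) (Y j)"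
    and \<zeta>: "\<And>j. j \<le> M \<Longrightarrow> \<zeta> j = \<theta> j \<or> (\<exists>z. \<zeta> j = (\<lambda>_. z))" and t: "\<And>j. j \<le> M \<Longrightarrow> 0 \<le> t j"
  shows "indep_vars (\<lambda>_. borel) (\<lambda>j. Y j (t j)) {..M}"
proof -
  define N where "N j = sigma (space \<Omega>) (\<Union>i\<in>block j. source_algebra i)" for j
  have sub: "(\<Union>i\<in>block j. source_algebra i) \<subseteq> Pow (space \<Omega>)" if "j \<le> M" for j
    using block_subset[OF that] source_algebra_subset sets.space_closed[of \<Omega>] by blast
  have N: "space (N j) = space \<Omega>" "sets (N j) = sigma_sets (space \<Omega>) (\<Union>i\<in>block j. source_algebra i)" if "j \<le> M" for j
    using sub[OF that] by (simp_all add: N_def space_measure_of sets_measure_of)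
  have ex: "\<exists>Y'. Y' \<in> borel_measurable (N j) \<and> (AE \<omega> in \<Omega>. Y j (t j) \<omega> = Y' \<omega>)" if j: "j \<le> M" for j
  proof -
    interpret c: component \<Omega> "W j" "\<zeta> j" "P j" "\<eta> j" lam "b j" "\<sigma> j" "Y j" by (rule c[OF j])
    have "diffusion_events \<Omega> (W j) (\<zeta> j) \<subseteq> diffusion_events \<Omega> (W j) (\<theta> j)"
      using \<zeta>[OF j] by (auto dest: subsetD[OF diffusion_events_constant_subset])
    also have "\<dots> \<subseteq> sets (N j)"
      unfolding diffusion_events_randomiser N[OF j] by (rule sigma_sets_mono') (auto simp: block_def)
    finally have d: "diffusion_events \<Omega> (W j) (\<zeta> j) \<subseteq> sets (N j)" .
    have "jump_events \<Omega> (P j) (\<eta> j) \<subseteq> sets (N j)"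
      unfolding jump_events_sources N[OF j] by (rule sigma_sets_mono') (auto simp: block_def)
    from c.component_version[OF t[OF j] N(1)[OF j] d this] show ?thesis by blast
  qed
  then have "\<forall>j\<in>{..M}. \<exists>Y'. Y' \<in> borel_measurable (N j) \<and> (AE \<omega> in \<Omega>. Y j (t j) \<omega> = Y' \<omega>)" by simp
  from bchoice[OF this] obtain Y' where Y'm: "\<And>j. j \<le> M \<Longrightarrow> Y' j \<in> borel_measurable (N j)"
    and Y'ae: "\<And>j. j \<le> M \<Longrightarrow> AE \<omega> in \<Omega>. Y j (t j) \<omega> = Y' j \<omega>" by auto
  have ind: "indep_sets (\<lambda>j. sigma_sets (space \<Omega>) (\<Union>i\<in>block j. source_algebra i)) {..M}"
  proof (rule indep_sets_collect_sigma)
    show "indep_sets source_algebra (\<Union>j\<in>{..M}. block j)"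
      by (rule indep_sets_mono_index[OF _ indep]) (use block_subset in auto)
  qed (rule Int_stable_source_events disjoint_block)+
  have ev: "sets (N j) \<subseteq> events" if "j \<le> M" for j
    using ind that unfolding N[OF that] indep_sets_def by auto
  have "indep_vars (\<lambda>_. borel) Y' {..M}"
    unfolding indep_vars_def2
  proof (intro conjI ballI)
    fix j assume "j \<in> {..M}"
    then have j: "j \<le> M" by simp
    show "Y' j \<in> borel_measurable \<Omega>" by (rule measurable_sub_algebra[OF Y'm[OF j] N(1)[OF j] ev[OF j]])
  next
    show "indep_sets (\<lambda>j. {Y' j -` A \<inter> space \<Omega> | A. A \<in> sets borel}) {..M}"
    proof (rule indep_sets_mono_sets[OF ind])
      fix j assume "j \<in> {..M}"
      then have j: "j \<le> M" by simp
      show "{Y' j -` A \<inter> space \<Omega> | A. A \<in> sets borel} \<subseteq> sigma_sets (space \<Omega>) (\<Union>i\<in>block j. source_algebra i)"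
        using measurable_sets[OF Y'm[OF j]] unfolding N[OF j] by auto
    qed
  qed
  then show ?thesis
  proof (rule indep_vars_cong_AE)
    fix j assume "j \<in> {..M}"
    then have j: "j \<le> M" by simp
    interpret c: component \<Omega> "W j" "\<zeta> j" "P j" "\<eta> j" lam "b j" "\<sigma> j" "Y j" by (rule c[OF j])
    show "Y j (t j) \<in> borel_measurable \<Omega>"
      using c.component t[OF j] by (simp add: component_process_def)
    show "AE \<omega> in \<Omega>. Y j (t j) \<omega> = Y' j \<omega>" by (rule Y'ae[OF j])
  qed simp
qed

end


section \<open>Quadrature\<close>

text \<open>The constant polynomial 1 gives the sum. For the sign of the n-th weight, the product of
  (z - x m)^2 over the other nodes is nonnegative and vanishes at every node except the n-th, so
  exactness equates a positive multiple of the weight with a nonnegative integral.\<close>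

lemma gauss_quadrature_weights:
  assumes q: "gauss_quadrature \<mu> N w x" and N: "1 \<le> N" and \<mu>: "prob_space \<mu>"
  shows "(\<Sum>n=1..N. w n) = 1" and "n \<in> {1..N} \<Longrightarrow> 0 \<le> w n"
proof -
  interpret prob_space \<mu> by (rule \<mu>)
  have ex: "\<And>p :: real poly. degree p < 2 * N \<Longrightarrow> (\<Sum>n=1..N. w n * poly p (x n)) = (\<integral>z. poly p z \<partial>\<mu>)"
    and inj: "inj_on x {1..N}"
    using q by (auto simp: gauss_quadrature_def)
  show "(\<Sum>n=1..N. w n) = 1"
    using ex[of 1] N by (simp add: prob_space)
  show "0 \<le> w n" if n: "n \<in> {1..N}"
  proof -
    define p where "p = (\<Prod>m\<in>{1..N}-{n}. [:- x m, 1:] ^ 2)"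
    have pp: "poly p z = (\<Prod>m\<in>{1..N}-{n}. (z - x m)\<^sup>2)" for z
      by (simp add: p_def poly_prod)
    have p0: "0 \<le> poly p z" for z
      unfolding pp by (rule prod_nonneg) simp
    have "degree p \<le> sum (degree \<circ> (\<lambda>m. [:- x m, 1:] ^ 2)) ({1..N}-{n})"
      unfolding p_def by (rule degree_prod_sum_le) simp
    also have "\<dots> \<le> (\<Sum>m\<in>{1..N}-{n}. 2)"
      by (rule sum_mono) (auto intro: order_trans[OF degree_power_le])
    \<comment> \<open>There are N - 1 squared factors, so the degree is at most 2N - 2, within the
      range of exactness.\<close>
    also have "\<dots> < 2 * N" using n by (simp add: card_Diff_singleton)
    finally have "(\<Sum>m=1..N. w m * poly p (x m)) = (\<integral>z. poly p z \<partial>\<mu>)" by (rule ex)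
    moreover have "(\<Sum>m=1..N. w m * poly p (x m)) = w n * poly p (x n)"
    proof -
      have "poly p (x m) = 0" if "m \<in> {1..N}" "m \<noteq> n" for m
        unfolding pp by (rule prod_zero) (use that in auto)
      then have "(\<Sum>m=1..N. w m * poly p (x m)) = (\<Sum>m\<in>{n}. w m * poly p (x m))"
        by (intro sum.mono_neutral_right) (use n in auto)
      then show ?thesis by simp
    qed
    moreover have "0 \<le> (\<integral>z. poly p z \<partial>\<mu>)"
      by (rule integral_nonneg_AE, rule AE_I2, rule p0)
    moreover have "0 < poly p (x n)"
      unfolding pp
    proof (rule prod_pos)
      fix m assume "m \<in> {1..N} - {n}"
      then have "x n \<noteq> x m" using inj_onD[OF inj _ n, of m] by fastforce
      then show "0 < (x n - x m)\<^sup>2" by simp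
    qed
    ultimately show ?thesis by (simp add: zero_le_mult_iff)
  qed
qed

text \<open>Splits off the last coordinate of a multi-index, so that the multiple quadrature sum can
  be treated by induction on the number of components.\<close>

lemma sum_PiE_lessThan_Suc:
  fixes h :: "(nat \<Rightarrow> 'b) \<Rightarrow> 'c::comm_monoid_add"
  shows "(\<Sum>n\<in>(\<Pi>\<^sub>E j\<in>{..<Suc m}. T j). h n) = (\<Sum>i\<in>T m. \<Sum>n\<in>(\<Pi>\<^sub>E j\<in>{..<m}. T j). h (n(m := i)))"
proof -
  have "(\<Sum>n\<in>(\<Pi>\<^sub>E j\<in>{..<Suc m}. T j). h n) =
      (\<Sum>n\<in>(\<lambda>(i, n). n(m := i)) ` (T m \<times> (\<Pi>\<^sub>E j\<in>{..<m}. T j)). h n)"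
    by (simp add: lessThan_Suc PiE_insert_eq)
  also have "\<dots> = (\<Sum>(i, n)\<in>T m \<times> (\<Pi>\<^sub>E j\<in>{..<m}. T j). h (n(m := i)))"
    by (subst sum.reindex[OF inj_combinator]) (auto simp: split_beta')
  also have "\<dots> = (\<Sum>i\<in>T m. \<Sum>n\<in>(\<Pi>\<^sub>E j\<in>{..<m}. T j). h (n(m := i)))"
    by (rule sum.cartesian_product[symmetric])
  finally show ?thesis .
qed

lemma regular_pdf_measurable: "regular_pdf M X \<Longrightarrow> pdf M X \<in> borel_measurable borel"
  by (auto simp: regular_pdf_def intro: borel_measurable_continuous_onI)

lemma (in prob_space) nn_integral_regular_pdf:
  assumes "regular_pdf M X" shows "(\<integral>\<^sup>+y. ennreal (pdf M X y) \<partial>lborel) = 1"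
  using assms distributed_nn_integral[of M lborel X "\<lambda>x. ennreal (pdf M X x)" "\<lambda>_. 1"]
  by (simp add: regular_pdf_def emeasure_space_1)

lemma (in prob_space) nn_integral_pdf_mixture:
  fixes X :: "'i \<Rightarrow> 'a \<Rightarrow> real"
  assumes w: "\<And>i. i \<in> I \<Longrightarrow> 0 \<le> w i" "(\<Sum>i\<in>I. w i) = 1" and X: "\<And>i. i \<in> I \<Longrightarrow> regular_pdf M (X i)"
  shows "(\<integral>\<^sup>+y. ennreal (\<Sum>i\<in>I. w i * pdf M (X i) y) \<partial>lborel) = 1"
proof -
  have "(\<integral>\<^sup>+y. ennreal (\<Sum>i\<in>I. w i * pdf M (X i) y) \<partial>lborel) =
      (\<integral>\<^sup>+y. (\<Sum>i\<in>I. ennreal (w i) * ennreal (pdf M (X i) y)) \<partial>lborel)"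
    by (intro nn_integral_cong, subst sum_ennreal[symmetric])
       (use X w(1) in \<open>auto simp: regular_pdf_def ennreal_mult intro!: sum.cong\<close>)
  also have "\<dots> = (\<Sum>i\<in>I. ennreal (w i) * (\<integral>\<^sup>+y. ennreal (pdf M (X i) y) \<partial>lborel))"
    using regular_pdf_measurable[OF X] by (subst nn_integral_sum) (auto simp: nn_integral_cmult)
  also have "\<dots> = (\<Sum>i\<in>I. ennreal (w i))"
    using nn_integral_regular_pdf[OF X] by (intro sum.cong) auto
  also have "\<dots> = 1" using w by (subst sum_ennreal) auto
  finally show ?thesis .
qed

text \<open>The quadrature approximation \<open>G\<close> of a partial convolution and the mixture density \<open>F\<close> it
  approximates: \<open>F \<le> G + E\<close> and \<open>f \<le> g + e\<close> imply \<open>F * f \<le> F * g + e \<le> G * g + E + e\<close>,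
  because \<open>F\<close> and \<open>g\<close> have integral 1. Everything is pointwise, as all conditional densities are
  bounded and continuous.\<close>

locale quadrature_mixture = prob_space \<Omega> for \<Omega> :: "'a measure" +
  fixes M :: nat and x0 :: real and s :: "nat \<Rightarrow> real" and N :: "nat \<Rightarrow> nat" and w :: "nat \<Rightarrow> nat \<Rightarrow> real"
    and X :: "nat \<Rightarrow> nat \<Rightarrow> 'a \<Rightarrow> real" and d :: "nat \<Rightarrow> gen_density" and f :: "nat \<Rightarrow> real \<Rightarrow> ennreal"
    and e :: "nat \<Rightarrow> real"
  assumes s0: "0 < s 0" and s: "\<And>j. j \<le> M \<Longrightarrow> 0 \<le> s j"
    and w1: "\<And>j. j \<le> M \<Longrightarrow> (\<Sum>i=1..N j. w j i) = 1" and w0: "\<And>j i. j \<le> M \<Longrightarrow> i \<in> {1..N j} \<Longrightarrow> 0 \<le> w j i"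
    and Xm: "\<And>j i. j \<le> M \<Longrightarrow> X j i \<in> borel_measurable \<Omega>"
    and Xreg: "\<And>j i. j \<le> M \<Longrightarrow> 0 < s j \<Longrightarrow> i \<in> {1..N j} \<Longrightarrow> regular_pdf \<Omega> (X j i)"
    and Xzero: "\<And>j i. j \<le> M \<Longrightarrow> s j = 0 \<Longrightarrow> AE \<omega> in \<Omega>. X j i \<omega> = 0"
    and Xind: "\<And>n. indep_vars (\<lambda>_. borel) (\<lambda>j. X j (n j)) {..M}"
    and dzero: "\<And>j. j \<le> M \<Longrightarrow> s j = 0 \<Longrightarrow> d j = Dirac 0"
    and dpos: "\<And>j. j \<le> M \<Longrightarrow> 0 < s j \<Longrightarrow> d j = Density (f j)"
    and fm: "\<And>j. j \<le> M \<Longrightarrow> 0 < s j \<Longrightarrow> f j \<in> borel_measurable borel"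
    and Fint: "\<And>m F. m \<le> M \<Longrightarrow> foldl conv (Dirac x0) (map d [0..<Suc m]) = Density F \<Longrightarrow>
      F \<in> borel_measurable borel \<and> (\<integral>\<^sup>+x. F x \<partial>lborel) = 1"
    and e0: "\<And>j. j \<le> M \<Longrightarrow> 0 \<le> e j"
    and fe: "\<And>j y. j \<le> M \<Longrightarrow> 0 < s j \<Longrightarrow>
      f j y \<le> ennreal (\<Sum>i=1..N j. w j i * pdf \<Omega> (X j i) y) + ennreal (e j)"
begin

definition partial :: "nat \<Rightarrow> (nat \<Rightarrow> nat) \<Rightarrow> 'a \<Rightarrow> real" where
  "partial m n \<omega> = x0 + (\<Sum>j<m. X j (n j) \<omega>)"

text \<open>The quadrature sum for the first m components. It is built from densities of sums, as in
  the final formula; that it is also an iterated convolution is a matter for the lemmas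
  below.\<close>

definition approx :: "nat \<Rightarrow> real \<Rightarrow> real" where
  "approx m x = (\<Sum>n\<in>(\<Pi>\<^sub>E j\<in>{..<m}. {1..N j}). (\<Prod>j<m. w j (n j)) * pdf \<Omega> (partial m n) x)"

lemma partial_update: "partial (Suc m) (n(m := i)) \<omega> = partial m n \<omega> + X m i \<omega>"
  unfolding partial_def by (simp add: add.assoc)

lemma weight_update: "(\<Prod>j<Suc m. w j ((n(m := i)) j)) = w m i * (\<Prod>j<m. w j (n j))"
  by (simp add: mult.commute)

lemma approx_Suc:
  "approx (Suc m) x = (\<Sum>i=1..N m. \<Sum>n\<in>(\<Pi>\<^sub>E j\<in>{..<m}. {1..N j}).
     (w m i * (\<Prod>j<m. w j (n j))) * pdf \<Omega> (\<lambda>\<omega>. partial m n \<omega> + X m i \<omega>) x)"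
  unfolding approx_def sum_PiE_lessThan_Suc weight_update
  by (intro sum.cong refl arg_cong2[where f = "(*)"] arg_cong2[where f = "pdf \<Omega>"]) (auto simp: partial_update fun_eq_iff)

lemma partial_indep: "m \<le> M \<Longrightarrow> indep_var borel (partial m n) borel (X m i)"
  using indep_var_partial_sum[OF Xind[of "n(m := i)"], of m x0]
  by (simp add: partial_def[abs_def] cong: sum.cong_simp)

lemma partial_weight_nonneg:
  assumes "m \<le> Suc M" "n \<in> (\<Pi>\<^sub>E j\<in>{..<m}. {1..N j})" shows "0 \<le> (\<Prod>j<m. w j (n j))"
proof (rule prod_nonneg)
  fix j assume j: "j \<in> {..<m}"
  show "0 \<le> w j (n j)" by (rule w0[OF _ PiE_mem[OF assms(2) j]]) (use assms(1) j in simp)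
qed

lemma pdf_add_zero:
  assumes "m \<le> M" "s m = 0" and [measurable]: "Z \<in> borel_measurable \<Omega>"
  shows "distr \<Omega> borel (\<lambda>\<omega>. Z \<omega> + X m i \<omega>) = distr \<Omega> borel Z"
proof (rule distr_cong_AE_borel)
  show "AE \<omega> in \<Omega>. Z \<omega> + X m i \<omega> = Z \<omega>" using Xzero[OF assms(1,2), of i] by eventually_elim simp
qed (use Xm[OF assms(1)] in auto)

lemma partial_measurable: "m \<le> Suc M \<Longrightarrow> partial m n \<in> borel_measurable \<Omega>"
  unfolding partial_def by (intro borel_measurable_add borel_measurable_sum Xm) auto

text \<open>The induction starts with one summand, since the constant x0 alone has no density;
  \<open>0 < s 0\<close> makes that summand regular. A later summand is either almost surely 0 or
  regular and independent.\<close>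

lemma partial_regular:
  assumes "m \<le> M" "n \<in> (\<Pi>\<^sub>E j\<in>{..<Suc m}. {1..N j})"
  shows "regular_pdf \<Omega> (partial (Suc m) n)"
  using assms
proof (induction m arbitrary: n)
  case 0
  have "n 0 \<in> {1..N 0}" by (rule PiE_mem[OF 0(2)]) simp
  then have "regular_pdf \<Omega> (X 0 (n 0))" using s0 by (intro Xreg) simp_all
  from regular_pdf_shift(1)[OF this, of x0] show ?case by (simp add: partial_def)
next
  case (Suc m)
  then have m: "Suc m \<le> M" "m \<le> M" by auto
  \<comment> \<open>Elements of \<open>\<Pi>\<^sub>E\<close> are \<open>undefined\<close> outside
    the index set, so n has to be cut down before the induction hypothesis applies.\<close>
  define n' where "n' = restrict n {..<Suc m}"
  have n': "n' \<in> (\<Pi>\<^sub>E j\<in>{..<Suc m}. {1..N j})" 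
    unfolding n'_def restrict_PiE_iff
  proof
    fix j assume "j \<in> {..<Suc m}"
    then show "n j \<in> {1..N j}" by (intro PiE_mem[OF Suc.prems(2)]) simp
  qed
  have r: "regular_pdf \<Omega> (partial (Suc m) n')" by (rule Suc.IH[OF m(2) n'])
  have eq: "partial (Suc (Suc m)) n = (\<lambda>\<omega>. partial (Suc m) n' \<omega> + X (Suc m) (n (Suc m)) \<omega>)"
  proof
    fix \<omega>
    have "(\<Sum>j<Suc m. X j (n' j) \<omega>) = (\<Sum>j<Suc m. X j (n j) \<omega>)"
      by (rule sum.cong) (simp_all add: n'_def)
    then show "partial (Suc (Suc m)) n \<omega> = partial (Suc m) n' \<omega> + X (Suc m) (n (Suc m)) \<omega>"
      by (simp add: partial_def)
  qed
  have i: "n (Suc m) \<in> {1..N (Suc m)}" by (rule PiE_mem[OF Suc.prems(2)]) simp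
  have pm: "partial (Suc m) n' \<in> borel_measurable \<Omega>"
    by (rule partial_measurable) (use m in simp)
  show ?case
  proof (cases "s (Suc m) = 0")
    case True
    show ?thesis unfolding eq
    proof (rule regular_pdf_cong[OF _ _ r])
      show "distr \<Omega> borel (partial (Suc m) n') = distr \<Omega> borel (\<lambda>\<omega>. partial (Suc m) n' \<omega> + X (Suc m) (n (Suc m)) \<omega>)"
        by (rule pdf_add_zero[OF m(1) True pm, of "n (Suc m)", symmetric])
      show "(\<lambda>\<omega>. partial (Suc m) n' \<omega> + X (Suc m) (n (Suc m)) \<omega>) \<in> \<Omega> \<rightarrow>\<^sub>M lborel"
        by (subst measurable_cong_sets[OF refl sets_lborel]) (intro borel_measurable_add pm Xm m(1))
    qed
  next
    case False
    then have "0 < s (Suc m)" using s[OF m(1)] by simp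
    then show ?thesis unfolding eq
      by (intro regular_pdf_add(1)[OF partial_indep[OF m(1)] r] Xreg m i)
  qed
qed

lemma approx_nonneg:
  assumes "m \<le> M" shows "0 \<le> approx (Suc m) x"
  unfolding approx_def
proof (intro sum_nonneg mult_nonneg_nonneg partial_weight_nonneg)
  fix n assume "n \<in> (\<Pi>\<^sub>E j\<in>{..<Suc m}. {1..N j})"
  from partial_regular[OF assms this] show "0 \<le> pdf \<Omega> (partial (Suc m) n) x" by (simp add: regular_pdf_def)
qed (use assms in auto)

abbreviation mix :: "nat \<Rightarrow> real \<Rightarrow> real" where
  "mix j y \<equiv> \<Sum>i=1..N j. w j i * pdf \<Omega> (X j i) y"

lemma mix_nonneg: "j \<le> M \<Longrightarrow> 0 < s j \<Longrightarrow> 0 \<le> mix j y"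
  using Xreg w0 by (intro sum_nonneg mult_nonneg_nonneg) (auto simp: regular_pdf_def)

lemma mix_measurable: "j \<le> M \<Longrightarrow> 0 < s j \<Longrightarrow> mix j \<in> borel_measurable borel"
  by (intro borel_measurable_sum borel_measurable_times borel_measurable_const regular_pdf_measurable Xreg)

lemma nn_integral_mix: "j \<le> M \<Longrightarrow> 0 < s j \<Longrightarrow> (\<integral>\<^sup>+y. ennreal (mix j y) \<partial>lborel) = 1"
  by (intro nn_integral_pdf_mixture w0 w1 Xreg)

text \<open>A component whose clock stands at 0 adds nothing, and its weights sum to 1, so its
  summation index disappears.\<close>

lemma approx_Suc_zero:
  assumes "Suc m \<le> M" "s (Suc m) = 0"
  shows "approx (Suc (Suc m)) x = approx (Suc m) x"
proof -
  have "pdf \<Omega> (\<lambda>\<omega>. partial (Suc m) n \<omega> + X (Suc m) i \<omega>) x = pdf \<Omega> (partial (Suc m) n) x" for n i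
    using pdf_cong_distr[OF pdf_add_zero[OF assms partial_measurable]] assms by simp
  then have "approx (Suc (Suc m)) x = (\<Sum>i=1..N (Suc m). w (Suc m) i * approx (Suc m) x)"
    unfolding approx_Suc[of "Suc m"] by (simp add: approx_def sum_distrib_left mult.assoc)
  also have "\<dots> = approx (Suc m) x"
    using w1[OF assms(1)] by (simp flip: sum_distrib_right)
  finally show ?thesis .
qed

text \<open>Convolution is bilinear, and for regular densities each convolution of a partial sum
  with a node component equals the density of the sum at every point.\<close>

lemma approx_Suc_pos:
  assumes m: "Suc m \<le> M" "0 < s (Suc m)"
  shows "(\<integral>\<^sup>+y. ennreal (approx (Suc m) (x - y)) * ennreal (mix (Suc m) y) \<partial>lborel) = ennreal (approx (Suc (Suc m)) x)"
proof -
  let ?I = "{1..N (Suc m)}" and ?T = "\<Pi>\<^sub>E j\<in>{..<Suc m}. {1..N j}"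
  let ?p = "\<lambda>n. pdf \<Omega> (partial (Suc m) n)" and ?q = "\<lambda>i. pdf \<Omega> (X (Suc m) i)" and ?c = "\<lambda>n. \<Prod>j<Suc m. w j (n j)"
  have mM: "m \<le> M" using m by simp
  have reg: "n \<in> ?T \<Longrightarrow> regular_pdf \<Omega> (partial (Suc m) n)" for n by (rule partial_regular[OF mM])
  note Xr = Xreg[OF m]
  have c: "n \<in> ?T \<Longrightarrow> 0 \<le> ?c n" for n by (rule partial_weight_nonneg) (use m in auto)
  have nonneg: "n \<in> ?T \<Longrightarrow> 0 \<le> ?p n y" "i \<in> ?I \<Longrightarrow> 0 \<le> ?q i y" for n i y
    using reg Xr by (auto simp: regular_pdf_def)
  have pq: "(\<integral>\<^sup>+y. ennreal (?p n (x - y)) * ennreal (?q i y) \<partial>lborel) = ennreal (pdf \<Omega> (\<lambda>\<omega>. partial (Suc m) n \<omega> + X (Suc m) i \<omega>) x)"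
    and pq_nonneg: "0 \<le> pdf \<Omega> (\<lambda>\<omega>. partial (Suc m) n \<omega> + X (Suc m) i \<omega>) x"
    if "n \<in> ?T" "i \<in> ?I" for n i
    using regular_pdf_add[OF partial_indep[OF m(1)] reg[OF that(1)] Xr[OF that(2)]] by (auto simp: regular_pdf_def)
  have "(\<integral>\<^sup>+y. ennreal (approx (Suc m) (x - y)) * ennreal (mix (Suc m) y) \<partial>lborel) =
     (\<integral>\<^sup>+y. (\<Sum>i\<in>?I. \<Sum>n\<in>?T. ennreal (w (Suc m) i * ?c n) * (ennreal (?p n (x - y)) * ennreal (?q i y))) \<partial>lborel)"
  proof (rule nn_integral_cong)
    fix y
    have "ennreal (approx (Suc m) (x - y)) * ennreal (mix (Suc m) y) = ennreal (mix (Suc m) y * approx (Suc m) (x - y))"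
      using approx_nonneg[OF mM] mix_nonneg[OF m] by (simp add: ennreal_mult mult.commute)
    also have "mix (Suc m) y * approx (Suc m) (x - y) = (\<Sum>i\<in>?I. \<Sum>n\<in>?T. (w (Suc m) i * ?c n) * (?p n (x - y) * ?q i y))"
      unfolding approx_def sum_product by (intro sum.cong refl) (simp only: mult_ac)
    also have "ennreal \<dots> = (\<Sum>i\<in>?I. ennreal (\<Sum>n\<in>?T. (w (Suc m) i * ?c n) * (?p n (x - y) * ?q i y)))"
      by (rule sum_ennreal[symmetric]) (intro sum_nonneg mult_nonneg_nonneg c nonneg w0[OF m(1)])
    also have "\<dots> = (\<Sum>i\<in>?I. \<Sum>n\<in>?T. ennreal ((w (Suc m) i * ?c n) * (?p n (x - y) * ?q i y)))"
      by (intro sum.cong refl sum_ennreal[symmetric] mult_nonneg_nonneg c nonneg w0[OF m(1)])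
    also have "\<dots> = (\<Sum>i\<in>?I. \<Sum>n\<in>?T. ennreal (w (Suc m) i * ?c n) * (ennreal (?p n (x - y)) * ennreal (?q i y)))"
    proof (intro sum.cong refl)
      fix i n assume "i \<in> ?I" "n \<in> ?T"
      then show "ennreal ((w (Suc m) i * ?c n) * (?p n (x - y) * ?q i y)) =
        ennreal (w (Suc m) i * ?c n) * (ennreal (?p n (x - y)) * ennreal (?q i y))"
        using c nonneg w0[OF m(1)] by (simp only: ennreal_mult mult_nonneg_nonneg)
    qed
    finally show "ennreal (approx (Suc m) (x - y)) * ennreal (mix (Suc m) y) =
      (\<Sum>i\<in>?I. \<Sum>n\<in>?T. ennreal (w (Suc m) i * ?c n) * (ennreal (?p n (x - y)) * ennreal (?q i y)))" .
  qed
  also have "\<dots> = (\<Sum>i\<in>?I. \<Sum>n\<in>?T. ennreal (w (Suc m) i * ?c n) * (\<integral>\<^sup>+y. ennreal (?p n (x - y)) * ennreal (?q i y) \<partial>lborel))"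
  proof -
    have ms: "(\<lambda>y. ennreal (?p n (x - y)) * ennreal (?q i y)) \<in> borel_measurable lborel" if "n \<in> ?T" "i \<in> ?I" for n i
    proof -
      note [measurable] = regular_pdf_measurable[OF reg[OF that(1)]] regular_pdf_measurable[OF Xr[OF that(2)]]
      show ?thesis by measurable
    qed
    show ?thesis
      by (subst nn_integral_sum, intro borel_measurable_sum borel_measurable_times_ennreal borel_measurable_const ms, assumption, assumption,
          intro sum.cong refl, subst nn_integral_sum, intro borel_measurable_times_ennreal borel_measurable_const ms, assumption, assumption,
          intro sum.cong refl nn_integral_cmult ms)
  qed
  also have "\<dots> = (\<Sum>i\<in>?I. \<Sum>n\<in>?T. ennreal (w (Suc m) i * ?c n * pdf \<Omega> (\<lambda>\<omega>. partial (Suc m) n \<omega> + X (Suc m) i \<omega>) x))"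
  proof (intro sum.cong refl)
    fix i n assume "i \<in> ?I" "n \<in> ?T"
    then show "ennreal (w (Suc m) i * ?c n) * (\<integral>\<^sup>+y. ennreal (?p n (x - y)) * ennreal (?q i y) \<partial>lborel) =
       ennreal (w (Suc m) i * ?c n * pdf \<Omega> (\<lambda>\<omega>. partial (Suc m) n \<omega> + X (Suc m) i \<omega>) x)"
      using c w0[OF m(1)] by (simp only: ennreal_mult mult_nonneg_nonneg pq pq_nonneg)
  qed
  also have "\<dots> = ennreal (approx (Suc (Suc m)) x)"
    unfolding approx_Suc[of "Suc m"]
    by (subst sum_ennreal[symmetric], intro sum_nonneg mult_nonneg_nonneg c w0[OF m(1)] pq_nonneg, assumption+,
        intro sum.cong refl sum_ennreal mult_nonneg_nonneg c w0[OF m(1)] pq_nonneg)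
  finally show ?thesis .
qed

lemma convolution_le_approx:
  assumes "m \<le> M"
  shows "\<exists>F. foldl conv (Dirac x0) (map d [0..<Suc m]) = Density F \<and>
    (\<forall>x. F x \<le> ennreal (approx (Suc m) x) + ennreal (\<Sum>j\<le>m. e j))"
  using assms
proof (induction m)
  case 0
  have "approx (Suc 0) x = mix 0 (x - x0)" for x
  proof -
    have "pdf \<Omega> (\<lambda>\<omega>. partial 0 n \<omega> + X 0 i \<omega>) x = pdf \<Omega> (X 0 i) (x - x0)" if "i \<in> {1..N 0}" for n i
      using regular_pdf_shift(2)[OF Xreg[OF _ s0 that], of x0 x] by (simp add: partial_def)
    then show ?thesis unfolding approx_Suc by simp
  qed
  moreover have "foldl conv (Dirac x0) (map d [0..<Suc 0]) = Density (\<lambda>x. f 0 (x - x0))"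
    using dpos[OF _ s0] by simp
  ultimately show ?case using fe[OF _ s0] by auto
next
  case (Suc m)
  then have m: "Suc m \<le> M" "m \<le> M" by auto
  obtain F where F: "foldl conv (Dirac x0) (map d [0..<Suc m]) = Density F"
    and FG: "\<And>x. F x \<le> ennreal (approx (Suc m) x) + ennreal (\<Sum>j\<le>m. e j)"
    using Suc by auto
  note Fm = Fint[OF m(2) F]
  have fold: "foldl conv (Dirac x0) (map d [0..<Suc (Suc m)]) = conv (Density F) (d (Suc m))"
    using F by (simp del: upt_Suc add: upt_Suc_append)
  have E: "0 \<le> (\<Sum>j\<le>m. e j)" using m by (intro sum_nonneg e0) auto
  show ?case
  proof (cases "s (Suc m) = 0")
    case True
    have "F x \<le> ennreal (approx (Suc (Suc m)) x) + ennreal (\<Sum>j\<le>Suc m. e j)" for x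
    proof -
      have "F x \<le> ennreal (approx (Suc m) x) + ennreal (\<Sum>j\<le>m. e j)" by (rule FG)
      also have "\<dots> \<le> ennreal (approx (Suc m) x) + ennreal (\<Sum>j\<le>Suc m. e j)"
        using e0[OF m(1)] by (intro add_left_mono ennreal_leI) simp
      finally show ?thesis by (simp only: approx_Suc_zero[OF m(1) True])
    qed
    then show ?thesis unfolding fold dzero[OF m(1) True] by (intro exI[of _ F]) simp
  next
    case False
    then have sp: "0 < s (Suc m)" using s[OF m(1)] by simp
    note [measurable] = fm[OF m(1) sp] mix_measurable[OF m(1) sp] Fm[THEN conjunct1]
    have am [measurable]: "approx (Suc m) \<in> borel_measurable borel"
      unfolding approx_def
      by (intro borel_measurable_sum borel_measurable_times borel_measurable_const regular_pdf_measurable partial_regular m)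
    \<comment> \<open>Reflection and translation preserve Lebesgue measure, so a constant error
      integrated against F(x - y) is returned unchanged.\<close>
    have shift: "(\<integral>\<^sup>+y. F (x - y) \<partial>lborel) = 1" for x
      using nn_integral_real_affine[of F "-1" x] Fm by simp
    have "(\<integral>\<^sup>+y. F (x - y) * f (Suc m) y \<partial>lborel) \<le> ennreal (approx (Suc (Suc m)) x) + ennreal (\<Sum>j\<le>Suc m. e j)" for x
    proof -
      have "(\<integral>\<^sup>+y. F (x - y) * f (Suc m) y \<partial>lborel) \<le>
          (\<integral>\<^sup>+y. F (x - y) * ennreal (mix (Suc m) y) + F (x - y) * ennreal (e (Suc m)) \<partial>lborel)"
        unfolding distrib_left[symmetric] by (intro nn_integral_mono mult_left_mono fe[OF m(1) sp]) simp
      also have "\<dots> = (\<integral>\<^sup>+y. F (x - y) * ennreal (mix (Suc m) y) \<partial>lborel) + ennreal (e (Suc m))"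
        by (subst nn_integral_add) (simp_all add: nn_integral_multc shift del: One_nat_def)
      also have "(\<integral>\<^sup>+y. F (x - y) * ennreal (mix (Suc m) y) \<partial>lborel) \<le>
          (\<integral>\<^sup>+y. ennreal (approx (Suc m) (x - y)) * ennreal (mix (Suc m) y) + ennreal (\<Sum>j\<le>m. e j) * ennreal (mix (Suc m) y) \<partial>lborel)"
        unfolding distrib_right[symmetric] by (intro nn_integral_mono mult_right_mono FG) simp
      also have "\<dots> = ennreal (approx (Suc (Suc m)) x) + ennreal (\<Sum>j\<le>m. e j)"
        by (subst nn_integral_add) (simp_all add: nn_integral_cmult nn_integral_mix[OF m(1) sp] approx_Suc_pos[OF m(1) sp] del: One_nat_def)
      finally have "(\<integral>\<^sup>+y. F (x - y) * f (Suc m) y \<partial>lborel) \<le>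
          ennreal (approx (Suc (Suc m)) x) + ennreal (\<Sum>j\<le>m. e j) + ennreal (e (Suc m))"
        by (simp add: add_right_mono)
      also have "\<dots> = ennreal (approx (Suc (Suc m)) x) + ennreal (\<Sum>j\<le>Suc m. e j)"
        using E e0[OF m(1)] by (simp add: ennreal_plus add.assoc)
      finally show ?thesis .
    qed
    then show ?thesis unfolding fold dpos[OF m(1) sp] by simp
  qed
qed

end

lemma ennreal_le_of_ereal_diff_le:
  assumes le: "enn2ereal a - ereal b \<le> ereal c" and "0 \<le> b" "0 \<le> c"
  shows "a \<le> ennreal b + ennreal c"
proof -
  have "enn2ereal a \<le> ereal (b + c)"
    using le by (cases "enn2ereal a") (auto simp: algebra_simps)
  also have "ereal (b + c) = enn2ereal (ennreal b + ennreal c)"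
    using assms by (simp add: enn2ereal_ennreal flip: ennreal_plus)
  finally show ?thesis by (simp add: less_eq_ennreal.rep_eq)
qed

text \<open>If the supremum were negative, g would lie above a positive constant on the whole line
  and have infinite mass. Nonnegativity of the component bounds keeps their extended sum free of
  opposite infinities.\<close>

lemma SUP_density_difference_nonneg:
  fixes g :: "real \<Rightarrow> real"
  assumes int: "(\<integral>\<^sup>+y. ennreal (g y) \<partial>lborel) = 1"
  shows "0 \<le> (SUP y. enn2ereal (f y) - ereal (g y))"
proof (rule ccontr)
  assume "\<not> 0 \<le> (SUP y. enn2ereal (f y) - ereal (g y))"
  then have "(SUP y. enn2ereal (f y) - ereal (g y)) < 0" by (simp only: not_le)
  then obtain r where r: "(SUP y. enn2ereal (f y) - ereal (g y)) < ereal r" "ereal r < 0"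
    using ereal_dense2 by blast
  have "ennreal (- r) \<le> ennreal (g y)" for y
  proof (rule ennreal_leI)
    have "enn2ereal (f y) - ereal (g y) \<le> ereal r"
      using order_trans[OF SUP_upper less_imp_le[OF r(1)], of y] by simp
    moreover have "0 \<le> enn2ereal (f y)" by simp
    ultimately show "- r \<le> g y" by (cases "enn2ereal (f y)") auto
  qed
  then have "(\<integral>\<^sup>+y. ennreal (- r) \<partial>(lborel :: real measure)) \<le> (\<integral>\<^sup>+y. ennreal (g y) \<partial>lborel)"
    by (intro nn_integral_mono)
  then show False using r(2) int by (simp add: ennreal_mult_top top_unique)
qed


lemma clock_nonneg:
  assumes "j \<le> M" "\<forall>j<M. \<tau> j < \<tau> (Suc j)"
  shows "0 \<le> clock M \<tau> j t"
  using assms by (auto simp: clock_def less_imp_le)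

text \<open>Component 0 runs from time 0 on. For positive t the first factor of the convolution is
  therefore an ordinary density, and Dirac factors can only follow it.\<close>

lemma clock_0_pos:
  assumes "\<tau> 0 = 0" "\<forall>j<M. \<tau> j < \<tau> (Suc j)" "0 < t"
  shows "0 < clock M \<tau> 0 t"
proof (cases "M = 0")
  case False
  then have "\<tau> 0 < \<tau> (Suc 0)" using assms(2) by blast
  then show ?thesis using assms by (auto simp: clock_def)
qed (use assms in \<open>simp add: clock_def\<close>)

section \<open>Composite density and quadrature error\<close>

theorem theorem3p2:
  fixes \<Omega> :: "'a measure" and M :: nat and x0 lam t :: real and F :: "real \<Rightarrow> real"
    and W :: "nat \<Rightarrow> real \<Rightarrow> 'a \<Rightarrow> real" and P :: "nat \<Rightarrow> real \<Rightarrow> 'a \<Rightarrow> nat"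
    and \<eta> :: "nat \<Rightarrow> nat \<Rightarrow> 'a \<Rightarrow> real" and \<theta> :: "nat \<Rightarrow> 'a \<Rightarrow> real"
    and b \<sigma> :: "nat \<Rightarrow> real \<Rightarrow> real \<Rightarrow> real" and \<tau> :: "nat \<Rightarrow> real" and D :: "nat \<Rightarrow> real set"
    and Y :: "nat \<Rightarrow> real \<Rightarrow> real \<Rightarrow> 'a \<Rightarrow> real" and Yr :: "nat \<Rightarrow> real \<Rightarrow> 'a \<Rightarrow> real"
  defines "s \<equiv> \<lambda>j. clock M \<tau> j t"
  assumes prob: "prob_space \<Omega>"
    and lam: "0 \<le> lam"
    and bm: "\<forall>j\<le>M. standard_brownian_motion \<Omega> (W j)"
    and poisson: "\<forall>j\<le>M. poisson_process \<Omega> lam (P j)"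
    and jumps: "\<forall>j\<le>M. \<forall>i\<ge>1. \<eta> j i \<in> borel_measurable \<Omega> \<and> cdf (distr \<Omega> borel (\<eta> j i)) = F"
    and randomisers: "\<forall>j\<le>M. has_pdf \<Omega> (\<theta> j)"
    and domains: "\<forall>j\<le>M. D j \<in> sets borel \<and> (AE \<omega> in \<Omega>. \<theta> j \<omega> \<in> D j)"
    and indep: "prob_space.indep_sets \<Omega> (source_events \<Omega> W P \<eta> \<theta>) (sources M)"
    and drift: "\<forall>j\<le>M. admissible_coefficient 1 (b j)"
    and volatility: "\<forall>j\<le>M. admissible_coefficient 2 (\<sigma> j)"
    and conditional: "\<forall>j\<le>M. \<forall>z. component_process \<Omega> (b j) (\<sigma> j) (W j) (P j) (\<eta> j) (\<lambda>_. z) (Y j z)"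
    and randomised: "\<forall>j\<le>M. component_process \<Omega> (b j) (\<sigma> j) (W j) (P j) (\<eta> j) (\<theta> j) (Yr j)"
    and switching: "\<tau> 0 = 0" "\<forall>j<M. \<tau> j < \<tau> (Suc j)"
    and t: "0 \<le> t"
    and densities: "\<forall>j\<le>M. s j > 0 \<longrightarrow> (\<forall>z\<in>D j. has_pdf \<Omega> (Y j z (s j)))"
  shows
    "((\<forall>j\<le>M. has_gen_density \<Omega> (Yr j (s j)) (randomised_density \<Omega> (D j) (\<theta> j) (Y j) (s j))) \<and>
      has_gen_density \<Omega> (composite_process M x0 \<tau> Yr t) (composite_density \<Omega> M x0 \<tau> D \<theta> Y t))
     \<and>
     (\<forall>(N :: nat \<Rightarrow> nat) (w :: nat \<Rightarrow> nat \<Rightarrow> real) (q :: nat \<Rightarrow> nat \<Rightarrow> real).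
        0 < t \<and>
        (\<forall>j\<le>M. 1 \<le> N j \<and> integrable \<Omega> (\<lambda>\<omega>. \<theta> j \<omega> ^ (2 * N j)) \<and>
            gauss_quadrature (distr \<Omega> borel (\<theta> j)) (N j) (w j) (q j) \<and>
            (s j > 0 \<longrightarrow> (\<forall>n\<in>{1..N j}. has_pdf \<Omega> (Y j (q j n) (s j)))))
        \<longrightarrow>
        (\<exists>\<epsilon> :: real \<Rightarrow> ereal. \<forall>x.
            enn2ereal (density_at (composite_density \<Omega> M x0 \<tau> D \<theta> Y t) x) =
              ereal (\<Sum>n\<in>(\<Pi>\<^sub>E j\<in>{..M}. {1..N j}). (\<Prod>j\<le>M. w j (n j)) *
                pdf \<Omega> (\<lambda>\<omega>. x0 + (\<Sum>j\<le>M. Y j (q j (n j)) (s j) \<omega>)) x) + \<epsilon> x \<and>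
            enn2ereal (density_at (composite_density \<Omega> M x0 \<tau> D \<theta> Y t) x) =
              ereal (\<Sum>n\<in>(\<Pi>\<^sub>E j\<in>{..M}. {1..N j}). (\<Prod>j\<le>M. w j (n j)) *
                pdf \<Omega> (composite_process M x0 \<tau> (\<lambda>j. Y j (q j (n j))) t) x) + \<epsilon> x \<and>
            \<epsilon> x \<le> (\<Sum>j\<le>M. SUP y. quadrature_error \<Omega> (D j) (\<theta> j) (Y j) (N j) (w j) (q j) (s j) y)))"
    (is "?law \<and> (\<forall>N w q. ?hyp N w q \<longrightarrow> ?concl N w q)")
proof -
  interpret driving_sources \<Omega> M lam W P \<eta> \<theta>
    using prob bm poisson jumps randomisers indep
    by (auto intro!: driving_sources.intro driving_sources_axioms.intro simp: has_pdf_def)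
  have s_nonneg: "j \<le> M \<Longrightarrow> 0 \<le> s j" for j
    unfolding s_def by (rule clock_nonneg) (use switching in auto)
  have cY: "component \<Omega> (W j) (\<lambda>_. z) (P j) (\<eta> j) lam (b j) (\<sigma> j) (Y j z)" if "j \<le> M" for j z
    using component_constant that drift volatility conditional by blast
  have cYr: "component \<Omega> (W j) (\<theta> j) (P j) (\<eta> j) lam (b j) (\<sigma> j) (Yr j)" if "j \<le> M" for j
    using component_random that drift volatility randomised by blast
  define d where "d j = randomised_density \<Omega> (D j) (\<theta> j) (Y j) (s j)" for j
  define f where "f j y = (\<integral>\<^sup>+z\<in>D j. ennreal (pdf \<Omega> (Y j z (s j)) y) \<partial>distr \<Omega> borel (\<theta> j))" for j y
  have d_zero: "d j = Dirac 0" if "s j = 0" for j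
    using that by (simp add: d_def randomised_density_def)
  have d_pos: "d j = Density (f j)" if "0 < s j" for j
    using that by (simp add: d_def randomised_density_def f_def[abs_def])
  have f_dist: "distributed \<Omega> lborel (Yr j (s j)) (f j)" if "j \<le> M" "0 < s j" for j
    unfolding f_def[abs_def]
    by (rule random_component_distributed[OF cYr])
       (use that domains densities cY in auto)
  have d: "has_gen_density \<Omega> (Yr j (s j)) (d j)" if j: "j \<le> M" for j
  proof (cases "s j = 0")
    case True
    have m: "Yr j (s j) \<in> borel_measurable \<Omega>"
      using randomised j s_nonneg[OF j] by (auto simp: component_process_def)
    have "AE \<omega> in \<Omega>. Yr j (s j) \<omega> = 0" unfolding True by (rule component_zero[OF cYr[OF j]])
    with m have "distr \<Omega> borel (Yr j (s j)) = distr \<Omega> borel (\<lambda>_. 0)"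
      by (intro distr_cong_AE_borel) auto
    also have "\<dots> = return borel 0" by (rule distr_const) simp
    finally show ?thesis using m by (simp add: d_zero True)
  next
    case False
    then have "0 < s j" using s_nonneg[OF j] by simp
    then show ?thesis using f_dist[OF j] by (simp add: d_pos)
  qed
  have composite: "composite_density \<Omega> M x0 \<tau> D \<theta> Y t = foldl conv (Dirac x0) (map d [0..<Suc M])"
    by (simp add: composite_density_def d_def[abs_def] s_def)
  have indYr: "indep_vars (\<lambda>_. borel) (\<lambda>j. Yr j (s j)) {..M}"
    by (rule indep_vars_components[where \<zeta> = \<theta>, OF cYr]) (simp_all add: s_nonneg)
  have fold: "has_gen_density \<Omega> (\<lambda>\<omega>. x0 + (\<Sum>j<m. Yr j (s j) \<omega>)) (foldl conv (Dirac x0) (map d [0..<m]))"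
    if "m \<le> Suc M" for m
    by (rule has_gen_density_foldl_conv[OF indYr d that])
  have law: ?law
    using fold[of "Suc M"] d
    by (simp add: composite d_def composite_process_def[abs_def] s_def lessThan_Suc_atMost del: upt_Suc)
  moreover have "?concl N w q" if hyp: "?hyp N w q" for N w q
  proof -
    define X where "X j i = Y j (q j i) (s j)" for j i
    define g where "g j y = (\<Sum>i=1..N j. w j i * pdf \<Omega> (X j i) y)" for j y
    define E where "E j = (SUP y. quadrature_error \<Omega> (D j) (\<theta> j) (Y j) (N j) (w j) (q j) (s j) y)" for j
    define S where "S x = (\<Sum>n\<in>(\<Pi>\<^sub>E j\<in>{..M}. {1..N j}). (\<Prod>j\<le>M. w j (n j)) *
        pdf \<Omega> (\<lambda>\<omega>. x0 + (\<Sum>j\<le>M. Y j (q j (n j)) (s j) \<omega>)) x)" for x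
    define L where "L x = density_at (composite_density \<Omega> M x0 \<tau> D \<theta> Y t) x" for x
    have tpos: "0 < t" using hyp by blast
    have s0: "0 < s 0" unfolding s_def by (rule clock_0_pos[OF switching tpos])
    have Npos: "1 \<le> N j" and gq: "gauss_quadrature (distr \<Omega> borel (\<theta> j)) (N j) (w j) (q j)" if "j \<le> M" for j
      using hyp that by auto
    have Z: "prob_space (distr \<Omega> borel (\<theta> j))" if "j \<le> M" for j
      by (rule prob_space_distr) (rule randomiser[OF that])
    have w1: "(\<Sum>i=1..N j. w j i) = 1" if "j \<le> M" for j
      by (rule gauss_quadrature_weights(1)[OF gq Npos Z]) (fact that)+
    have w0: "0 \<le> w j i" if "j \<le> M" "i \<in> {1..N j}" for j i
      by (rule gauss_quadrature_weights(2)[OF gq Npos Z that(2)]) (fact that)+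
    \<comment> \<open>The densities at the nodes come from the quadrature hypothesis, as a node is
      not assumed to lie in \<open>D j\<close>.\<close>
    have Xreg: "regular_pdf \<Omega> (X j i)" if "j \<le> M" "0 < s j" "i \<in> {1..N j}" for j i
      unfolding X_def by (rule constant_component_regular_pdf(1)[OF cY]) (use that hyp in auto)
    have g_int: "(\<integral>\<^sup>+y. ennreal (g j y) \<partial>lborel) = 1" if "j \<le> M" "0 < s j" for j
      unfolding g_def by (intro nn_integral_pdf_mixture w0 w1 Xreg that)
    have g_nonneg: "0 \<le> g j y" if "j \<le> M" "0 < s j" for j y
      unfolding g_def using Xreg[OF that] w0[OF that(1)]
      by (intro sum_nonneg mult_nonneg_nonneg) (auto simp: regular_pdf_def)
    \<comment> \<open>The weights sum to 1, so the coefficient of the Dirac delta is 0, and 0 times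
      its infinite value at the origin is 0.\<close>
    have E_zero: "E j = 0" if j: "j \<le> M" "s j = 0" for j
      unfolding E_def quadrature_error_def using j w1[OF j(1)] by (simp flip: zero_ereal_def)
    have E_pos: "E j = (SUP y. enn2ereal (f j y) - ereal (g j y))" if j: "j \<le> M" "0 < s j" for j
      unfolding E_def quadrature_error_def using j
      by (simp add: d_def[symmetric] d_pos g_def X_def)
    have E_nonneg: "0 \<le> E j" if j: "j \<le> M" for j
      using E_zero[OF j] E_pos[OF j] SUP_density_difference_nonneg[OF g_int[OF j], of "f j"] s_nonneg[OF j]
      by (cases "s j = 0") auto
    \<comment> \<open>An infinite component error makes the bound trivial. Otherwise all errors are
      nonnegative reals and the convolution comparison applies.\<close>
    have LE: "enn2ereal (L x) - ereal (S x) \<le> (\<Sum>j\<le>M. E j)" for x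
    proof (cases "\<exists>j\<le>M. E j = \<infinity>")
      case True
      then have "(\<Sum>j\<le>M. E j) = \<infinity>" by (subst sum_Pinfty) auto
      then show ?thesis by simp
    next
      case False
      define e where "e j = real_of_ereal (E j)" for j
      have Ee: "E j = ereal (e j)" if "j \<le> M" for j
        using False E_nonneg[OF that] that by (cases "E j") (auto simp: e_def)
      have e0: "0 \<le> e j" if "j \<le> M" for j using E_nonneg[OF that] Ee[OF that] by simp
      interpret Q: quadrature_mixture \<Omega> M x0 s N w X d f e
      proof
        fix j i assume j: "j \<le> M"
        show "X j i \<in> borel_measurable \<Omega>"
          using conditional j s_nonneg[OF j] by (auto simp: X_def component_process_def)
        show "AE \<omega> in \<Omega>. X j i \<omega> = 0" if "s j = 0"
          unfolding X_def that by (rule component_zero[OF cY[OF j]])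
      next
        fix n :: "nat \<Rightarrow> nat"
        show "indep_vars (\<lambda>_. borel) (\<lambda>j. X j (n j)) {..M}"
          unfolding X_def
          by (rule indep_vars_components[where \<zeta> = "\<lambda>j _. q j (n j)" and Y = "\<lambda>j. Y j (q j (n j))", OF cY])
             (auto simp: s_nonneg)
      next
        \<comment> \<open>Measurability and mass 1 of the partial convolution are read off from part
          (i): it is the density of x0 plus the first randomised components.\<close>
        fix m G assume m: "m \<le> M" and G: "foldl conv (Dirac x0) (map d [0..<Suc m]) = Density G"
        then have G': "distributed \<Omega> lborel (\<lambda>\<omega>. x0 + (\<Sum>j<Suc m. Yr j (s j) \<omega>)) G"
          using fold[of "Suc m"] by simp
        then show "G \<in> borel_measurable borel \<and> (\<integral>\<^sup>+x. G x \<partial>lborel) = 1"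
          using distributed_borel_measurable[OF G'] distributed_nn_integral[OF G', of "\<lambda>_. 1"]
          by (simp add: emeasure_space_1)
      next
        fix j y assume j: "j \<le> M" "0 < s j"
        show "f j \<in> borel_measurable borel"
          using distributed_borel_measurable[OF f_dist[OF j]] by simp
        have "enn2ereal (f j y) - ereal (g j y) \<le> ereal (e j)"
          unfolding Ee[OF j(1), symmetric] E_pos[OF j] by (rule SUP_upper) simp
        from ennreal_le_of_ereal_diff_le[OF this g_nonneg[OF j] e0[OF j(1)]]
        show "f j y \<le> ennreal (\<Sum>i=1..N j. w j i * pdf \<Omega> (X j i) y) + ennreal (e j)"
          by (simp add: g_def)
      qed (use s0 s_nonneg w1 w0 Xreg d_zero d_pos e0 in auto)
      obtain G where G: "foldl conv (Dirac x0) (map d [0..<Suc M]) = Density G"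
        and GE: "\<And>x. G x \<le> ennreal (Q.approx (Suc M) x) + ennreal (\<Sum>j\<le>M. e j)"
        using Q.convolution_le_approx[OF order_refl] by blast
      have "L x = G x" by (simp only: L_def composite G density_at.simps)
      moreover have "Q.approx (Suc M) x = S x"
        unfolding Q.approx_def S_def lessThan_Suc_atMost
        by (simp add: Q.partial_def[abs_def] X_def lessThan_Suc_atMost)
      moreover have "0 \<le> Q.approx (Suc M) x" by (rule Q.approx_nonneg) simp
      moreover have "0 \<le> (\<Sum>j\<le>M. e j)" using e0 by (intro sum_nonneg) auto
      ultimately have "L x \<le> ennreal (S x + (\<Sum>j\<le>M. e j))" "0 \<le> S x + (\<Sum>j\<le>M. e j)"
        using GE[of x] by (simp_all add: ennreal_plus)
      then have "enn2ereal (L x) \<le> ereal (S x + (\<Sum>j\<le>M. e j))"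
        by (simp add: less_eq_ennreal.rep_eq enn2ereal_ennreal)
      moreover have "(\<Sum>j\<le>M. E j) = ereal (\<Sum>j\<le>M. e j)"
        by (simp add: Ee sum_ereal[symmetric] del: sum_ereal)
      ultimately show ?thesis by (cases "enn2ereal (L x)") (auto simp: algebra_simps)
    qed
    \<comment> \<open>The error term is taken to be the difference itself. This is legitimate in
      \<open>ereal\<close> because S is real, even where L is infinite.\<close>
    have split: "enn2ereal (L x) = ereal (S x) + (enn2ereal (L x) - ereal (S x))" for x
      by (cases "enn2ereal (L x)") auto
    have S': "(\<Sum>n\<in>(\<Pi>\<^sub>E j\<in>{..M}. {1..N j}). (\<Prod>j\<le>M. w j (n j)) *
        pdf \<Omega> (composite_process M x0 \<tau> (\<lambda>j. Y j (q j (n j))) t) x) = S x" for x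
      by (simp add: S_def composite_process_def[abs_def] s_def)
    show ?thesis
      unfolding S' S_def[symmetric] E_def[symmetric] L_def[symmetric]
      by (intro exI[of _ "\<lambda>x. enn2ereal (L x) - ereal (S x)"] allI conjI split LE)
  qed
  ultimately show ?thesis by blast
qed

end
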